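(* Let $k$ be a field of characteristic $0$, $R=k[x_1,\ldots,x_n]$, and let $I\subset R$ be a homogeneous Artinian ideal, with $f_2,\ldots,f_n$ and $J_1,\ldots,J_{n-1}$ defined for $\mathrm{gin}(I)$ as in the context. Then $\mathrm{gin}(I)$ is almost reverse lexicographic if and only if: (1) for every $0\le i\le n-3$, there exist generic linear forms $L_1,\ldots,L_i$ in $R$ such that $R/(I+(L_1,\ldots,L_i))$ has the strong Lefschetz property; and (2) for each $3\le i\le n-1$, whenever $\alpha=(\alpha_1,\ldots,\alpha_i)$ and $\beta=(\beta_1,\ldots,\beta_i)$ are elements of $J_i$ with $|\alpha|=|\beta|$ and $\alpha<\beta$, we have $f_{i+1}(\beta)\le f_{i+1}(\alpha)$.
   Context: Monomials of $R$ are ordered by the degree reverse lexicographic order with $x_1>\cdots>x_n$; $\mathrm{gin}(I)$ is the generic initial ideal of $I$ with respect to this order. A homogeneous ideal is Artinian if the quotient is finite-dimensional over $k$. A monomial ideal $J$ is almost reverse lexicographic if for every minimal generator $m$ of $J$ and every monomial $M$ with $\deg M=\deg m$ and $M>m$, we have $M\in J$. A standard graded Artinian algebra $A=\bigoplus_d A_d$ has the strong Lefschetz property if there is a linear form $L$ such that for all $d$ and $i$ the multiplication map $\times L^i:A_d\to A_{d+i}$ is injective or surjective. "Generic linear forms" means linear forms chosen from a suitable nonempty Zariski-open subset of the space of tuples of linear forms (for $i=0$ no forms are added). Define $f_1=\min\{t\mid x_1^t\in\mathrm{gin}(I)\}$ and for $2\le i\le n$, $f_i(\alpha_1,\ldots,\alpha_{i-1})=\min\{t\ge0\mid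 x_1^{\alpha_1}\cdots x_{i-1}^{\alpha_{i-1}}x_i^t\in\mathrm{gin}(I)\}$ (value $\infty$ if none). For $1\le i\le n-1$, $J_i=\{(\alpha_1,\ldots,\alpha_i)\in\mathbb{Z}_{\ge0}^i\mid \alpha_1<f_1,\ \alpha_j<f_j(\alpha_1,\ldots,\alpha_{j-1})\text{ for }2\le j\le i\}$. $|\alpha|=\sum_j\alpha_j$, and $\alpha<\beta$ means $x_1^{\alpha_1}\cdots x_i^{\alpha_i}<x_1^{\beta_1}\cdots x_i^{\beta_i}$ in the reverse lexicographic order. *)

theory Defs
  imports Main "HOL-Library.Poly_Mapping" "HOL-Library.Extended_Nat"
begin

text \<open>Polynomials in variables x_0, x_1, ... (the paper's x_1,...,x_n are x_0,...,x_(n-1)).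
  A monomial is an exponent vector; a polynomial is a finitely supported map from monomials to k.\<close>

type_synonym mon = "nat \<Rightarrow>\<^sub>0 nat"
type_synonym 'k mpoly = "mon \<Rightarrow>\<^sub>0 'k"

definition mdeg :: "mon \<Rightarrow> nat" where
  "mdeg m = (\<Sum>j\<in>Poly_Mapping.keys m. Poly_Mapping.lookup m j)"

definition var_mon :: "nat \<Rightarrow> mon" where
  "var_mon j = Poly_Mapping.single j 1"

definition const :: "'k::comm_ring_1 \<Rightarrow> 'k mpoly" where
  "const c = Poly_Mapping.single 0 c"

definition Var :: "nat \<Rightarrow> 'k::comm_ring_1 mpoly" where
  "Var j = Poly_Mapping.single (var_mon j) 1"

definition polyR :: "nat \<Rightarrow> 'k::comm_ring_1 mpoly set" where
  "polyR n = {p. \<forall>m\<in>Poly_Mapping.keys p. Poly_Mapping.keys m \<subseteq> {..<n}}"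

definition homog_of_deg :: "nat \<Rightarrow> 'k::comm_ring_1 mpoly \<Rightarrow> bool" where
  "homog_of_deg d p \<longleftrightarrow> (\<forall>m\<in>Poly_Mapping.keys p. mdeg m = d)"

definition homog_comp :: "nat \<Rightarrow> 'k::comm_ring_1 mpoly \<Rightarrow> 'k mpoly" where
  "homog_comp d p = (\<Sum>m\<in>{m\<in>Poly_Mapping.keys p. mdeg m = d}. Poly_Mapping.single m (Poly_Mapping.lookup p m))"

definition is_ideal :: "nat \<Rightarrow> 'k::comm_ring_1 mpoly set \<Rightarrow> bool" where
  "is_ideal n I \<longleftrightarrow> I \<subseteq> polyR n \<and> 0 \<in> I \<and> (\<forall>p\<in>I. \<forall>q\<in>I. p + q \<in> I)
      \<and> (\<forall>r\<in>polyR n. \<forall>p\<in>I. r * p \<in> I)"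

definition homogeneous_ideal :: "'k::comm_ring_1 mpoly set \<Rightarrow> bool" where
  "homogeneous_ideal I \<longleftrightarrow> (\<forall>p\<in>I. \<forall>d. homog_comp d p \<in> I)"

definition artinian :: "nat \<Rightarrow> 'k::comm_ring_1 mpoly set \<Rightarrow> bool" where
  "artinian n I \<longleftrightarrow> (\<exists>B. finite B \<and> B \<subseteq> polyR n \<and>
      (\<forall>p\<in>polyR n. \<exists>c. p - (\<Sum>b\<in>B. const (c b) * b) \<in> I))"

text \<open>Degree reverse lexicographic order with x_0 > x_1 > ...: strict "greater than".\<close>
definition mon_gt :: "mon \<Rightarrow> mon \<Rightarrow> bool" where
  "mon_gt m m' \<longleftrightarrow> mdeg m > mdeg m' \<or>
     (mdeg m = mdeg m' \<and> m \<noteq> m' \<and>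
       Poly_Mapping.lookup m (Max {j. Poly_Mapping.lookup m j \<noteq> Poly_Mapping.lookup m' j}) < Poly_Mapping.lookup m' (Max {j. Poly_Mapping.lookup m j \<noteq> Poly_Mapping.lookup m' j}))"

definition lm :: "'k::comm_ring_1 mpoly \<Rightarrow> mon" where
  "lm p = (THE m. m \<in> Poly_Mapping.keys p \<and> (\<forall>m'\<in>Poly_Mapping.keys p. m' \<noteq> m \<longrightarrow> mon_gt m m'))"

definition mon_dvd :: "mon \<Rightarrow> mon \<Rightarrow> bool" where
  "mon_dvd m m' \<longleftrightarrow> (\<exists>q. m' = m + q)"

text \<open>The monomials of the initial ideal in(J) (a monomial ideal is determined by its monomials).\<close>
definition init_mons :: "nat \<Rightarrow> 'k::comm_ring_1 mpoly set \<Rightarrow> mon set" where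
  "init_mons n J = {m. Poly_Mapping.keys m \<subseteq> {..<n} \<and> (\<exists>p\<in>J. p \<noteq> 0 \<and> mon_dvd (lm p) m)}"

definition eval :: "'k::comm_ring_1 mpoly \<Rightarrow> (nat \<Rightarrow> 'k) \<Rightarrow> 'k" where
  "eval p v = (\<Sum>m\<in>Poly_Mapping.keys p. Poly_Mapping.lookup p m * (\<Prod>j\<in>Poly_Mapping.keys m. v j ^ Poly_Mapping.lookup m j))"

definition subst :: "(nat \<Rightarrow> 'k::comm_ring_1 mpoly) \<Rightarrow> 'k mpoly \<Rightarrow> 'k mpoly" where
  "subst \<sigma> p = (\<Sum>m\<in>Poly_Mapping.keys p. const (Poly_Mapping.lookup p m) * (\<Prod>j\<in>Poly_Mapping.keys m. \<sigma> j ^ Poly_Mapping.lookup m j))"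

text \<open>Zariski-open subsets of k^N (points are functions nat => k, only coordinates < N matter).\<close>
definition zariski_open :: "nat \<Rightarrow> (nat \<Rightarrow> 'k::comm_ring_1) set \<Rightarrow> bool" where
  "zariski_open N U \<longleftrightarrow> (\<exists>S. S \<subseteq> polyR N \<and> U = {v. \<exists>h\<in>S. eval h v \<noteq> 0})"

definition generic :: "nat \<Rightarrow> ((nat \<Rightarrow> 'k::comm_ring_1) \<Rightarrow> bool) \<Rightarrow> bool" where
  "generic N P \<longleftrightarrow> (\<exists>U. zariski_open N U \<and> U \<noteq> {} \<and> (\<forall>v\<in>U. P v))"

text \<open>An n x n matrix g with entries g(l,j) = v(l*n+j), acting by x_j |-> sum_l g(l,j) x_l.\<close>
definition mat_invertible :: "nat \<Rightarrow> (nat \<Rightarrow> 'k::comm_ring_1) \<Rightarrow> bool" where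
  "mat_invertible n v \<longleftrightarrow> (\<forall>c. (\<forall>l<n. (\<Sum>j<n. v (l*n+j) * c j) = 0) \<longrightarrow> (\<forall>j<n. c j = 0))"

definition gsubst :: "nat \<Rightarrow> (nat \<Rightarrow> 'k::comm_ring_1) \<Rightarrow> nat \<Rightarrow> 'k mpoly" where
  "gsubst n v j = (if j < n then (\<Sum>l<n. const (v (l*n+j)) * Var l) else Var j)"

definition gact :: "nat \<Rightarrow> (nat \<Rightarrow> 'k::comm_ring_1) \<Rightarrow> 'k mpoly set \<Rightarrow> 'k mpoly set" where
  "gact n v I = subst (gsubst n v) ` I"

definition gin :: "nat \<Rightarrow> 'k::comm_ring_1 mpoly set \<Rightarrow> mon set" where
  "gin n I = (THE G. generic (n*n) (\<lambda>v. mat_invertible n v \<and> init_mons n (gact n v I) = G))"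

definition min_gen :: "mon set \<Rightarrow> mon \<Rightarrow> bool" where
  "min_gen G m \<longleftrightarrow> m \<in> G \<and> \<not> (\<exists>m'\<in>G. mon_dvd m' m \<and> m' \<noteq> m)"

definition almost_revlex :: "nat \<Rightarrow> mon set \<Rightarrow> bool" where
  "almost_revlex n G \<longleftrightarrow> (\<forall>m. min_gen G m \<longrightarrow>
      (\<forall>M. Poly_Mapping.keys M \<subseteq> {..<n} \<and> mdeg M = mdeg m \<and> mon_gt M m \<longrightarrow> M \<in> G))"

text \<open>f_i(alpha_1..alpha_(i-1)) with alpha a list of length i-1; f_1 is the case alpha = [].\<close>
definition fval :: "mon set \<Rightarrow> nat list \<Rightarrow> enat" where
  "fval G \<alpha> = (if \<exists>t. Poly_Mapping.nth \<alpha> + Poly_Mapping.single (length \<alpha>) (t::nat) \<in> G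
      then enat (LEAST t. Poly_Mapping.nth \<alpha> + Poly_Mapping.single (length \<alpha>) (t::nat) \<in> G) else \<infinity>)"

definition Jset :: "mon set \<Rightarrow> nat \<Rightarrow> nat list set" where
  "Jset G i = {\<alpha>. length \<alpha> = i \<and> (\<forall>j<i. enat (\<alpha> ! j) < fval G (take j \<alpha>))}"

definition slp :: "nat \<Rightarrow> 'k::comm_ring_1 mpoly set \<Rightarrow> bool" where
  "slp n J \<longleftrightarrow> (\<exists>L\<in>polyR n. homog_of_deg 1 L \<and> (\<forall>d i.
      (\<forall>p\<in>polyR n. homog_of_deg d p \<longrightarrow> L ^ i * p \<in> J \<longrightarrow> p \<in> J) \<or>
      (\<forall>q\<in>polyR n. homog_of_deg (d + i) q \<longrightarrow>
          (\<exists>p\<in>polyR n. homog_of_deg d p \<and> q - L ^ i * p \<in> J))))"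

definition lin :: "nat \<Rightarrow> (nat \<Rightarrow> 'k::comm_ring_1) \<Rightarrow> nat \<Rightarrow> 'k mpoly" where
  "lin n v j = (\<Sum>l<n. const (v (j*n+l)) * Var l)"

definition ideal_plus :: "nat \<Rightarrow> 'k::comm_ring_1 mpoly set \<Rightarrow> (nat \<Rightarrow> 'k mpoly) \<Rightarrow> nat \<Rightarrow> 'k mpoly set" where
  "ideal_plus n I Ls i = {p + (\<Sum>j<i. r j * Ls j) | p r. p \<in> I \<and> (\<forall>j<i. r j \<in> polyR n)}"

end

theory Submission
  imports Defs "HOL-Computational_Algebra.Polynomial" "HOL-Library.FuncSet"
begin

text \<open>
  Let G be the generic initial ideal. In the reverse lexicographic order, killing general linear forms and multiplying by a power of another one is, after a general change of coordinates,
  visible on monomials: it corresponds to killing the last variables and multiplying by the last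
  remaining variable x_m modulo G. The standard monomials then split into strings
  a, a x_m, ..., a x_m^(f_m(a)-1), so multiplication by x_m^e has maximal rank for all e and in
  all degrees iff no string both starts and ends strictly before another one. This compares f_m on
  monomials a of different degrees. In equal degree the comparison is condition (2), except when a
  involves at most two variables, where it follows from strong stability of G.

  Genericity is handled by lower semicontinuity of dimensions of spans of polynomial families.
  The generic initial ideal is read off at a coordinate change maximising finitely many such
  dimensions, and these are semicontinuous both in the coordinate change and in its inverse; this
  relates the matrix entries used to define G to the coefficients of the general linear forms
  without inverting a generic matrix.
  Strong stability comes from the first-order term in t of the substitution x_b := x_b + t x_a.
\<close>

text \<open>The forms L_1, ..., L_i and the coordinate change behind G are generic for unrelated
  reasons, and for given forms a Lefschetz element is only known to exist; it may be special. For
  fixed forms, however, the Lefschetz elements form an open set: the Artinian hypothesis leaves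
  finitely many degrees, and in each of them maximal rank is an open condition. The element can
  therefore be replaced by the next row of a generic matrix, which is what the monomial criterion
  needs. The bounds 3 in both conditions come from a minimal generator with last variable x_j and a
  larger monomial of the same degree. If their exponents of x_j differ, the Lefschetz condition in j
  variables is applied; for j at most 2, strong stability or a degree count suffices. If the
  exponents agree, the comparison concerns monomials in x_1, ..., x_(j-1), and strong stability
  suffices when j - 1 is at most 2.\<close>

abbreviation lookup :: "('a \<Rightarrow>\<^sub>0 'b::zero) \<Rightarrow> 'a \<Rightarrow> 'b" where "lookup \<equiv> Poly_Mapping.lookup"
abbreviation keys :: "('a \<Rightarrow>\<^sub>0 'b::zero) \<Rightarrow> 'a set" where "keys \<equiv> Poly_Mapping.keys"
abbreviation single :: "'a \<Rightarrow> 'b \<Rightarrow> 'a \<Rightarrow>\<^sub>0 'b::zero" where "single \<equiv> Poly_Mapping.single"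

section \<open>Monomials\<close>

lemma mdeg_superset:
  assumes "finite S" "keys m \<subseteq> S"
  shows "mdeg m = (\<Sum>j\<in>S. lookup m j)"
  unfolding mdeg_def using assms
  by (intro sum.mono_neutral_left) (auto simp: in_keys_iff)

lemma keys_add_mon: "keys (a + b) = keys a \<union> keys (b::mon)"
  by (auto simp: in_keys_iff lookup_add)

lemma mdeg_add [simp]: "mdeg (a + b) = mdeg a + mdeg b"
proof -
  let ?S = "keys a \<union> keys b"
  have "mdeg (a + b) = (\<Sum>j\<in>?S. lookup (a + b) j)" by (rule mdeg_superset) (auto simp: keys_add_mon)
  moreover have "mdeg a = (\<Sum>j\<in>?S. lookup a j)" "mdeg b = (\<Sum>j\<in>?S. lookup b j)"
    by (rule mdeg_superset; auto)+
  ultimately show ?thesis by (simp add: lookup_add sum.distrib)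
qed

lemma mdeg_single [simp]: "mdeg (single j e) = e"
  by (subst mdeg_superset[of "{j}"]) auto

lemma mdeg_zero [simp]: "mdeg 0 = 0"
  by (simp add: mdeg_def)

lemma lookup_le_mdeg: "lookup m j \<le> mdeg m"
  by (cases "j \<in> keys m") (auto simp: mdeg_def in_keys_iff intro: member_le_sum)

lemma mdeg_eq_0_iff: "mdeg m = 0 \<longleftrightarrow> m = 0"
  by (metis le_zero_eq lookup_le_mdeg lookup_zero mdeg_zero poly_mapping_eqI)

definition monset :: "nat \<Rightarrow> nat \<Rightarrow> mon set" where
  "monset n d = {m. keys m \<subseteq> {..<n} \<and> mdeg m = d}"

lemma finite_monset: "finite (monset n d)"
proof (rule finite_imageD)
  let ?f = "\<lambda>m. restrict (lookup m) {..<n}"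
  have "?f ` monset n d \<subseteq> {..<n} \<rightarrow>\<^sub>E {..d}"
    by (auto simp: monset_def PiE_iff lookup_le_mdeg split: if_splits)
  then show "finite (?f ` monset n d)" by (rule finite_subset) (auto intro: finite_PiE)
  show "inj_on ?f (monset n d)"
  proof (rule inj_onI)
    fix a b assume a: "a \<in> monset n d" "b \<in> monset n d" "?f a = ?f b"
    show "a = b"
    proof (rule poly_mapping_eqI)
      fix j show "lookup a j = lookup b j"
      proof (cases "j < n")
        case True
        then show ?thesis using fun_cong[OF a(3), of j] by simp
      next
        case False
        then show ?thesis using a(1,2) by (auto simp: monset_def in_keys_iff subset_iff) (metis not_gr0)
      qed
    qed
  qed
qed

section \<open>The degree reverse lexicographic order\<close>

lemma finite_diff_mon: "finite {j. lookup m j \<noteq> lookup (m'::mon) j}"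
  by (rule finite_subset[of _ "keys m \<union> keys m'"]) (auto simp: in_keys_iff)

text \<open>The index in the existential form is forced to be the last one where the exponents
  differ, so it agrees with the \<open>Max\<close> in the definition. Transitivity and compatibility
  with products are read off from this form.\<close>

lemma mon_gt_iff:
  "mon_gt m m' \<longleftrightarrow> mdeg m > mdeg m' \<or> (mdeg m = mdeg m' \<and>
     (\<exists>j. lookup m j < lookup m' j \<and> (\<forall>l>j. lookup m l = lookup m' l)))"
proof -
  let ?D = "{j. lookup m j \<noteq> lookup m' j}"
  have "(m \<noteq> m' \<and> lookup m (Max ?D) < lookup m' (Max ?D)) \<longleftrightarrow>
     (\<exists>j. lookup m j < lookup m' j \<and> (\<forall>l>j. lookup m l = lookup m' l))" (is "?L = ?R")
  proof
    assume ?L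
    have "lookup m l = lookup m' l" if "l > Max ?D" for l
      using that Max_ge[OF finite_diff_mon, of l m m'] by force
    then show ?R using \<open>?L\<close> by blast
  next
    assume ?R
    then obtain j where j: "lookup m j < lookup m' j" "\<forall>l>j. lookup m l = lookup m' l" by blast
    have "Max ?D = j"
      by (rule Max_eqI) (use j finite_diff_mon in \<open>auto simp: not_le intro: ccontr\<close>)
    then show ?L using j by auto
  qed
  then show ?thesis unfolding mon_gt_def by blast
qed

lemma mon_gt_irrefl [simp]: "\<not> mon_gt m m"
  by (simp add: mon_gt_iff)

lemma mon_gt_trans: assumes "mon_gt a b" "mon_gt b c" shows "mon_gt a c"
proof (cases "mdeg a > mdeg b \<or> mdeg b > mdeg c")
  case True
  then show ?thesis using assms by (auto simp: mon_gt_iff)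
next
  case False
  then obtain i j where i: "lookup a i < lookup b i" "\<forall>l>i. lookup a l = lookup b l"
    and j: "lookup b j < lookup c j" "\<forall>l>j. lookup b l = lookup c l"
    and d: "mdeg a = mdeg c"
    using assms by (auto simp: mon_gt_iff)
  have "lookup a (max i j) < lookup c (max i j) \<and> (\<forall>l>max i j. lookup a l = lookup c l)"
    using i j by (cases i j rule: linorder_cases) auto
  then show ?thesis using d by (auto simp: mon_gt_iff)
qed

lemma mon_gt_asym: "mon_gt a b \<Longrightarrow> \<not> mon_gt b a"
  using mon_gt_trans mon_gt_irrefl by blast

lemma mon_gt_linear: "a \<noteq> b \<Longrightarrow> mon_gt a b \<or> mon_gt b a"
proof -
  assume ab: "a \<noteq> b"
  let ?D = "{j. lookup a j \<noteq> lookup b j}"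
  have ne: "?D \<noteq> {}" using ab by (auto simp: poly_mapping_eq_iff fun_eq_iff)
  define j where "j = Max ?D"
  have "j \<in> ?D" unfolding j_def using ne finite_diff_mon by (intro Max_in)
  then have j1: "lookup a j \<noteq> lookup b j" by simp
  have j2: "lookup a l = lookup b l" if "l > j" for l
  proof (rule ccontr)
    assume "lookup a l \<noteq> lookup b l"
    then have "l \<le> j" unfolding j_def by (intro Max_ge finite_diff_mon) simp
    then show False using that by simp
  qed
  show ?thesis
  proof (cases "mdeg a = mdeg b")
    case True
    then show ?thesis using j1 j2 unfolding mon_gt_iff by (cases "lookup a j < lookup b j") (auto intro!: exI[of _ j])
  next
    case False
    then show ?thesis unfolding mon_gt_iff by linarith
  qed
qed

lemma mon_gt_add_iff [simp]: "mon_gt (a + c) (b + c) \<longleftrightarrow> mon_gt a b"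
  by (simp add: mon_gt_iff lookup_add)

lemma mon_gt_add_iff' [simp]: "mon_gt (c + a) (c + b) \<longleftrightarrow> mon_gt a b"
  by (simp add: mon_gt_iff lookup_add)

lemma ex_mon_max:
  assumes "finite S" "S \<noteq> {}"
  obtains m where "m \<in> S" "\<And>m'. m' \<in> S \<Longrightarrow> m' \<noteq> m \<Longrightarrow> mon_gt m m'"
proof -
  have "\<exists>m\<in>S. \<forall>m'\<in>S. m' \<noteq> m \<longrightarrow> mon_gt m m'"
    using assms
  proof (induction rule: finite_ne_induct)
    case (insert x F)
    then obtain m where m: "m \<in> F" "\<forall>m'\<in>F. m' \<noteq> m \<longrightarrow> mon_gt m m'" by blast
    show ?case
    proof (cases "mon_gt m x")
      case True then show ?thesis using m by auto
    next
      case False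
      then have "mon_gt x m" using mon_gt_linear insert.hyps m(1) by metis
      then show ?thesis using m mon_gt_trans by (metis insert_iff)
    qed
  qed auto
  then show ?thesis using that by blast
qed

text \<open>Fixing the degree leaves finitely many monomials, so the number of monomials below a
  given one is a decreasing measure.\<close>

lemma mon_wf_induct [consumes 1, case_names less]:
  assumes "m \<in> monset n d"
    and "\<And>m. m \<in> monset n d \<Longrightarrow> (\<And>m'. m' \<in> monset n d \<Longrightarrow> mon_gt m m' \<Longrightarrow> P m') \<Longrightarrow> P m"
  shows "P m"
  using assms(1)
proof (induction "card {m'\<in>monset n d. mon_gt m m'}" arbitrary: m rule: less_induct)
  case less
  show ?case
  proof (rule assms(2)[OF less.prems])
    fix m' assume m': "m' \<in> monset n d" "mon_gt m m'"
    have "{m''\<in>monset n d. mon_gt m' m''} \<subset> {m''\<in>monset n d. mon_gt m m''}"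
    proof
      show "{m''\<in>monset n d. mon_gt m' m''} \<subseteq> {m''\<in>monset n d. mon_gt m m''}"
        using m' mon_gt_trans by blast
      show "{m''\<in>monset n d. mon_gt m' m''} \<noteq> {m''\<in>monset n d. mon_gt m m''}"
        using m' mon_gt_irrefl by blast
    qed
    then have "card {m''\<in>monset n d. mon_gt m' m''} < card {m''\<in>monset n d. mon_gt m m''}"
      by (intro psubset_card_mono) (simp_all add: finite_monset)
    then show "P m'" using less.hyps m' by blast
  qed
qed

section \<open>Evaluation homomorphisms\<close>

lemma poly_mapping_sum_single: "p = (\<Sum>m\<in>keys p. single m (lookup p m))"
  by (rule poly_mapping_eqI) (auto simp: lookup_sum lookup_single when_def in_keys_iff)

definition mprod :: "(nat \<Rightarrow> 'r::comm_ring_1) \<Rightarrow> mon \<Rightarrow> 'r" where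
  "mprod \<sigma> m = (\<Prod>j\<in>keys m. \<sigma> j ^ lookup m j)"

lemma mprod_superset:
  assumes "finite S" "keys m \<subseteq> S"
  shows "mprod \<sigma> m = (\<Prod>j\<in>S. \<sigma> j ^ lookup m j)"
  unfolding mprod_def using assms
  by (intro prod.mono_neutral_left) (auto simp: in_keys_iff)

lemma mprod_add: "mprod \<sigma> (a + b) = mprod \<sigma> a * mprod \<sigma> b"
proof -
  let ?S = "keys a \<union> keys b"
  have "mprod \<sigma> (a + b) = (\<Prod>j\<in>?S. \<sigma> j ^ lookup (a + b) j)"
    by (rule mprod_superset) (auto simp: keys_add_mon)
  moreover have "mprod \<sigma> a = (\<Prod>j\<in>?S. \<sigma> j ^ lookup a j)" "mprod \<sigma> b = (\<Prod>j\<in>?S. \<sigma> j ^ lookup b j)"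
    by (rule mprod_superset; auto)+
  ultimately show ?thesis by (simp add: lookup_add power_add prod.distrib)
qed

lemma mprod_zero [simp]: "mprod \<sigma> 0 = 1"
  by (simp add: mprod_def)

lemma mprod_single [simp]: "mprod \<sigma> (single j e) = \<sigma> j ^ e"
  by (subst mprod_superset[of "{j}"]) auto

text \<open>Evaluation in the field and substitution of polynomials are the instances with
  \<open>\<phi>\<close> the identity and with \<open>\<phi>\<close> equal to \<open>const\<close>;
  multiplicativity is proved once for both.\<close>

locale coeff_hom =
  fixes \<phi> :: "'k::comm_ring_1 \<Rightarrow> 'r::comm_ring_1"
  assumes hom_add: "\<phi> (a + b) = \<phi> a + \<phi> b"
    and hom_mult: "\<phi> (a * b) = \<phi> a * \<phi> b"
    and hom_one: "\<phi> 1 = 1"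
begin

lemma hom_zero: "\<phi> 0 = 0"
  using hom_add[of 0 0] by simp

definition insertion :: "(nat \<Rightarrow> 'r) \<Rightarrow> 'k mpoly \<Rightarrow> 'r" where
  "insertion \<sigma> p = (\<Sum>m\<in>keys p. \<phi> (lookup p m) * mprod \<sigma> m)"

lemma insertion_superset:
  assumes "finite S" "keys p \<subseteq> S"
  shows "insertion \<sigma> p = (\<Sum>m\<in>S. \<phi> (lookup p m) * mprod \<sigma> m)"
  unfolding insertion_def using assms
  by (intro sum.mono_neutral_left) (auto simp: in_keys_iff hom_zero)

lemma insertion_zero [simp]: "insertion \<sigma> 0 = 0"
  by (simp add: insertion_def)

lemma insertion_single: "insertion \<sigma> (single m c) = \<phi> c * mprod \<sigma> m"
  by (subst insertion_superset[of "{m}"]) auto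

lemma insertion_add: "insertion \<sigma> (p + q) = insertion \<sigma> p + insertion \<sigma> q"
proof -
  let ?S = "keys p \<union> keys q"
  have "insertion \<sigma> (p + q) = (\<Sum>m\<in>?S. \<phi> (lookup (p + q) m) * mprod \<sigma> m)"
    by (rule insertion_superset) (auto simp: Poly_Mapping.keys_add)
  moreover have "insertion \<sigma> p = (\<Sum>m\<in>?S. \<phi> (lookup p m) * mprod \<sigma> m)"
      "insertion \<sigma> q = (\<Sum>m\<in>?S. \<phi> (lookup q m) * mprod \<sigma> m)"
    by (rule insertion_superset; auto)+
  ultimately show ?thesis by (simp add: lookup_add hom_add algebra_simps sum.distrib)
qed

lemma insertion_sum: "insertion \<sigma> (sum f A) = (\<Sum>a\<in>A. insertion \<sigma> (f a))"
  by (induction A rule: infinite_finite_induct) (auto simp: insertion_add)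

lemma insertion_mult: "insertion \<sigma> (p * q) = insertion \<sigma> p * insertion \<sigma> q"
proof -
  have "p * q = (\<Sum>a\<in>keys p. \<Sum>b\<in>keys q. single (a + b) (lookup p a * lookup q b))"
    by (subst (1) poly_mapping_sum_single[of p], subst (1) poly_mapping_sum_single[of q])
      (simp add: sum_product Poly_Mapping.mult_single)
  then have "insertion \<sigma> (p * q) =
      (\<Sum>a\<in>keys p. \<Sum>b\<in>keys q. (\<phi> (lookup p a) * mprod \<sigma> a) * (\<phi> (lookup q b) * mprod \<sigma> b))"
    by (simp add: insertion_sum insertion_single mprod_add hom_mult mult_ac)
  then show ?thesis by (simp add: insertion_def sum_product)
qed

lemma insertion_one: "insertion \<sigma> 1 = 1"
  using insertion_single[of \<sigma> 0 1] by (simp add: hom_one)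

lemma insertion_power: "insertion \<sigma> (p ^ e) = insertion \<sigma> p ^ e"
  by (induction e) (auto simp: insertion_one insertion_mult)

lemma insertion_prod: "insertion \<sigma> (prod f A) = (\<Prod>a\<in>A. insertion \<sigma> (f a))"
  by (induction A rule: infinite_finite_induct) (auto simp: insertion_mult insertion_one)

end

lemma const_add: "const (a + b) = const a + const b"
  by (simp add: const_def single_add)
lemma const_mult: "const (a * b) = const a * const b"
  by (simp add: const_def Poly_Mapping.mult_single)
lemma const_one [simp]: "const 1 = 1"
  by (simp add: const_def)
lemma const_zero [simp]: "const 0 = 0"
  by (simp add: const_def)
lemma const_mult_single [simp]: "const c * single m d = single m (c * d)"
  by (simp add: const_def Poly_Mapping.mult_single)

lemma const_uminus: "const (- a) = - const a"
  by (simp add: const_def single_uminus)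

lemma const_sum: "const (sum f A) = (\<Sum>a\<in>A. const (f a))"
  by (induction A rule: infinite_finite_induct) (auto simp: const_add)
lemma lookup_const_mult [simp]: "lookup (const c * p) m = c * lookup p m"
proof -
  have "const c * p = (\<Sum>m\<in>keys p. single m (c * lookup p m))"
    by (subst (1) poly_mapping_sum_single[of p]) (simp add: sum_distrib_left)
  then show ?thesis
    by (auto simp: lookup_sum lookup_single when_def in_keys_iff)
qed

interpretation ev: coeff_hom "\<lambda>c. c"
  by unfold_locales auto

interpretation sb: coeff_hom const
  by unfold_locales (auto simp: const_add const_mult)

lemma eval_insertion: "eval p v = ev.insertion v p"
  by (simp add: eval_def ev.insertion_def mprod_def)

lemma subst_insertion: "subst \<sigma> p = sb.insertion \<sigma> p"
  by (simp add: subst_def sb.insertion_def mprod_def)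

lemma subst_add: "subst \<sigma> (p + q) = subst \<sigma> p + subst \<sigma> q"
  by (simp add: subst_insertion sb.insertion_add)
lemma subst_mult: "subst \<sigma> (p * q) = subst \<sigma> p * subst \<sigma> q"
  by (simp add: subst_insertion sb.insertion_mult)
lemma subst_zero [simp]: "subst \<sigma> 0 = 0"
  by (simp add: subst_insertion)
lemma subst_one [simp]: "subst \<sigma> 1 = 1"
  by (simp add: subst_insertion sb.insertion_one)
lemma subst_uminus: "subst \<sigma> (- p) = - subst \<sigma> p"
  using subst_add[of \<sigma> p "- p"] by (simp add: eq_neg_iff_add_eq_0 add.commute)
lemma subst_diff: "subst \<sigma> (p - q) = subst \<sigma> p - subst \<sigma> q"
  using subst_add[of \<sigma> p "- q"] by (simp add: subst_uminus)
lemma subst_sum: "subst \<sigma> (sum f A) = (\<Sum>a\<in>A. subst \<sigma> (f a))"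
  by (simp add: subst_insertion sb.insertion_sum)
lemma subst_power: "subst \<sigma> (p ^ e) = subst \<sigma> p ^ e"
  by (simp add: subst_insertion sb.insertion_power)
lemma subst_single: "subst \<sigma> (single m c) = const c * mprod \<sigma> m"
  by (simp add: subst_insertion sb.insertion_single)
lemma subst_const [simp]: "subst \<sigma> (const c) = const c"
  by (simp add: const_def[of c] subst_single)
lemma subst_Var [simp]: "subst \<sigma> (Var j) = \<sigma> j"
  by (simp add: Var_def var_mon_def subst_single)

lemma subst_mprod: "subst \<sigma> (mprod \<tau> m) = mprod (\<lambda>j. subst \<sigma> (\<tau> j)) m"
  unfolding mprod_def subst_insertion by (simp add: sb.insertion_prod sb.insertion_power)

lemma subst_subst: "subst \<sigma> (subst \<tau> p) = subst (\<lambda>j. subst \<sigma> (\<tau> j)) p"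
  by (subst (2) subst_insertion, subst (2) subst_insertion)
    (simp add: sb.insertion_def subst_sum subst_mult subst_mprod)

lemma Var_power: "Var j ^ e = single (single j e) 1"
  by (induction e) (auto simp: Var_def var_mon_def Poly_Mapping.mult_single single_add[symmetric])

lemma mprod_Var: "mprod Var m = single m 1"
proof -
  have "(\<Prod>j\<in>S. Var j ^ lookup m j) = single (\<Sum>j\<in>S. single j (lookup m j)) 1" if "finite S" for S
    using that by (induction S) (auto simp: Var_power Poly_Mapping.mult_single)
  from this[of "keys m"] show ?thesis unfolding mprod_def
    by (simp flip: poly_mapping_sum_single)
qed

lemma subst_cong:
  assumes "p \<in> polyR n" "\<And>j. j < n \<Longrightarrow> \<sigma> j = \<tau> j"
  shows "subst \<sigma> p = subst \<tau> p"
  unfolding subst_def using assms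
  by (intro sum.cong refl arg_cong2[where f="(*)"] prod.cong) (auto simp: polyR_def subset_iff)

lemma subst_id: assumes "p \<in> polyR n" "\<And>j. j < n \<Longrightarrow> \<sigma> j = Var j" shows "subst \<sigma> p = p"
proof -
  have "subst \<sigma> p = subst Var p" by (rule subst_cong) (use assms in auto)
  also have "\<dots> = p"
    unfolding subst_insertion sb.insertion_def
    by (subst (3) poly_mapping_sum_single) (simp add: mprod_Var)
  finally show ?thesis .
qed

section \<open>The graded polynomial ring\<close>

lemma polyR_0 [simp]: "0 \<in> polyR n" by (simp add: polyR_def)
lemma polyR_add: "p \<in> polyR n \<Longrightarrow> q \<in> polyR n \<Longrightarrow> p + q \<in> polyR n"
  using Poly_Mapping.keys_add[of p q] by (auto simp: polyR_def)
lemma polyR_single: "keys m \<subseteq> {..<n} \<Longrightarrow> single m c \<in> polyR n"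
  by (simp add: polyR_def)
lemma polyR_const [simp]: "const c \<in> polyR n"
  by (simp add: const_def polyR_single)
lemma polyR_1 [simp]: "1 \<in> polyR n"
  using polyR_const[of 1] by simp
lemma polyR_Var [simp]: "j < n \<Longrightarrow> Var j \<in> polyR n"
  by (simp add: Var_def var_mon_def polyR_single)
lemma polyR_mult: "p \<in> polyR n \<Longrightarrow> q \<in> polyR n \<Longrightarrow> p * q \<in> polyR n"
  using Poly_Mapping.keys_mult[of p q] by (fastforce simp: polyR_def keys_add_mon)
lemma polyR_uminus: "p \<in> polyR n \<Longrightarrow> - p \<in> polyR n"
  by (simp add: polyR_def in_keys_iff)
lemma polyR_diff: "p \<in> polyR n \<Longrightarrow> q \<in> polyR n \<Longrightarrow> p - q \<in> polyR n"
  using polyR_add[of p n "- q"] polyR_uminus[of q n] by simp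
lemma polyR_sum: "(\<And>a. a \<in> A \<Longrightarrow> f a \<in> polyR n) \<Longrightarrow> sum f A \<in> polyR n"
  by (induction A rule: infinite_finite_induct) (auto intro: polyR_add)
lemma polyR_prod: "(\<And>a. a \<in> A \<Longrightarrow> f a \<in> polyR n) \<Longrightarrow> prod f A \<in> polyR n"
  by (induction A rule: infinite_finite_induct) (auto intro: polyR_mult)
lemma polyR_power: "p \<in> polyR n \<Longrightarrow> p ^ e \<in> polyR n"
  by (induction e) (auto intro: polyR_mult)

lemma homog_0 [simp]: "homog_of_deg d 0" by (simp add: homog_of_deg_def)
lemma homog_add: "homog_of_deg d p \<Longrightarrow> homog_of_deg d q \<Longrightarrow> homog_of_deg d (p + q)"
  using Poly_Mapping.keys_add[of p q] by (auto simp: homog_of_deg_def)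
lemma homog_uminus: "homog_of_deg d p \<Longrightarrow> homog_of_deg d (- p)"
  by (simp add: homog_of_deg_def in_keys_iff)
lemma homog_diff: "homog_of_deg d p \<Longrightarrow> homog_of_deg d q \<Longrightarrow> homog_of_deg d (p - q)"
  using homog_add[of d p "- q"] homog_uminus[of d q] by simp
lemma homog_mult: "homog_of_deg d p \<Longrightarrow> homog_of_deg e q \<Longrightarrow> homog_of_deg (d + e) (p * q)"
  using Poly_Mapping.keys_mult[of p q] by (fastforce simp: homog_of_deg_def)
lemma homog_single: "mdeg m = d \<Longrightarrow> homog_of_deg d (single m c)"
  by (simp add: homog_of_deg_def)
lemma homog_const: "homog_of_deg 0 (const c)"
  by (simp add: const_def homog_single)
lemma homog_scale: "homog_of_deg d p \<Longrightarrow> homog_of_deg d (const c * p)"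
  using homog_mult[OF homog_const[of c]] by simp
lemma homog_Var: "homog_of_deg 1 (Var j)"
  by (simp add: Var_def var_mon_def homog_single)
lemma homog_sum: "(\<And>a. a \<in> A \<Longrightarrow> homog_of_deg d (f a)) \<Longrightarrow> homog_of_deg d (sum f A)"
  by (induction A rule: infinite_finite_induct) (auto intro: homog_add)
lemma homog_power: "homog_of_deg d p \<Longrightarrow> homog_of_deg (e * d) (p ^ e)"
proof (induction e)
  case 0 then show ?case using homog_const[of 1] by simp
next
  case (Suc e) then show ?case using homog_mult[of d p "e * d" "p ^ e"] by simp
qed
lemma homog_prod:
  assumes "\<And>a. a \<in> A \<Longrightarrow> homog_of_deg (g a) (f a)" "finite A"
  shows "homog_of_deg (sum g A) (prod f A)"
  using assms(2,1)
proof (induction A rule: finite_induct)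
  case empty then show ?case using homog_const[of 1] by simp
next
  case (insert a A) then show ?case using homog_mult[of "g a" "f a"] by simp
qed

lemma homog_mprod:
  assumes "\<And>j. j \<in> keys m \<Longrightarrow> homog_of_deg 1 (\<sigma> j)"
  shows "homog_of_deg (mdeg m) (mprod \<sigma> m)"
  unfolding mprod_def mdeg_def using assms homog_power[of 1]
  by (intro homog_prod) force+

lemma lookup_homog_comp: "lookup (homog_comp d p) m = (if mdeg m = d then lookup p m else 0)"
  unfolding homog_comp_def by (auto simp: lookup_sum lookup_single when_def in_keys_iff)

lemma homog_homog_comp: "homog_of_deg d (homog_comp d p)"
  by (auto simp: homog_of_deg_def in_keys_iff lookup_homog_comp split: if_splits)

lemma homog_comp_add: "homog_comp d (p + q) = homog_comp d p + homog_comp d q"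
  by (rule poly_mapping_eqI) (simp add: lookup_homog_comp lookup_add)

lemma homog_comp_diff: "homog_comp d (p - q) = homog_comp d p - homog_comp d q"
  by (rule poly_mapping_eqI) (simp add: lookup_homog_comp lookup_minus)

lemma homog_comp_0 [simp]: "homog_comp d 0 = 0"
  by (rule poly_mapping_eqI) (simp add: lookup_homog_comp)

lemma homog_comp_sum: "homog_comp d (sum f A) = (\<Sum>a\<in>A. homog_comp d (f a))"
  by (induction A rule: infinite_finite_induct) (auto simp: homog_comp_add)

lemma homog_comp_homog: "homog_of_deg e p \<Longrightarrow> homog_comp d p = (if d = e then p else 0)"
  by (rule poly_mapping_eqI) (auto simp: lookup_homog_comp homog_of_deg_def in_keys_iff)

lemma polyR_homog_comp: "p \<in> polyR n \<Longrightarrow> homog_comp d p \<in> polyR n"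
  by (auto simp: polyR_def in_keys_iff lookup_homog_comp split: if_splits)

lemma homog_comp_mult_homog:
  assumes "homog_of_deg e q"
  shows "homog_comp d (p * q) = (if e \<le> d then homog_comp (d - e) p * q else 0)"
proof -
  have "p * q = (\<Sum>m\<in>keys p. single m (lookup p m) * q)"
    by (subst (1) poly_mapping_sum_single[of p]) (simp add: sum_distrib_right)
  then have "homog_comp d (p * q) = (\<Sum>m\<in>keys p. if d = mdeg m + e then single m (lookup p m) * q else 0)"
    using homog_comp_homog[OF homog_mult[OF homog_single[OF refl] assms]]
    by (simp add: homog_comp_sum)
  moreover have "(\<Sum>m\<in>keys p. if d = mdeg m + e then single m (lookup p m) * q else 0)
     = (if e \<le> d then homog_comp (d - e) p * q else 0)"
    unfolding homog_comp_def sum_distrib_right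
    by (auto simp: sum.If_cases intro!: sum.cong sum.neutral)
  ultimately show ?thesis by simp
qed

section \<open>Polynomial functions and genericity\<close>

definition polyfun :: "nat \<Rightarrow> ((nat \<Rightarrow> 'k::comm_ring_1) \<Rightarrow> 'k) \<Rightarrow> bool" where
  "polyfun N f \<longleftrightarrow> (\<exists>h\<in>polyR N. f = eval h)"

lemma polyfunI: "h \<in> polyR N \<Longrightarrow> (\<And>v. f v = eval h v) \<Longrightarrow> polyfun N f"
  by (auto simp: polyfun_def)

lemma polyfun_const: "polyfun N (\<lambda>v. c)"
  by (rule polyfunI[of "const c"]) (auto simp: eval_insertion const_def[of c] ev.insertion_single polyR_single)
lemma polyfun_coord: "k < N \<Longrightarrow> polyfun N (\<lambda>v. v k)"
  by (rule polyfunI[of "Var k"]) (auto simp: eval_insertion Var_def var_mon_def ev.insertion_single polyR_single)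
lemma polyfun_add: "polyfun N f \<Longrightarrow> polyfun N g \<Longrightarrow> polyfun N (\<lambda>v. f v + g v)"
  unfolding polyfun_def by (metis (no_types, lifting) eval_insertion ev.insertion_add ext polyR_add)
lemma polyfun_mult: "polyfun N f \<Longrightarrow> polyfun N g \<Longrightarrow> polyfun N (\<lambda>v. f v * g v)"
  unfolding polyfun_def by (metis (no_types, lifting) eval_insertion ev.insertion_mult ext polyR_mult)
lemma polyfun_diff: "polyfun N f \<Longrightarrow> polyfun N g \<Longrightarrow> polyfun N (\<lambda>v. f v - g v)"
  using polyfun_add[of N f "\<lambda>v. (-1) * g v"] polyfun_mult[OF polyfun_const[of N "-1"], of g] by simp
lemma polyfun_sum: "(\<And>a. a \<in> A \<Longrightarrow> polyfun N (f a)) \<Longrightarrow> polyfun N (\<lambda>v. \<Sum>a\<in>A. f a v)"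
  by (induction A rule: infinite_finite_induct) (auto intro: polyfun_add polyfun_const)
lemma polyfun_prod: "(\<And>a. a \<in> A \<Longrightarrow> polyfun N (f a)) \<Longrightarrow> polyfun N (\<lambda>v. \<Prod>a\<in>A. f a v)"
  by (induction A rule: infinite_finite_induct) (auto intro: polyfun_mult polyfun_const)
lemma polyfun_power: "polyfun N f \<Longrightarrow> polyfun N (\<lambda>v. f v ^ e)"
  by (induction e) (auto intro: polyfun_mult polyfun_const)

lemma polyfun_compose:
  assumes "polyfun N f" "\<And>k. k < N \<Longrightarrow> polyfun M (\<lambda>v. s v k)"
  shows "polyfun M (\<lambda>v. f (s v))"
proof -
  obtain h where h: "h \<in> polyR N" "f = eval h" using assms(1) by (auto simp: polyfun_def)
  show ?thesis unfolding h eval_def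
    using h(1) by (intro polyfun_sum polyfun_mult polyfun_prod polyfun_power polyfun_const assms(2))
      (auto simp: polyR_def)
qed

lemma polyfun_univariate:
  assumes "polyfun 1 f" obtains p where "\<And>v. f v = poly p (v 0)"
proof -
  obtain h where h: "h \<in> polyR 1" "f = eval h" using assms(1) by (auto simp: polyfun_def)
  have "f v = poly (\<Sum>m\<in>keys h. Polynomial.monom (lookup h m) (lookup m 0)) (v 0)" for v
    unfolding h(2) eval_insertion ev.insertion_def poly_sum
  proof (rule sum.cong[OF refl])
    fix m assume "m \<in> keys h"
    then have "keys m \<subseteq> {0}" using h(1) by (auto simp: polyR_def)
    then have "mprod v m = v 0 ^ lookup m 0" by (subst mprod_superset[of "{0}"]) auto
    then show "lookup h m * mprod v m = poly (Polynomial.monom (lookup h m) (lookup m 0)) (v 0)"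
      by (simp add: poly_monom)
  qed
  then show ?thesis using that by blast
qed

text \<open>Restricted to the line through \<open>a\<close> and \<open>b\<close>, the functions
  become univariate polynomials that are nonzero at 0 and at 1 respectively. Their product has
  finitely many roots, and a field of characteristic 0 is infinite. This is the irreducibility of
  affine space.\<close>

lemma polyfun_common_nonzero:
  fixes f g :: "(nat \<Rightarrow> 'k::field_char_0) \<Rightarrow> 'k"
  assumes "polyfun N f" "polyfun N g" "f a \<noteq> 0" "g b \<noteq> 0"
  obtains c where "f c \<noteq> 0" "g c \<noteq> 0"
proof -
  define s where "s = (\<lambda>(t::nat\<Rightarrow>'k) k. a k + t 0 * (b k - a k))"
  have s: "polyfun 1 (\<lambda>t. s t k)" for k
    unfolding s_def by (intro polyfun_add polyfun_mult polyfun_const polyfun_coord) auto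
  obtain p where p: "\<And>t. f (s t) = poly p (t 0)"
    using polyfun_univariate[OF polyfun_compose[of N f 1 s, OF assms(1) s]] by metis
  obtain q where q: "\<And>t. g (s t) = poly q (t 0)"
    using polyfun_univariate[OF polyfun_compose[of N g 1 s, OF assms(2) s]] by metis
  have "poly p 0 \<noteq> 0" using p[of "\<lambda>_. 0"] assms(3) by (simp add: s_def)
  moreover have "poly q 1 \<noteq> 0" using q[of "\<lambda>_. 1"] assms(4) by (simp add: s_def)
  ultimately have "p * q \<noteq> 0" by auto
  then have "finite {x. poly (p * q) x = 0}" by (rule poly_roots_finite)
  then obtain x where "poly (p * q) x \<noteq> 0"
    using infinite_UNIV_char_0 by (metis (mono_tags, lifting) UNIV_I ex_new_if_finite mem_Collect_eq)
  then show ?thesis using that[of "s (\<lambda>_. x)"] p[of "\<lambda>_. x"] q[of "\<lambda>_. x"] by auto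
qed

text \<open>A nonempty open set contains the non-vanishing locus of one of its defining polynomials,
  so a single polynomial function suffices as a certificate.\<close>

lemma generic_iff:
  "generic N P \<longleftrightarrow> (\<exists>f. polyfun N f \<and> (\<exists>v. f v \<noteq> 0) \<and> (\<forall>v. f v \<noteq> 0 \<longrightarrow> P v))" (is "?L = ?R")
proof
  assume ?L
  then obtain S where "S \<subseteq> polyR N" "{v. \<exists>h\<in>S. eval h v \<noteq> 0} \<noteq> {}" "\<forall>v\<in>{v. \<exists>h\<in>S. eval h v \<noteq> 0}. P v"
    unfolding generic_def zariski_open_def by blast
  then show ?R unfolding polyfun_def by blast
next
  assume ?R
  then obtain h where h: "h \<in> polyR N" "\<exists>v. eval h v \<noteq> 0" "\<forall>v. eval h v \<noteq> 0 \<longrightarrow> P v"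
    unfolding polyfun_def by blast
  then show ?L unfolding generic_def zariski_open_def
    by (intro exI[of _ "{v. eval h v \<noteq> 0}"]) (auto intro!: exI[of _ "{h}"])
qed

text \<open>A property holding on a basic open neighbourhood of a named point. Keeping the point
  allows finite intersections, by multiplying certificates that are nonzero there; meeting
  neighbourhoods of different points is left to \<open>zariski_near_common\<close>.\<close>

definition zariski_near :: "nat \<Rightarrow> (nat \<Rightarrow> 'k::comm_ring_1) \<Rightarrow> ((nat \<Rightarrow> 'k) \<Rightarrow> bool) \<Rightarrow> bool" where
  "zariski_near N a P \<longleftrightarrow> (\<exists>f. polyfun N f \<and> f a \<noteq> 0 \<and> (\<forall>v. f v \<noteq> 0 \<longrightarrow> P v))"

lemma zariski_near_mono:
  "zariski_near N a P \<Longrightarrow> (\<And>v. P v \<Longrightarrow> Q v) \<Longrightarrow> zariski_near N a Q"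
  unfolding zariski_near_def by blast

lemma zariski_near_True: "zariski_near N a (\<lambda>v. True)"
  unfolding zariski_near_def by (intro exI[of _ "\<lambda>v. 1"]) (auto intro: polyfun_const)

lemma zariski_near_conj:
  fixes a :: "nat \<Rightarrow> 'k::idom"
  assumes "zariski_near N a P" "zariski_near N a Q"
  shows "zariski_near N a (\<lambda>v. P v \<and> Q v)"
proof -
  obtain f g where f: "polyfun N f" "f a \<noteq> 0" "\<And>v. f v \<noteq> 0 \<Longrightarrow> P v"
    and g: "polyfun N g" "g a \<noteq> 0" "\<And>v. g v \<noteq> 0 \<Longrightarrow> Q v"
    using assms unfolding zariski_near_def by metis
  show ?thesis unfolding zariski_near_def
    by (rule exI[of _ "\<lambda>v. f v * g v"]) (use f g in \<open>auto intro: polyfun_mult\<close>)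
qed

lemma zariski_near_ball:
  fixes a :: "nat \<Rightarrow> 'k::idom"
  assumes "finite A" "\<And>x. x \<in> A \<Longrightarrow> zariski_near N a (P x)"
  shows "zariski_near N a (\<lambda>v. \<forall>x\<in>A. P x v)"
  using assms
proof (induction A rule: finite_induct)
  case empty then show ?case by (auto intro: zariski_near_mono[OF zariski_near_True])
next
  case (insert x A)
  then have "zariski_near N a (\<lambda>v. P x v \<and> (\<forall>x\<in>A. P x v))" by (intro zariski_near_conj) auto
  then show ?case by (rule zariski_near_mono) auto
qed

text \<open>Pulls a neighbourhood back along a polynomial map. The maps used later freeze some
  coordinates, move along a line of matrices, or rearrange matrix entries.\<close>

lemma zariski_near_compose:
  assumes "zariski_near N (s a) P" "\<And>k. k < N \<Longrightarrow> polyfun M (\<lambda>v. s v k)"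
  shows "zariski_near M a (\<lambda>v. P (s v))"
proof -
  obtain f where f: "polyfun N f" "f (s a) \<noteq> 0" "\<And>v. f v \<noteq> 0 \<Longrightarrow> P v"
    using assms(1) unfolding zariski_near_def by metis
  show ?thesis unfolding zariski_near_def
    by (rule exI[of _ "\<lambda>v. f (s v)"]) (use f assms(2) in \<open>auto intro: polyfun_compose\<close>)
qed

lemma zariski_near_common:
  fixes a b :: "nat \<Rightarrow> 'k::field_char_0"
  assumes "zariski_near N a P" "zariski_near N b Q"
  obtains c where "P c" "Q c"
  using assms polyfun_common_nonzero unfolding zariski_near_def by metis

lemma generic_iff_near: "generic N P \<longleftrightarrow> (\<exists>a. zariski_near N a P)"
  unfolding generic_iff zariski_near_def by blast

lemma polyfun_cong: assumes "polyfun N f" "\<And>k. k < N \<Longrightarrow> a k = b k" shows "f a = f b"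
proof -
  obtain h where h: "h \<in> polyR N" "f = eval h" using assms(1) by (auto simp: polyfun_def)
  show ?thesis unfolding h(2) eval_def using h(1) assms(2)
    by (intro sum.cong refl arg_cong2[where f="(*)"] prod.cong) (auto simp: polyR_def subset_iff)
qed

lemma zariski_near_cong:
  "zariski_near N a P \<Longrightarrow> (\<And>k. k < N \<Longrightarrow> a k = b k) \<Longrightarrow> zariski_near N b P"
  unfolding zariski_near_def using polyfun_cong by metis

lemma polyfun_mono: "polyfun N f \<Longrightarrow> N \<le> M \<Longrightarrow> polyfun M f"
  unfolding polyfun_def polyR_def by fastforce

lemma zariski_near_dim_mono: "zariski_near N a P \<Longrightarrow> N \<le> M \<Longrightarrow> zariski_near M a P"
  unfolding zariski_near_def using polyfun_mono by blast

text \<open>Basic open sets are neighbourhoods of each of their points, so the base point may be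
  moved to any point already found inside.\<close>

lemma zariski_near_self: "zariski_near N a P \<Longrightarrow> zariski_near N a (\<lambda>b. zariski_near N b P)"
  unfolding zariski_near_def by blast

section \<open>Dimension and semicontinuity\<close>

context vector_space
begin

text \<open>The polynomial ring has infinite dimension over k, so dimension estimates are made
  inside spans of finite sets, where \<open>independent_span_bound\<close> applies.\<close>

lemma dim_mono_finite: assumes "finite T" "S \<subseteq> span T" shows "dim S \<le> dim T"
proof -
  obtain B where B: "B \<subseteq> S" "independent B" "S \<subseteq> span B" "card B = dim S" by (rule basis_exists)
  obtain C where C: "C \<subseteq> T" "independent C" "T \<subseteq> span C" "card C = dim T" by (rule basis_exists)
  have "B \<subseteq> span C" using B(1) assms(2) C(3) by (metis span_minimal subspace_span subset_trans)
  moreover have "finite C" using C(1) assms(1) finite_subset by blast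
  ultimately show ?thesis using independent_span_bound[of C B] B C by simp
qed

lemma dim_insert_finite:
  assumes "finite S" shows "dim (insert x S) = (if x \<in> span S then dim S else Suc (dim S))"
proof (cases "x \<in> span S")
  case True
  then show ?thesis using span_eq_dim[OF span_redundant[OF True]] by simp
next
  case False
  obtain B where B: "B \<subseteq> S" "independent B" "S \<subseteq> span B" "card B = dim S" by (rule basis_exists)
  have fin: "finite B" using B(1) assms finite_subset by blast
  have xB: "x \<notin> span B" using False span_mono[OF B(1)] by blast
  have "card (insert x B) = dim (insert x S)"
  proof (rule basis_card_eq_dim)
    show "insert x B \<subseteq> insert x S" using B by blast
    show "insert x S \<subseteq> span (insert x B)"
      using B(3) span_mono[of B "insert x B"] span_base[of x "insert x B"] by blast
    show "independent (insert x B)" using xB B(2) by (rule independent_insertI)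
  qed
  moreover have "x \<notin> B" using xB span_base by blast
  ultimately show ?thesis using False fin B(4) by simp
qed

lemma subset_span_of_dim:
  assumes "finite T" "finite S" "S \<subseteq> span T" "dim T \<le> dim S"
  shows "T \<subseteq> span S"
proof
  fix x assume x: "x \<in> T"
  have "dim (insert x S) \<le> dim T"
    using assms x span_base by (intro dim_mono_finite) auto
  then show "x \<in> span S" using dim_insert_finite[OF assms(2), of x] assms(4) by (auto split: if_splits)
qed

lemma ex_finite_basis:
  assumes "finite T" "V \<subseteq> span T"
  obtains B where "B \<subseteq> V" "finite B" "independent B" "V \<subseteq> span B"
proof -
  obtain B where B: "B \<subseteq> V" "independent B" "V \<subseteq> span B" by (rule maximal_independent_subset)
  then have "finite B" using independent_span_bound[OF assms(1), of B] assms(2) by blast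
  then show ?thesis using B that by blast
qed

lemma dim_image_inj:
  assumes "Vector_Spaces.linear scale scale f" "inj_on f (span S)" shows "dim (f ` S) = dim S"
proof -
  interpret f: Vector_Spaces.linear scale scale f by fact
  obtain B where B: "B \<subseteq> S" "independent B" "S \<subseteq> span B" "card B = dim S" by (rule basis_exists)
  have sp: "span B \<subseteq> span S" using B(1) by (rule span_mono)
  have inj: "inj_on f (span B)" using assms(2) sp by (rule inj_on_subset)
  have "card (f ` B) = dim (f ` S)"
  proof (rule basis_card_eq_dim)
    show "f ` S \<subseteq> span (f ` B)" using B(3) f.spans_image by blast
    show "independent (f ` B)" using B(2) inj by (rule f.independent_injective_image)
  qed (use B in blast)
  moreover have "card (f ` B) = card B"
    using inj span_superset by (intro card_image) (rule inj_on_subset)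
  ultimately show ?thesis using B by simp
qed

text \<open>Independence of an indexed family, which excludes repetitions. The index set stays fixed
  while the vectors vary with a parameter, whereas the image set may collapse.\<close>

definition indep_fam :: "'i set \<Rightarrow> ('i \<Rightarrow> 'b) \<Rightarrow> bool" where
  "indep_fam F W \<longleftrightarrow> (\<forall>c. (\<Sum>i\<in>F. c i *s W i) = 0 \<longrightarrow> (\<forall>i\<in>F. c i = 0))"

lemma indep_famD: "local.indep_fam F W \<Longrightarrow> (\<Sum>i\<in>F. c i *s W i) = 0 \<Longrightarrow> i \<in> F \<Longrightarrow> c i = 0"
  by (auto simp: local.indep_fam_def)

lemma indep_fam_inj: assumes "finite F" "local.indep_fam F W" shows "inj_on W F"
proof (rule inj_onI, rule ccontr)
  fix i j assume ij: "i \<in> F" "j \<in> F" "W i = W j" "i \<noteq> j"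
  let ?c = "\<lambda>l. if l = i then 1 else if l = j then -1 else 0"
  have "(\<Sum>l\<in>F. ?c l *s W l) = (\<Sum>l\<in>{i,j}. ?c l *s W l)"
    using assms(1) ij by (intro sum.mono_neutral_right) auto
  also have "\<dots> = 0" using ij by simp
  finally show False using indep_famD[OF assms(2), of ?c i] ij by simp
qed

lemma indep_fam_independent: assumes "finite F" "local.indep_fam F W" shows "independent (W ` F)"
proof
  assume "dependent (W ` F)"
  then obtain u v where u: "v \<in> W ` F" "u v \<noteq> 0" "(\<Sum>v\<in>W ` F. u v *s v) = 0"
    using dependent_finite[of "W ` F"] assms(1) by blast
  have "(\<Sum>i\<in>F. u (W i) *s W i) = 0"
    using u(3) by (simp add: sum.reindex[OF indep_fam_inj[OF assms]])
  from indep_famD[OF assms(2) this] show False using u(1,2) by blast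
qed

lemma indep_fam_card_le:
  assumes "finite F" "local.indep_fam F W" "W ` F \<subseteq> span T" "finite T"
  shows "card F \<le> dim T"
proof -
  have "card F = dim (W ` F)"
    using dim_eq_card_independent[OF indep_fam_independent[OF assms(1,2)]]
      card_image[OF indep_fam_inj[OF assms(1,2)]] by simp
  then show ?thesis using dim_mono_finite[OF assms(4,3)] by simp
qed

lemma independent_imp_indep_fam:
  assumes "finite F" "independent (W ` F)" "inj_on W F" shows "local.indep_fam F W"
  unfolding local.indep_fam_def
proof (intro allI impI ballI)
  fix c i assume c: "(\<Sum>i\<in>F. c i *s W i) = 0" and i: "i \<in> F"
  have "(\<Sum>v\<in>W ` F. c (inv_into F W v) *s v) = 0"
    using c by (simp add: sum.reindex[OF assms(3)] inv_into_f_f[OF assms(3)])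
  then have "c (inv_into F W (W i)) = 0"
    using i assms(1) by (intro independentD[OF assms(2), of "W ` F"]) auto
  then show "c i = 0" using i inv_into_f_f[OF assms(3)] by simp
qed

lemma indep_fam_insert:
  assumes "finite F" "r \<notin> F" "local.indep_fam F W" "W r \<notin> span (W ` F)"
  shows "local.indep_fam (insert r F) W"
  unfolding local.indep_fam_def
proof (intro allI impI)
  fix c assume "(\<Sum>i\<in>insert r F. c i *s W i) = 0"
  then have eq: "c r *s W r + (\<Sum>i\<in>F. c i *s W i) = 0" using assms(1,2) by simp
  have "(\<Sum>i\<in>F. c i *s W i) \<in> span (W ` F)" by (intro span_sum span_scale span_base) simp
  moreover have "c r *s W r = - (\<Sum>i\<in>F. c i *s W i)" using eq by (simp add: eq_neg_iff_add_eq_0)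
  ultimately have "c r *s W r \<in> span (W ` F)" by (simp add: span_neg)
  then have "inverse (c r) *s (c r *s W r) \<in> span (W ` F)" by (rule span_scale)
  then have r: "c r = 0" using assms(4) by (cases "c r = 0") simp_all
  then have "(\<Sum>i\<in>F. c i *s W i) = 0" using eq by simp
  then show "\<forall>i\<in>insert r F. c i = 0" using indep_famD[OF assms(3)] r by blast
qed

lemma ex_indep_subfam:
  assumes "finite F"
  obtains F' where "F' \<subseteq> F" "local.indep_fam F' W" "card F' = dim (W ` F)" "W ` F \<subseteq> span (W ` F')"
proof -
  obtain B where B: "B \<subseteq> W ` F" "independent B" "W ` F \<subseteq> span B" "card B = dim (W ` F)"
    by (rule basis_exists)
  let ?F = "inv_into F W ` B"
  have WF: "W ` ?F = B" using B(1) by (rule image_inv_into_cancel[OF refl])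
  have inj: "inj_on W ?F"
  proof (rule inj_onI)
    fix x y assume "x \<in> ?F" "y \<in> ?F" and eq: "W x = W y"
    then obtain b c where bc: "b \<in> B" "c \<in> B" "x = inv_into F W b" "y = inv_into F W c" by blast
    then have "W x = b" "W y = c" using B(1) by (auto intro!: f_inv_into_f)
    then show "x = y" using bc eq by simp
  qed
  show ?thesis
  proof (rule that[of ?F])
    show sub: "?F \<subseteq> F" using B(1) by (auto intro!: inv_into_into)
    show "local.indep_fam ?F W"
      using finite_subset[OF sub assms] inj WF B(2) by (intro independent_imp_indep_fam) auto
    show "card ?F = dim (W ` F)" using card_image[OF inj] WF B(4) by simp
    show "W ` F \<subseteq> span (W ` ?F)" using WF B(3) by simp
  qed
qed

end

section \<open>Families of polynomials with coefficients polynomial in parameters\<close>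

interpretation mp: vector_space "\<lambda>(c::'k::field) (p::'k mpoly). const c * p"
  by unfold_locales (auto simp: distrib_left const_add const_mult distrib_right mult.assoc)

text \<open>The uniform bound on the support makes a coefficient of a product a sum over a fixed
  finite index set, so that products of families are again families.\<close>

definition polyfam :: "nat \<Rightarrow> ((nat \<Rightarrow> 'k::field) \<Rightarrow> 'k mpoly) \<Rightarrow> bool" where
  "polyfam N W \<longleftrightarrow> (\<exists>X. finite X \<and> (\<forall>v. keys (W v) \<subseteq> X)) \<and> (\<forall>m. polyfun N (\<lambda>v. lookup (W v) m))"

lemma polyfam_const: "polyfam N (\<lambda>v. p)"
  unfolding polyfam_def by (intro conjI exI[of _ "keys p"]) (auto intro: polyfun_const)

lemma polyfam_coeff: assumes "polyfun N f" shows "polyfam N (\<lambda>v. const (f v))"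
  unfolding polyfam_def
proof (intro conjI allI)
  show "\<exists>X. finite X \<and> (\<forall>v. keys (const (f v)) \<subseteq> X)"
    by (rule exI[of _ "{0}"]) (simp add: const_def)
  show "polyfun N (\<lambda>v. lookup (const (f v)) m)" for m
    using assms polyfun_const[of N 0] by (cases "m = 0") (simp_all add: const_def lookup_single)
qed

lemma polyfam_add: assumes "polyfam N W" "polyfam N V" shows "polyfam N (\<lambda>v. W v + V v)"
  unfolding polyfam_def
proof (intro conjI allI)
  obtain X Y where "finite X" "\<And>v. keys (W v) \<subseteq> X" "finite Y" "\<And>v. keys (V v) \<subseteq> Y"
    using assms by (auto simp: polyfam_def)
  then show "\<exists>Z. finite Z \<and> (\<forall>v. keys (W v + V v) \<subseteq> Z)"
    by (intro exI[of _ "X \<union> Y"]) (meson Poly_Mapping.keys_add Un_mono finite_UnI subset_trans)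
  show "polyfun N (\<lambda>v. lookup (W v + V v) m)" for m
    using assms by (auto simp: polyfam_def lookup_add intro: polyfun_add)
qed

lemma lookup_mult_superset:
  assumes "finite X" "keys p \<subseteq> X" "finite Y" "keys q \<subseteq> Y"
  shows "lookup (p * q) m = (\<Sum>a\<in>X. \<Sum>b\<in>Y. if a + b = m then lookup p a * lookup q b else 0)"
proof -
  have "p = (\<Sum>a\<in>X. single a (lookup p a))" if "finite X" "keys p \<subseteq> X" for p X
    using that by (subst (1) poly_mapping_sum_single) (intro sum.mono_neutral_left, auto simp: in_keys_iff)
  then have "p * q = (\<Sum>a\<in>X. single a (lookup p a)) * (\<Sum>b\<in>Y. single b (lookup q b))"
    using assms by metis
  also have "\<dots> = (\<Sum>a\<in>X. \<Sum>b\<in>Y. single (a + b) (lookup p a * lookup q b))"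
    by (simp add: sum_product Poly_Mapping.mult_single)
  finally show ?thesis by (simp add: lookup_sum lookup_single when_def)
qed

lemma polyfam_mult: assumes "polyfam N W" "polyfam N V" shows "polyfam N (\<lambda>v. W v * V v)"
  unfolding polyfam_def
proof (intro conjI allI)
  obtain X Y where XY: "finite X" "\<And>v. keys (W v) \<subseteq> X" "finite Y" "\<And>v. keys (V v) \<subseteq> Y"
    using assms by (auto simp: polyfam_def)
  have "keys (W v * V v) \<subseteq> (\<lambda>(a, b). a + b) ` (X \<times> Y)" for v
    using Poly_Mapping.keys_mult[of "W v" "V v"] XY(2,4)[of v] by force
  then show "\<exists>Z. finite Z \<and> (\<forall>v. keys (W v * V v) \<subseteq> Z)"
    using XY by (intro exI[of _ "(\<lambda>(a, b). a + b) ` (X \<times> Y)"]) auto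
  show "polyfun N (\<lambda>v. lookup (W v * V v) m)" for m
  proof -
    have "polyfun N (\<lambda>v. if a + b = m then lookup (W v) a * lookup (V v) b else 0)" for a b
      using assms by (cases "a + b = m") (auto simp: polyfam_def intro: polyfun_mult polyfun_const)
    then show ?thesis by (simp add: lookup_mult_superset[OF XY(1,2) XY(3,4)]) (intro polyfun_sum)
  qed
qed

lemma polyfam_sum: "(\<And>a. a \<in> A \<Longrightarrow> polyfam N (f a)) \<Longrightarrow> polyfam N (\<lambda>v. \<Sum>a\<in>A. f a v)"
  by (induction A rule: infinite_finite_induct) (auto intro: polyfam_add polyfam_const)
lemma polyfam_prod: "(\<And>a. a \<in> A \<Longrightarrow> polyfam N (f a)) \<Longrightarrow> polyfam N (\<lambda>v. \<Prod>a\<in>A. f a v)"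
  by (induction A rule: infinite_finite_induct) (auto intro: polyfam_mult polyfam_const)
lemma polyfam_power: "polyfam N f \<Longrightarrow> polyfam N (\<lambda>v. f v ^ e)"
  by (induction e) (auto intro: polyfam_mult polyfam_const)

lemma polyfam_subst:
  assumes "p \<in> polyR n" "\<And>j. j < n \<Longrightarrow> polyfam N (\<lambda>v. \<sigma> v j)"
  shows "polyfam N (\<lambda>v. subst (\<sigma> v) p)"
  unfolding subst_def using assms(1)
  by (intro polyfam_sum polyfam_mult polyfam_prod polyfam_power polyfam_const assms(2))
    (auto simp: polyR_def)

text \<open>Fraction-free Gaussian elimination, one pivot per step, replaces the choice of a minor.\<close>
lemma indep_fam_open:
  fixes W :: "'i \<Rightarrow> (nat \<Rightarrow> 'k::field) \<Rightarrow> 'k mpoly"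
  assumes "finite F" "\<And>i m. i \<in> F \<Longrightarrow> polyfun N (\<lambda>v. lookup (W i v) m)"
    and "mp.indep_fam F (\<lambda>i. W i v0)"
  shows "zariski_near N v0 (\<lambda>v. mp.indep_fam F (\<lambda>i. W i v))"
  using assms unfolding zariski_near_def
proof (induction F arbitrary: W rule: finite_induct)
  case empty
  show ?case
    by (rule exI[of _ "\<lambda>v. 1"]) (auto simp: mp.indep_fam_def intro: polyfun_const)
next
  case (insert r F)
  have "W r v0 \<noteq> 0"
  proof
    assume "W r v0 = 0"
    then have "(\<Sum>i\<in>insert r F. const (if i = r then 1 else 0) * W i v0) = 0"
      by (intro sum.neutral) auto
    from mp.indep_famD[OF insert.prems(2) this] show False by force
  qed
  then obtain x where x: "lookup (W r v0) x \<noteq> 0" by (metis lookup_zero poly_mapping_eqI)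
  define V where "V = (\<lambda>i v. const (lookup (W r v) x) * W i v - const (lookup (W i v) x) * W r v)"
  have pV: "polyfun N (\<lambda>v. lookup (V i v) m)" if "i \<in> F" for i m
    unfolding V_def using that insert.prems(1)
    by (simp add: lookup_minus) (intro polyfun_diff polyfun_mult; blast)
  have V_sum: "(\<Sum>i\<in>F. const (c i) * V i v) =
      const (lookup (W r v) x) * (\<Sum>i\<in>F. const (c i) * W i v) - const (\<Sum>i\<in>F. c i * lookup (W i v) x) * W r v"
    for c v
  proof (rule poly_mapping_eqI)
    show "lookup (\<Sum>i\<in>F. const (c i) * V i v) m = lookup (const (lookup (W r v) x) * (\<Sum>i\<in>F. const (c i) * W i v) - const (\<Sum>i\<in>F. c i * lookup (W i v) x) * W r v) m" for m
      by (simp add: V_def lookup_sum lookup_minus sum_distrib_left sum_distrib_right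
          right_diff_distrib sum_subtractf mult.assoc)
        (simp add: mult.left_commute)
  qed
  have "mp.indep_fam F (\<lambda>i. V i v0)"
    unfolding mp.indep_fam_def
  proof (intro allI impI ballI)
    fix c i assume c: "(\<Sum>i\<in>F. const (c i) * V i v0) = 0" and i: "i \<in> F"
    let ?c = "\<lambda>i. if i = r then - (\<Sum>i\<in>F. c i * lookup (W i v0) x) else lookup (W r v0) x * c i"
    have "(\<Sum>i\<in>insert r F. const (?c i) * W i v0) = const (?c r) * W r v0 + (\<Sum>i\<in>F. const (?c i) * W i v0)"
      using insert.hyps by simp
    also have "(\<Sum>i\<in>F. const (?c i) * W i v0) = const (lookup (W r v0) x) * (\<Sum>i\<in>F. const (c i) * W i v0)"
      unfolding sum_distrib_left using insert.hyps by (intro sum.cong) (auto simp: const_mult mult_ac)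
    also have "const (?c r) * W r v0 + \<dots> = 0"
      using c unfolding V_sum by (simp add: const_def Poly_Mapping.single_uminus)
    finally have "?c i = 0" using i by (intro mp.indep_famD[OF insert.prems(2)]) auto
    then show "c i = 0" using x i insert.hyps by (auto split: if_splits)
  qed
  from insert.IH[OF pV this] obtain h where h: "polyfun N h" "h v0 \<noteq> 0"
    "\<And>v. h v \<noteq> 0 \<Longrightarrow> mp.indep_fam F (\<lambda>i. V i v)" by blast
  show ?case
  proof (intro exI[of _ "\<lambda>v. h v * lookup (W r v) x"] conjI allI impI)
    show "polyfun N (\<lambda>v. h v * lookup (W r v) x)" using h insert.prems by (auto intro: polyfun_mult)
    show "h v0 * lookup (W r v0) x \<noteq> 0" using h x by simp
    fix v assume v: "h v * lookup (W r v) x \<noteq> 0"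
    show "mp.indep_fam (insert r F) (\<lambda>i. W i v)"
      unfolding mp.indep_fam_def
    proof (intro allI impI)
      fix c assume c: "(\<Sum>i\<in>insert r F. const (c i) * W i v) = 0"
      have s: "(\<Sum>i\<in>F. const (c i) * W i v) = - (const (c r) * W r v)"
        using c insert.hyps by (simp add: eq_neg_iff_add_eq_0 add.commute)
      \<comment> \<open>Taking the coefficient of \<open>x\<close> in the relation expresses the
        multiple of the pivot through the other terms, which turns it into a relation among the
        \<open>V i\<close>.\<close>
      have "(\<Sum>i\<in>F. c i * lookup (W i v) x) = lookup (\<Sum>i\<in>F. const (c i) * W i v) x"
        by (simp add: lookup_sum)
      then have "(\<Sum>i\<in>F. c i * lookup (W i v) x) = - (c r * lookup (W r v) x)" using s by simp
      then have "(\<Sum>i\<in>F. const (c i) * V i v) = 0"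
        unfolding V_sum s by (simp add: const_def Poly_Mapping.single_uminus Poly_Mapping.mult_single mult_ac flip: mult.assoc)
      then have 0: "\<forall>i\<in>F. c i = 0" using h(3)[of v] v by (auto simp: mp.indep_fam_def)
      then have "const (c r) * W r v = 0" using s by simp
      then have "c r * lookup (W r v) x = 0" by (metis lookup_const_mult lookup_zero)
      then show "\<forall>i\<in>insert r F. c i = 0" using 0 v by auto
    qed
  qed
qed

text \<open>A subfamily forming a basis of the span at \<open>v0\<close> remains independent nearby,
  so the dimension cannot drop there.\<close>

lemma dim_open:
  fixes W :: "'i \<Rightarrow> (nat \<Rightarrow> 'k::field) \<Rightarrow> 'k mpoly"
  assumes "finite F" "\<And>i. i \<in> F \<Longrightarrow> polyfam N (W i)"
  shows "zariski_near N v0 (\<lambda>v. mp.dim ((\<lambda>i. W i v0) ` F) \<le> mp.dim ((\<lambda>i. W i v) ` F))"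
proof -
  obtain F' where F': "F' \<subseteq> F" "mp.indep_fam F' (\<lambda>i. W i v0)" "card F' = mp.dim ((\<lambda>i. W i v0) ` F)"
    using mp.ex_indep_subfam[OF assms(1)] by metis
  have fin: "finite F'" using F'(1) assms(1) by (rule finite_subset)
  have near: "zariski_near N v0 (\<lambda>v. mp.indep_fam F' (\<lambda>i. W i v))"
    using assms(2) F'(1) unfolding polyfam_def by (intro indep_fam_open[where W=W and ?v0.0=v0, OF fin _ F'(2)]) blast
  have "mp.dim ((\<lambda>i. W i v0) ` F) \<le> mp.dim ((\<lambda>i. W i v) ` F)"
    if "mp.indep_fam F' (\<lambda>i. W i v)" for v
    unfolding F'(3)[symmetric]
  proof (rule mp.indep_fam_card_le[OF fin that])
    show "(\<lambda>i. W i v) ` F' \<subseteq> mp.span ((\<lambda>i. W i v) ` F)"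
      using image_mono[OF F'(1)] mp.span_superset by (rule subset_trans)
    show "finite ((\<lambda>i. W i v) ` F)" using assms(1) by simp
  qed
  from zariski_near_mono[OF near this] show ?thesis .
qed

section \<open>Ideals and initial monomials\<close>

lemma span_single_iff: "p \<in> mp.span ((\<lambda>m. single m (1::'k::field)) ` M) \<longleftrightarrow> keys p \<subseteq> M"
proof
  have "mp.subspace {p :: 'k mpoly. keys p \<subseteq> M}"
  proof (rule mp.subspaceI, goal_cases)
    case (2 x y)
    then show ?case using Poly_Mapping.keys_add[of x y] by auto
  qed (auto simp: in_keys_iff subset_iff)
  then have "mp.span ((\<lambda>m. single m (1::'k)) ` M) \<subseteq> {p. keys p \<subseteq> M}"
    by (rule mp.span_minimal[rotated]) auto
  then show "p \<in> mp.span ((\<lambda>m. single m 1) ` M) \<Longrightarrow> keys p \<subseteq> M" by blast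
next
  assume k: "keys p \<subseteq> M"
  have "(\<Sum>m\<in>keys p. const (lookup p m) * single m 1) \<in> mp.span ((\<lambda>m. single m 1) ` M)"
    using k by (intro mp.span_sum mp.span_scale mp.span_base) auto
  then show "p \<in> mp.span ((\<lambda>m. single m 1) ` M)"
    by (simp flip: poly_mapping_sum_single)
qed

lemma polyR_homog_iff: "p \<in> polyR n \<and> homog_of_deg d p \<longleftrightarrow> keys p \<subseteq> monset n d"
  by (auto simp: polyR_def homog_of_deg_def monset_def)

lemma is_ideal_scale: "is_ideal n J \<Longrightarrow> p \<in> J \<Longrightarrow> const c * p \<in> J"
  by (simp add: is_ideal_def)
lemma is_ideal_add: "is_ideal n J \<Longrightarrow> p \<in> J \<Longrightarrow> q \<in> J \<Longrightarrow> p + q \<in> J"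
  by (simp add: is_ideal_def)
lemma is_ideal_0: "is_ideal n J \<Longrightarrow> 0 \<in> J"
  by (simp add: is_ideal_def)
lemma is_ideal_uminus: "is_ideal n J \<Longrightarrow> p \<in> J \<Longrightarrow> - p \<in> J"
  using is_ideal_scale[of n J p "-1"] by (simp add: const_def single_uminus)
lemma is_ideal_diff: "is_ideal n J \<Longrightarrow> p \<in> J \<Longrightarrow> q \<in> J \<Longrightarrow> p - q \<in> J"
  using is_ideal_add[of n J p "- q"] is_ideal_uminus[of n J q] by simp
lemma is_ideal_mult: "is_ideal n J \<Longrightarrow> r \<in> polyR n \<Longrightarrow> p \<in> J \<Longrightarrow> r * p \<in> J"
  by (simp add: is_ideal_def)
lemma is_ideal_polyR: "is_ideal n J \<Longrightarrow> p \<in> J \<Longrightarrow> p \<in> polyR n"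
  by (auto simp: is_ideal_def)
lemma is_ideal_sum: "is_ideal n J \<Longrightarrow> (\<And>a. a \<in> A \<Longrightarrow> f a \<in> J) \<Longrightarrow> sum f A \<in> J"
  by (induction A rule: infinite_finite_induct) (auto simp: is_ideal_0 is_ideal_add)

definition gpart :: "'k::comm_ring_1 mpoly set \<Rightarrow> nat \<Rightarrow> 'k mpoly set" where
  "gpart J d = {p\<in>J. homog_of_deg d p}"

lemma subspace_gpart: "is_ideal n (J :: 'k::field mpoly set) \<Longrightarrow> mp.subspace (gpart J d)"
  by (rule mp.subspaceI) (auto simp: gpart_def is_ideal_0 is_ideal_add is_ideal_scale homog_add homog_scale)

lemma gpart_keys: "is_ideal n J \<Longrightarrow> p \<in> gpart J d \<Longrightarrow> keys p \<subseteq> monset n d"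
  using polyR_homog_iff[of p n d] is_ideal_polyR[of n J p] by (simp add: gpart_def)

definition monlt :: "nat \<Rightarrow> mon \<Rightarrow> mon set" where
  "monlt n \<mu> = {\<nu>\<in>monset n (mdeg \<mu>). mon_gt \<mu> \<nu>}"

lemma finite_monlt: "finite (monlt n \<mu>)"
  by (simp add: monlt_def finite_monset)

text \<open>A monic homogeneous witness for \<open>\<mu>\<close> being a leading monomial; for
  homogeneous ideals it replaces any reference to \<open>lm\<close>.\<close>

definition leads :: "'k::comm_ring_1 mpoly \<Rightarrow> mon \<Rightarrow> bool" where
  "leads p \<mu> \<longleftrightarrow> homog_of_deg (mdeg \<mu>) p \<and> lookup p \<mu> = 1 \<and> (\<forall>\<nu>\<in>keys p. \<nu> \<noteq> \<mu> \<longrightarrow> mon_gt \<mu> \<nu>)"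

lemma lm_eqI:
  assumes "m \<in> keys p" "\<And>m'. m' \<in> keys p \<Longrightarrow> m' \<noteq> m \<Longrightarrow> mon_gt m m'" shows "lm p = m"
  unfolding lm_def
proof (rule the_equality)
  show "m \<in> keys p \<and> (\<forall>m'\<in>keys p. m' \<noteq> m \<longrightarrow> mon_gt m m')" using assms by auto
  fix x assume x: "x \<in> keys p \<and> (\<forall>m'\<in>keys p. m' \<noteq> x \<longrightarrow> mon_gt x m')"
  show "x = m"
  proof (rule ccontr)
    assume "x \<noteq> m"
    then have "mon_gt x m" "mon_gt m x" using x assms by auto
    then show False using mon_gt_asym by blast
  qed
qed

lemma lm_props:
  assumes "p \<noteq> 0"
  shows "lm p \<in> keys p" "\<And>m'. m' \<in> keys p \<Longrightarrow> m' \<noteq> lm p \<Longrightarrow> mon_gt (lm p) m'"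
proof -
  have "keys p \<noteq> {}" using assms by simp
  then obtain m where m: "m \<in> keys p" "\<And>m'. m' \<in> keys p \<Longrightarrow> m' \<noteq> m \<Longrightarrow> mon_gt m m'"
    using ex_mon_max[OF finite_keys] by metis
  then have "lm p = m" by (rule lm_eqI)
  then show "lm p \<in> keys p" "\<And>m'. m' \<in> keys p \<Longrightarrow> m' \<noteq> lm p \<Longrightarrow> mon_gt (lm p) m'" using m by auto
qed

lemma lookup_single_mult: "lookup (single q 1 * p) (q + \<nu>) = lookup (p :: 'k::comm_ring_1 mpoly) \<nu>"
proof -
  have "single q 1 * p = (\<Sum>m\<in>keys p. single (q + m) (lookup p m))"
    by (subst (1) poly_mapping_sum_single[of p]) (simp add: sum_distrib_left Poly_Mapping.mult_single)
  then show ?thesis by (auto simp: lookup_sum lookup_single when_def in_keys_iff)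
qed

lemma keys_single_mult: "keys (single q 1 * (p :: 'k::comm_ring_1 mpoly)) = (\<lambda>\<nu>. q + \<nu>) ` keys p"
proof
  show "keys (single q 1 * p) \<subseteq> (\<lambda>\<nu>. q + \<nu>) ` keys p"
    using Poly_Mapping.keys_mult[of "single q 1" p] by (auto split: if_splits)
  show "(\<lambda>\<nu>. q + \<nu>) ` keys p \<subseteq> keys (single q 1 * p)"
    by (auto simp: in_keys_iff lookup_single_mult)
qed

text \<open>An element whose leading monomial divides \<open>\<mu>\<close> is multiplied by the
  quotient monomial, cut down to its component of degree \<open>mdeg \<mu>\<close> and made monic.
  The order is compatible with products, and \<open>\<mu>\<close> survives the cut.\<close>

lemma init_mons_iff:
  fixes J :: "'k::field mpoly set"
  assumes J: "is_ideal n J" "homogeneous_ideal J"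
  shows "\<mu> \<in> init_mons n J \<longleftrightarrow> keys \<mu> \<subseteq> {..<n} \<and> (\<exists>p\<in>J. leads p \<mu>)"
proof (intro iffI conjI; (elim conjE)?)
  assume "\<mu> \<in> init_mons n J"
  then obtain p q where p: "keys \<mu> \<subseteq> {..<n}" "p \<in> J" "p \<noteq> 0" "\<mu> = lm p + q"
    by (auto simp: init_mons_def mon_dvd_def)
  then show "keys \<mu> \<subseteq> {..<n}" by blast
  define c where "c = lookup p (lm p)"
  have c: "c \<noteq> 0" using lm_props(1)[OF p(3)] by (simp add: c_def in_keys_iff)
  define r where "r = const (inverse c) * homog_comp (mdeg \<mu>) (single q 1 * p)"
  have "keys q \<subseteq> {..<n}" using p(1,4) by (simp add: keys_add_mon)
  then have "single q 1 * p \<in> J" using p(2) J(1) by (intro is_ideal_mult polyR_single)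
  then have "r \<in> J" unfolding r_def using J by (intro is_ideal_scale[OF J(1)]) (auto simp: homogeneous_ideal_def)
  moreover have "leads r \<mu>"
    unfolding leads_def
  proof (intro conjI ballI impI)
    show "homog_of_deg (mdeg \<mu>) r" by (simp add: r_def homog_scale homog_homog_comp)
    show "lookup r \<mu> = 1"
      using c lookup_single_mult[of q p "lm p"] by (simp add: r_def lookup_homog_comp p(4) add.commute c_def)
    fix \<nu> assume \<nu>: "\<nu> \<in> keys r" "\<nu> \<noteq> \<mu>"
    then have "\<nu> \<in> keys (single q 1 * p)"
      by (auto simp: r_def in_keys_iff lookup_homog_comp split: if_splits)
    then obtain m where m: "m \<in> keys p" "\<nu> = q + m" by (auto simp: keys_single_mult)
    have "m \<noteq> lm p" using m(2) \<nu>(2) p(4) by (metis add.commute)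
    then have "mon_gt (lm p) m" using lm_props(2)[OF p(3)] m(1) by blast
    then show "mon_gt \<mu> \<nu>" unfolding p(4) m(2) add.commute[of "lm p"] by simp
  qed
  ultimately show "\<exists>p\<in>J. leads p \<mu>" by blast
next
  assume \<mu>: "keys \<mu> \<subseteq> {..<n}" "\<exists>p\<in>J. leads p \<mu>"
  then obtain p where p: "p \<in> J" "leads p \<mu>" by blast
  have "lm p = \<mu>" using p(2) by (intro lm_eqI) (auto simp: leads_def in_keys_iff)
  moreover have "p \<noteq> 0" using p(2) by (auto simp: leads_def)
  ultimately show "\<mu> \<in> init_mons n J"
    using \<mu>(1) p(1) by (auto simp: init_mons_def mon_dvd_def intro!: bexI[of _ p] exI[of _ 0])
qed

text \<open>An element led by \<open>\<mu>\<close> is \<open>\<mu>\<close> plus smaller monomials.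
  Membership in the initial ideal thus becomes a span condition in one degree, which dimensions can
  detect.\<close>

lemma init_mons_span:
  fixes J :: "'k::field mpoly set"
  assumes J: "is_ideal n J" "homogeneous_ideal J" and \<mu>: "\<mu> \<in> monset n d"
  shows "\<mu> \<in> init_mons n J \<longleftrightarrow> single \<mu> 1 \<in> mp.span (gpart J d \<union> (\<lambda>m. single m 1) ` monlt n \<mu>)"
proof -
  let ?L = "(\<lambda>m. single m (1::'k)) ` monlt n \<mu>"
  have d: "mdeg \<mu> = d" and k: "keys \<mu> \<subseteq> {..<n}" using \<mu> by (auto simp: monset_def)
  show ?thesis
  proof
    assume "\<mu> \<in> init_mons n J"
    then obtain p where p: "p \<in> J" "leads p \<mu>" using init_mons_iff[OF J] by blast
    have "p \<in> gpart J d" using p d by (auto simp: gpart_def leads_def)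
    have "keys (p - single \<mu> 1) \<subseteq> monlt n \<mu>"
    proof
      fix \<nu> assume "\<nu> \<in> keys (p - single \<mu> 1)"
      then have "\<nu> \<in> keys p" "\<nu> \<noteq> \<mu>"
        using p(2) by (auto simp: in_keys_iff lookup_minus lookup_single leads_def when_def split: if_splits)
      then show "\<nu> \<in> monlt n \<mu>"
        using p gpart_keys[OF J(1) \<open>p \<in> gpart J d\<close>] d by (auto simp: monlt_def leads_def)
    qed
    then have "p - single \<mu> 1 \<in> mp.span ?L" by (simp add: span_single_iff)
    then have "p - single \<mu> 1 \<in> mp.span (gpart J d \<union> ?L)" using mp.span_mono[of ?L] by blast
    moreover have "p \<in> mp.span (gpart J d \<union> ?L)" using \<open>p \<in> gpart J d\<close> by (auto intro: mp.span_base)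
    ultimately have "p - (p - single \<mu> 1) \<in> mp.span (gpart J d \<union> ?L)" using mp.span_diff by blast
    then show "single \<mu> 1 \<in> mp.span (gpart J d \<union> ?L)" by simp
  next
    assume "single \<mu> 1 \<in> mp.span (gpart J d \<union> ?L)"
    then obtain a b where ab: "single \<mu> 1 = a + b" "a \<in> gpart J d" "b \<in> mp.span ?L"
      using mp.span_eq_iff[THEN iffD2, OF subspace_gpart[OF J(1), of d]] by (auto simp: mp.span_Un)
    have kb: "keys b \<subseteq> monlt n \<mu>" using ab(3) by (simp add: span_single_iff)
    have a: "a = single \<mu> 1 - b" using ab(1) by simp
    have "lookup b \<mu> = 0" using kb by (auto simp: monlt_def in_keys_iff)
    then have "leads a \<mu>"
      using kb ab(2) d unfolding leads_def
      by (auto simp: gpart_def) (auto simp: a lookup_minus lookup_single when_def in_keys_iff monlt_def subset_iff split: if_splits)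
    then show "\<mu> \<in> init_mons n J" using init_mons_iff[OF J] ab(2) k by (auto simp: gpart_def)
  qed
qed

section \<open>Linear changes of coordinates\<close>

abbreviation act :: "nat \<Rightarrow> (nat \<Rightarrow> 'k::comm_ring_1) \<Rightarrow> 'k mpoly \<Rightarrow> 'k mpoly" where
  "act n v \<equiv> subst (gsubst n v)"

lemma subst_polyR:
  assumes "p \<in> polyR n" "\<And>j. j < n \<Longrightarrow> \<sigma> j \<in> polyR n" shows "subst \<sigma> p \<in> polyR n"
  unfolding subst_def using assms(1)
  by (intro polyR_sum polyR_mult polyR_prod polyR_power polyR_const assms(2)) (auto simp: polyR_def)

lemma subst_homog:
  assumes "homog_of_deg d p" "p \<in> polyR n" "\<And>j. j < n \<Longrightarrow> homog_of_deg 1 (\<sigma> j)"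
  shows "homog_of_deg d (subst \<sigma> p)"
  unfolding subst_insertion sb.insertion_def
proof (intro homog_sum homog_scale)
  fix m assume m: "m \<in> keys p"
  then have "homog_of_deg (mdeg m) (mprod \<sigma> m)"
    using assms(2,3) by (intro homog_mprod) (auto simp: polyR_def)
  then show "homog_of_deg d (mprod \<sigma> m)" using assms(1) m by (simp add: homog_of_deg_def)
qed

lemma polyR_gsubst: "j < n \<Longrightarrow> gsubst n v j \<in> polyR n"
  by (auto simp: gsubst_def intro!: polyR_sum polyR_mult)
lemma homog_gsubst: "j < n \<Longrightarrow> homog_of_deg 1 (gsubst n v j)"
  by (auto simp: gsubst_def simp del: One_nat_def intro!: homog_sum homog_scale homog_Var)
lemma act_polyR: "p \<in> polyR n \<Longrightarrow> act n v p \<in> polyR n"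
  by (rule subst_polyR) (auto intro: polyR_gsubst)
lemma act_homog: "homog_of_deg d p \<Longrightarrow> p \<in> polyR n \<Longrightarrow> homog_of_deg d (act n v p)"
  by (erule (1) subst_homog) (rule homog_gsubst)

lemma act_homog_comp:
  assumes "p \<in> polyR n" shows "homog_comp d (act n v p) = act n v (homog_comp d p)"
proof -
  have s: "single m (lookup p m) \<in> polyR n" if "m \<in> keys p" for m
    using that assms by (auto simp: polyR_def)
  have h: "homog_comp d p = (\<Sum>m\<in>keys p. homog_comp d (single m (lookup p m)))"
    by (subst (1) poly_mapping_sum_single[of p]) (rule homog_comp_sum)
  have "homog_comp d (act n v p) = (\<Sum>m\<in>keys p. homog_comp d (act n v (single m (lookup p m))))"
    by (subst (1) poly_mapping_sum_single[of p]) (simp only: subst_sum homog_comp_sum)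
  also have "\<dots> = (\<Sum>m\<in>keys p. act n v (homog_comp d (single m (lookup p m))))"
  proof (rule sum.cong[OF refl])
    fix m assume m: "m \<in> keys p"
    have "homog_of_deg (mdeg m) (act n v (single m (lookup p m)))"
      by (rule act_homog[OF homog_single[OF refl] s[OF m]])
    from homog_comp_homog[OF this] homog_comp_homog[OF homog_single[OF refl, of m "lookup p m"]]
    show "homog_comp d (act n v (single m (lookup p m))) = act n v (homog_comp d (single m (lookup p m)))"
      by simp
  qed
  also have "\<dots> = act n v (homog_comp d p)" by (simp add: h subst_sum)
  finally show ?thesis .
qed

lemma linear_subst: "Vector_Spaces.linear (\<lambda>(c::'k::field) p. const c * p) (\<lambda>c p. const c * p) (subst \<sigma>)"
  by unfold_locales (auto simp: subst_add subst_mult)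

text \<open>Mutually inverse matrices, expressed through their actions on the polynomial ring; no
  matrix product is formed.\<close>

definition inv_pair :: "nat \<Rightarrow> (nat \<Rightarrow> 'k::comm_ring_1) \<Rightarrow> (nat \<Rightarrow> 'k) \<Rightarrow> bool" where
  "inv_pair n v w \<longleftrightarrow> (\<forall>p\<in>polyR n. act n v (act n w p) = p) \<and> (\<forall>p\<in>polyR n. act n w (act n v p) = p)"

lemma inv_pair_sym: "inv_pair n v w \<Longrightarrow> inv_pair n w v"
  by (auto simp: inv_pair_def)

lemma inv_pairI:
  assumes "\<And>j. j < n \<Longrightarrow> act n v (gsubst n w j) = Var j" "\<And>j. j < n \<Longrightarrow> act n w (gsubst n v j) = Var j"
  shows "inv_pair n v w"
  unfolding inv_pair_def subst_subst using assms by (auto intro!: subst_id)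

lemma var_mon_eq_iff [simp]: "var_mon j = var_mon k \<longleftrightarrow> j = k"
  unfolding var_mon_def by (metis lookup_single_eq lookup_single_not_eq zero_neq_one)

lemma lookup_linear_form: "lookup (\<Sum>l<n. const (a l) * Var l) (var_mon k) = (if k < n then a k else 0)"
proof -
  have "lookup (\<Sum>l<n. const (a l) * Var l) (var_mon k) = (\<Sum>l<n. if l = k then a l else 0)"
    by (auto simp: lookup_sum Var_def lookup_single when_def intro!: sum.cong)
  then show ?thesis by simp
qed

lemma mat_invertible_iff: "mat_invertible n v \<longleftrightarrow> mp.indep_fam {..<n} (gsubst n (v :: nat \<Rightarrow> 'k::field))"
proof -
  have eq: "(\<Sum>j<n. const (c j) * gsubst n v j) = (\<Sum>l<n. const (\<Sum>j<n. v (l*n+j) * c j) * Var l)" for c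
  proof -
    have "(\<Sum>j<n. const (c j) * gsubst n v j) = (\<Sum>j<n. \<Sum>l<n. const (v (l*n+j) * c j) * Var l)"
      by (intro sum.cong) (auto simp: gsubst_def sum_distrib_left const_mult mult_ac)
    also have "\<dots> = (\<Sum>l<n. \<Sum>j<n. const (v (l*n+j) * c j) * Var l)" by (rule sum.swap)
    finally show ?thesis by (simp add: sum_distrib_right const_sum)
  qed
  have z: "(\<Sum>l<n. const (a l) * Var l) = 0 \<longleftrightarrow> (\<forall>l<n. a l = 0)" for a :: "nat \<Rightarrow> 'k"
    using lookup_linear_form[of a n] by (metis (no_types, lifting) const_zero lookup_zero mult_zero_left lessThan_iff sum.neutral)
  show ?thesis unfolding mat_invertible_def mp.indep_fam_def eq z by auto
qed

lemma sum_const_delta: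
  assumes "finite F" "i \<in> F"
  shows "(\<Sum>j\<in>F. const (if j = i then 1 else 0) * W j) = W i"
proof -
  have "(\<Sum>j\<in>F. const (if j = i then 1 else 0) * W j) = (\<Sum>j\<in>{i}. W j)"
    using assms by (intro sum.mono_neutral_cong_right) auto
  then show ?thesis by simp
qed

lemma span_image_explicit:
  fixes W :: "'i \<Rightarrow> 'k::field mpoly"
  assumes "finite F" "x \<in> mp.span (W ` F)"
  shows "\<exists>c. x = (\<Sum>i\<in>F. const (c i) * W i)"
proof -
  let ?S = "{x. \<exists>c. x = (\<Sum>i\<in>F. const (c i) * W i)}"
  have "mp.subspace ?S"
  proof (rule mp.subspaceI, goal_cases)
    case 1
    then show ?case by (auto intro!: exI[of _ "\<lambda>_. 0"])
  next
    case (2 x y)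
    then obtain a b where "x = (\<Sum>i\<in>F. const (a i) * W i)" "y = (\<Sum>i\<in>F. const (b i) * W i)" by blast
    then have "x + y = (\<Sum>i\<in>F. const (a i + b i) * W i)"
      by (simp only: const_add distrib_right sum.distrib)
    then show ?case by (intro CollectI exI[of _ "\<lambda>i. a i + b i"])
  next
    case (3 c x)
    then obtain a where "x = (\<Sum>i\<in>F. const (a i) * W i)" by blast
    then have "const c * x = (\<Sum>i\<in>F. const (c * a i) * W i)"
      by (simp only: const_mult sum_distrib_left mult.assoc)
    then show ?case by (intro CollectI exI[of _ "\<lambda>i. c * a i"])
  qed
  moreover have "W ` F \<subseteq> ?S"
  proof clarify
    fix i assume "i \<in> F"
    then have "W i = (\<Sum>j\<in>F. const (if j = i then 1 else 0) * W j)"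
      using assms(1) by (simp add: sum_const_delta)
    then show "\<exists>c. W i = (\<Sum>j\<in>F. const (c j) * W j)" by (rule exI[of _ "\<lambda>j. if j = i then 1 else 0"])
  qed
  ultimately have "mp.span (W ` F) \<subseteq> ?S" by (rule mp.span_minimal[rotated])
  then show ?thesis using assms(2) by blast
qed

lemma gsubst_in_span: "j < n \<Longrightarrow> gsubst n v j \<in> mp.span (Var ` {..<n})"
  unfolding gsubst_def by simp (intro mp.span_sum mp.span_scale mp.span_base, simp)

lemma act_linear_form: "act n v (\<Sum>l<n. const (c l) * Var l) = (\<Sum>l<n. const (c l) * gsubst n v l)"
  by (simp add: subst_sum subst_mult)

text \<open>The images of the variables are n independent linear forms, so they span all linear
  forms, and expressing the variables through them gives \<open>w\<close> and one of the two
  composites. The other follows by applying \<open>act n v\<close> and comparing coefficients of the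
  independent images.\<close>

lemma ex_inv_pair:
  fixes v :: "nat \<Rightarrow> 'k::field"
  assumes "mat_invertible n v" obtains w where "inv_pair n v w"
proof -
  have ind: "mp.indep_fam {..<n} (gsubst n v)" using assms by (simp add: mat_invertible_iff)
  let ?X = "Var ` {..<n} :: 'k mpoly set" and ?g = "gsubst n v ` {..<n}"
  have sub: "?g \<subseteq> mp.span ?X" using gsubst_in_span by blast
  have "mp.dim ?X \<le> mp.dim ?g"
  proof -
    have "mp.dim ?X \<le> card ?X" by (rule mp.dim_le_card) (auto intro: mp.span_base)
    also have "\<dots> \<le> n" using card_image_le[of "{..<n}" Var] by simp
    also have "n \<le> mp.dim ?g"
      using mp.indep_fam_card_le[OF _ ind mp.span_superset] by simp
    finally show ?thesis .
  qed
  then have X: "?X \<subseteq> mp.span ?g" by (intro mp.subset_span_of_dim[OF _ _ sub]) simp_all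
  have ex: "\<exists>c. Var j = (\<Sum>l<n. const (c l) * gsubst n v l)" if "j < n" for j
    using subsetD[OF X, of "Var j"] that by (intro span_image_explicit) simp_all
  define c where "c = (\<lambda>j. SOME c. Var j = (\<Sum>l<n. const (c l) * gsubst n v l))"
  have c: "Var j = (\<Sum>l<n. const (c j l) * gsubst n v l)" if "j < n" for j
    unfolding c_def by (rule someI_ex[OF ex[OF that]])
  \<comment> \<open>The entry in row l and column j is stored at position \<open>l * n + j\<close>,
    so \<open>k mod n\<close> is the column and \<open>k div n\<close> the row.\<close>
  define w where "w = (\<lambda>k. c (k mod n) (k div n))"
  have gw: "gsubst n w j = (\<Sum>l<n. const (c j l) * Var l)" if "j < n" for j
    using that by (auto simp: gsubst_def w_def)
  have 1: "act n v (gsubst n w j) = Var j" if "j < n" for j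
    by (simp only: gw[OF that] act_linear_form c[OF that, symmetric])
  have 2: "act n w (gsubst n v j) = Var j" if j: "j < n" for j
  proof -
    have "act n w (gsubst n v j) = (\<Sum>l<n. const (v (l*n+j)) * gsubst n w l)"
      using j by (simp add: gsubst_def[of n v] act_linear_form)
    also have "\<dots> \<in> mp.span ?X"
      by (intro mp.span_sum mp.span_scale gsubst_in_span) auto
    finally have "\<exists>a. act n w (gsubst n v j) = (\<Sum>l<n. const (a l) * Var l)"
      by (intro span_image_explicit) simp_all
    then obtain a where a: "act n w (gsubst n v j) = (\<Sum>l<n. const (a l) * Var l)" by blast
    have "act n v (act n w (gsubst n v j)) = gsubst n v j"
      unfolding subst_subst by (rule subst_id[OF polyR_gsubst[OF j] 1])
    then have "(\<Sum>l<n. const (a l) * gsubst n v l) - gsubst n v j = 0"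
      unfolding a act_linear_form by simp
    moreover have "gsubst n v j = (\<Sum>l<n. const (if l = j then 1 else 0) * gsubst n v l)"
      using j by (simp add: sum_const_delta)
    ultimately have "(\<Sum>l<n. const (a l) * gsubst n v l) - (\<Sum>l<n. const (if l = j then 1 else 0) * gsubst n v l) = 0"
      by simp
    then have "(\<Sum>l<n. const (a l - (if l = j then 1 else 0)) * gsubst n v l) = 0"
      by (simp add: sum_subtractf[symmetric] left_diff_distrib[symmetric] const_def single_diff del: sum_subtractf)
    then have "a l = (if l = j then 1 else 0)" if "l < n" for l
      using mp.indep_famD[OF ind, of "\<lambda>l. a l - (if l = j then 1 else 0)" l] that by auto
    then have "act n w (gsubst n v j) = (\<Sum>l<n. const (if l = j then 1 else 0) * Var l)" unfolding a by auto
    then show ?thesis using j by (simp add: sum_const_delta)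
  qed
  show ?thesis using that inv_pairI[OF 1 2] by blast
qed

lemma inv_pair_mat_invertible:
  fixes v :: "nat \<Rightarrow> 'k::field"
  assumes "inv_pair n v w" shows "mat_invertible n v"
  unfolding mat_invertible_iff mp.indep_fam_def
proof (intro allI impI)
  fix c assume "(\<Sum>j<n. const (c j) * gsubst n v j) = 0"
  then have "act n v (\<Sum>j<n. const (c j) * Var j) = 0" by (simp add: act_linear_form)
  moreover have "(\<Sum>j<n. const (c j) * Var j) \<in> polyR n" by (auto intro!: polyR_sum polyR_mult)
  ultimately have "act n w 0 = (\<Sum>j<n. const (c j) * Var j)"
    using assms unfolding inv_pair_def by force
  then have "(if j < n then c j else 0) = 0" for j using lookup_linear_form[of c n j] by simp
  then show "\<forall>j\<in>{..<n}. c j = 0" by (metis lessThan_iff)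
qed

lemma gact_iff:
  assumes "inv_pair n v w" "is_ideal n I"
  shows "p \<in> gact n v I \<longleftrightarrow> p \<in> polyR n \<and> act n w p \<in> I"
proof
  assume "p \<in> gact n v I"
  then obtain q where q: "q \<in> I" "p = act n v q" by (auto simp: gact_def)
  then show "p \<in> polyR n \<and> act n w p \<in> I"
    using assms is_ideal_polyR[OF assms(2)] by (auto simp: inv_pair_def act_polyR)
next
  assume "p \<in> polyR n \<and> act n w p \<in> I"
  then show "p \<in> gact n v I" using assms(1) unfolding gact_def inv_pair_def by (metis imageI)
qed

lemma gact_ideal:
  assumes "inv_pair n v w" "is_ideal n I" shows "is_ideal n (gact n v I)"
  unfolding is_ideal_def using assms(2)
  by (auto simp: gact_iff[OF assms] subst_add subst_mult polyR_add polyR_mult is_ideal_0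
      is_ideal_add is_ideal_mult act_polyR)

lemma gact_homogeneous:
  assumes "inv_pair n v w" "is_ideal n I" "homogeneous_ideal I" shows "homogeneous_ideal (gact n v I)"
  using assms(3)
  by (auto simp: homogeneous_ideal_def gact_iff[OF assms(1,2)] polyR_homog_comp act_homog_comp[symmetric])

lemma gpart_gact:
  assumes "inv_pair n v w" "is_ideal n I" shows "gpart (gact n v I) d = act n v ` gpart I d"
proof -
  have "p \<in> act n v ` gpart I d" if p: "p \<in> gact n v I" "homog_of_deg d p" for p
  proof -
    have "p = act n v (act n w p)" "homog_of_deg d (act n w p)" "act n w p \<in> I"
      using p assms(1) gact_iff[OF assms] by (auto simp: inv_pair_def act_homog)
    then show ?thesis by (auto simp: gpart_def)
  qed
  then show ?thesis
    using is_ideal_polyR[OF assms(2)] by (auto simp: gpart_def gact_def act_homog)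
qed

lemma polyfun_entry: "l < n \<Longrightarrow> j < n \<Longrightarrow> polyfun (n * n) (\<lambda>v. v (l * n + j))"
proof (rule polyfun_coord)
  assume a: "l < n" "j < n"
  then have "l * n + j < (l + 1) * n" by simp
  also have "\<dots> \<le> n * n" using a by (intro mult_le_mono) auto
  finally show "l * n + j < n * n" .
qed

lemma polyfam_act: "p \<in> polyR n \<Longrightarrow> polyfam (n * n) (\<lambda>v. act n v p)"
  by (rule polyfam_subst)
    (auto simp: gsubst_def intro!: polyfam_sum polyfam_mult polyfam_coeff polyfam_const polyfun_entry)

lemma mat_invertible_near:
  fixes v0 :: "nat \<Rightarrow> 'k::field"
  assumes "mat_invertible n v0" shows "zariski_near (n * n) v0 (mat_invertible n)"
proof -
  have "polyfam (n * n) (\<lambda>v. gsubst n (v :: nat \<Rightarrow> 'k) j)" if "j < n" for j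
    using polyfam_act[OF polyR_Var[OF that]] by simp
  then have "zariski_near (n * n) v0 (\<lambda>v. mp.indep_fam {..<n} (gsubst n v))"
    using assms by (intro indep_fam_open[where W="\<lambda>j v. gsubst n v j"]) (auto simp: mat_invertible_iff polyfam_def)
  then show ?thesis by (rule zariski_near_mono) (simp add: mat_invertible_iff)
qed

section \<open>The generic initial ideal\<close>

locale homog_artinian =
  fixes n :: nat and I :: "'k::field_char_0 mpoly set"
  assumes ideal: "is_ideal n I" and homogeneous: "homogeneous_ideal I" and artinian: "artinian n I"
begin

text \<open>In a degree beyond all monomials of a finite set spanning the quotient, the correcting
  combination has zero component, so the form itself lies in \<open>I\<close>. Hence only finitely
  many degrees carry information.\<close>

lemma ex_degree_bound: "\<exists>D. \<forall>d\<ge>D. \<forall>p\<in>polyR n. homog_of_deg d p \<longrightarrow> p \<in> I"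
proof -
  obtain B where B: "finite B" "\<And>p. p \<in> polyR n \<Longrightarrow> \<exists>c. p - (\<Sum>b\<in>B. const (c b) * b) \<in> I"
    using artinian by (auto simp: artinian_def)
  let ?X = "\<Union>b\<in>B. keys b"
  have fin: "finite (mdeg ` ?X)" using B(1) by simp
  define D where "D = Suc (Max (insert 0 (mdeg ` ?X)))"
  have less: "mdeg m < D" if "b \<in> B" "m \<in> keys b" for b m
    unfolding D_def using that fin by (intro le_imp_less_Suc Max_ge) auto
  have "p \<in> I" if d: "d \<ge> D" "p \<in> polyR n" "homog_of_deg d p" for d p
  proof -
    obtain c where c: "p - (\<Sum>b\<in>B. const (c b) * b) \<in> I" using B(2)[OF d(2)] by blast
    have "homog_comp d (\<Sum>b\<in>B. const (c b) * b) = 0"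
      by (rule poly_mapping_eqI)
        (use less d(1) in \<open>fastforce simp: lookup_homog_comp lookup_sum in_keys_iff intro!: sum.neutral\<close>)
    then have "homog_comp d (p - (\<Sum>b\<in>B. const (c b) * b)) = p"
      using homog_comp_homog[OF d(3), of d] by (simp add: homog_comp_diff)
    then show ?thesis using homogeneous[unfolded homogeneous_ideal_def, rule_format, OF c, of d] by simp
  qed
  then show ?thesis by blast
qed

definition D :: nat where "D = (SOME D. \<forall>d\<ge>D. \<forall>p\<in>polyR n. homog_of_deg d p \<longrightarrow> p \<in> I)"

lemma D: "d \<ge> D \<Longrightarrow> p \<in> polyR n \<Longrightarrow> homog_of_deg d p \<Longrightarrow> p \<in> I"
  using someI_ex[OF ex_degree_bound] unfolding D_def by blast

text \<open>A finite spanning set chosen once for each degree part of \<open>I\<close>; its image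
  under \<open>act n v\<close> is then a family over a fixed finite index set with coefficients
  polynomial in \<open>v\<close>.\<close>

definition E :: "nat \<Rightarrow> 'k mpoly set" where
  "E d = (SOME B. B \<subseteq> gpart I d \<and> finite B \<and> gpart I d \<subseteq> mp.span B)"

lemma E: "E d \<subseteq> gpart I d" "finite (E d)" "gpart I d \<subseteq> mp.span (E d)"
proof -
  have "gpart I d \<subseteq> mp.span ((\<lambda>m. single m 1) ` monset n d)"
    using gpart_keys[OF ideal] by (auto simp: span_single_iff)
  then have "\<exists>B. B \<subseteq> gpart I d \<and> finite B \<and> gpart I d \<subseteq> mp.span B"
    using mp.ex_finite_basis[of "(\<lambda>m. single m 1) ` monset n d" "gpart I d"] finite_monset by (metis finite_imageI)
  from someI_ex[OF this] show "E d \<subseteq> gpart I d" "finite (E d)" "gpart I d \<subseteq> mp.span (E d)"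
    unfolding E_def by blast+
qed

lemma E_polyR: "p \<in> E d \<Longrightarrow> p \<in> polyR n" and E_homog: "p \<in> E d \<Longrightarrow> homog_of_deg d p"
  using E(1)[of d] is_ideal_polyR[OF ideal] by (auto simp: gpart_def)

section \<open>Dimensions that determine the initial monomials\<close>

definition jdim :: "(nat \<Rightarrow> 'k) \<Rightarrow> nat \<Rightarrow> mon set \<Rightarrow> nat" where
  "jdim v d S = mp.dim (act n v ` E d \<union> (\<lambda>m. single m 1) ` S)"

text \<open>The space measured by \<open>jdim\<close>, pulled back along the inverse: here the
  polynomials of \<open>I\<close> stay fixed and the monomials move.\<close>

definition idim :: "(nat \<Rightarrow> 'k) \<Rightarrow> nat \<Rightarrow> mon set \<Rightarrow> nat" where
  "idim w d S = mp.dim (E d \<union> (\<lambda>m. act n w (single m 1)) ` S)"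

lemma jdim_eq_idim:
  assumes "inv_pair n v w" "S \<subseteq> monset n d" shows "jdim v d S = idim w d S"
proof -
  let ?A = "act n v ` E d \<union> (\<lambda>m. single m (1::'k)) ` S"
  have sub: "?A \<subseteq> polyR n"
    using assms(2) by (auto simp: monset_def intro!: polyR_single act_polyR intro: E_polyR)
  have "mp.subspace (polyR n :: 'k mpoly set)"
    by (rule mp.subspaceI) (auto intro: polyR_add polyR_mult)
  then have "mp.span ?A \<subseteq> polyR n" using sub by (rule mp.span_minimal[rotated])
  moreover have "inj_on (act n w) (polyR n)"
    by (rule inj_on_inverseI[of _ "act n v"]) (use assms(1) in \<open>auto simp: inv_pair_def\<close>)
  ultimately have "mp.dim (act n w ` ?A) = mp.dim ?A"
    by (intro mp.dim_image_inj[OF linear_subst]) (rule inj_on_subset)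
  moreover have "act n w ` act n v ` E d = E d"
    using assms(1) E_polyR[of _ d] by (force simp: inv_pair_def image_image)
  ultimately show ?thesis by (simp add: jdim_def idim_def image_Un image_image)
qed

lemma jdim_near:
  assumes "finite S" shows "zariski_near (n * n) v0 (\<lambda>v. jdim v0 d S \<le> jdim v d S)"
proof -
  let ?W = "\<lambda>i v. case i of Inl p \<Rightarrow> act n v p | Inr m \<Rightarrow> single m 1"
  have "zariski_near (n * n) v0 (\<lambda>v. mp.dim ((\<lambda>i. ?W i v0) ` (E d <+> S)) \<le> mp.dim ((\<lambda>i. ?W i v) ` (E d <+> S)))"
    using assms E(2)
    by (intro dim_open[where W="?W"]) (auto intro!: polyfam_act polyfam_const intro: E_polyR)
  moreover have "(\<lambda>i. ?W i v) ` (E d <+> S) = act n v ` E d \<union> (\<lambda>m. single m 1) ` S" for v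
    by (force simp: Plus_def)
  ultimately show ?thesis by (simp add: jdim_def)
qed

lemma idim_near:
  assumes "S \<subseteq> monset n d" shows "zariski_near (n * n) w0 (\<lambda>w. idim w0 d S \<le> idim w d S)"
proof -
  let ?W = "\<lambda>i v. case i of Inl p \<Rightarrow> p | Inr m \<Rightarrow> act n v (single m 1)"
  have "finite S" using assms finite_monset by (rule finite_subset)
  then have "zariski_near (n * n) w0 (\<lambda>v. mp.dim ((\<lambda>i. ?W i w0) ` (E d <+> S)) \<le> mp.dim ((\<lambda>i. ?W i v) ` (E d <+> S)))"
    using assms E(2)
    by (intro dim_open[where W="?W"]) (auto simp: monset_def intro!: polyfam_act polyfam_const polyR_single)
  moreover have "(\<lambda>i. ?W i v) ` (E d <+> S) = E d \<union> (\<lambda>m. act n v (single m 1)) ` S" for v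
    by (force simp: Plus_def)
  ultimately show ?thesis by (simp add: idim_def)
qed

lemma span_gact:
  assumes "inv_pair n v w"
  shows "mp.span (gpart (gact n v I) d \<union> X) = mp.span (act n v ` E d \<union> X)"
proof -
  interpret f: Vector_Spaces.linear "\<lambda>(c::'k) p. const c * p" "\<lambda>c p. const c * p" "act n v"
    by (rule linear_subst)
  have "act n v ` gpart I d \<subseteq> mp.span (act n v ` E d)"
    using E(3)[of d] by (auto simp: f.span_image)
  then have "gpart (gact n v I) d \<union> X \<subseteq> mp.span (act n v ` E d \<union> X)"
    unfolding gpart_gact[OF assms ideal]
    using mp.span_mono[of "act n v ` E d" "act n v ` E d \<union> X"] mp.span_superset[of "act n v ` E d \<union> X"] by blast
  moreover have "act n v ` E d \<union> X \<subseteq> gpart (gact n v I) d \<union> X"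
    unfolding gpart_gact[OF assms ideal] using E(1)[of d] by blast
  ultimately show ?thesis
    by (intro subset_antisym mp.span_mono mp.span_minimal[OF _ mp.subspace_span])
qed

lemma init_gact_iff:
  assumes "inv_pair n v w" "\<mu> \<in> monset n d"
  shows "\<mu> \<in> init_mons n (gact n v I) \<longleftrightarrow> jdim v d (insert \<mu> (monlt n \<mu>)) = jdim v d (monlt n \<mu>)"
proof -
  let ?A = "act n v ` E d \<union> (\<lambda>m. single m (1::'k)) ` monlt n \<mu>"
  have "\<mu> \<in> init_mons n (gact n v I) \<longleftrightarrow> single \<mu> 1 \<in> mp.span ?A"
    using init_mons_span[OF gact_ideal[OF assms(1) ideal] gact_homogeneous[OF assms(1) ideal homogeneous] assms(2)]
    by (simp add: span_gact[OF assms(1)])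
  moreover have "finite ?A" using E(2) finite_monlt by simp
  ultimately show ?thesis
    using mp.dim_insert_finite[of ?A "single \<mu> 1"] by (auto simp: jdim_def)
qed

definition mdown :: "nat \<Rightarrow> mon set set" where
  "mdown d = monlt n ` monset n d \<union> (\<lambda>\<mu>. insert \<mu> (monlt n \<mu>)) ` monset n d"

lemma mdown_subset: "S \<in> mdown d \<Longrightarrow> S \<subseteq> monset n d"
  by (auto simp: mdown_def monlt_def monset_def)

lemma finite_mdown: "finite (mdown d)"
  by (simp add: mdown_def finite_monset)

lemma init_gact_high:
  assumes "inv_pair n v w" "\<mu> \<in> monset n d" "d \<ge> D" shows "\<mu> \<in> init_mons n (gact n v I)"
proof -
  have k: "single \<mu> 1 \<in> polyR n" "homog_of_deg d (single \<mu> (1::'k))"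
    using assms(2) by (auto simp: monset_def intro: polyR_single homog_single)
  then have "act n w (single \<mu> 1) \<in> I" by (intro D[OF assms(3)] act_polyR act_homog)
  then have "single \<mu> 1 \<in> gpart (gact n v I) d"
    using k by (auto simp: gpart_def gact_iff[OF assms(1) ideal])
  then show ?thesis
    using init_mons_span[OF gact_ideal[OF assms(1) ideal] gact_homogeneous[OF assms(1) ideal homogeneous] assms(2)]
    by (auto intro: mp.span_base)
qed

lemma init_gact_subset: "init_mons n J \<subseteq> {m. keys m \<subseteq> {..<n}}"
  by (auto simp: init_mons_def)

text \<open>From degree \<open>D\<close> on every monomial is initial, and below it the dimensions
  over \<open>mdown\<close> decide, so finitely many numbers determine the whole initial
  ideal.\<close>

lemma init_gact_cong:
  assumes "inv_pair n v w" "inv_pair n v' w'"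
    and "\<And>d S. d < D \<Longrightarrow> S \<in> mdown d \<Longrightarrow> jdim v d S = jdim v' d S"
  shows "init_mons n (gact n v I) = init_mons n (gact n v' I)"
proof -
  have "\<mu> \<in> init_mons n (gact n v I) \<longleftrightarrow> \<mu> \<in> init_mons n (gact n v' I)" if "\<mu> \<in> monset n d" for \<mu> d
  proof (cases "d \<ge> D")
    case True
    then show ?thesis using init_gact_high[OF assms(1) that] init_gact_high[OF assms(2) that] by blast
  next
    case False
    have "monlt n \<mu> \<in> mdown d" "insert \<mu> (monlt n \<mu>) \<in> mdown d" using that by (auto simp: mdown_def)
    then show ?thesis
      using init_gact_iff[OF assms(1) that] init_gact_iff[OF assms(2) that] assms(3) False by simp
  qed
  then show ?thesis using init_gact_subset by (fastforce simp: monset_def)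
qed

text \<open>Each dimension is lower semicontinuous both in the coordinate change v and in its inverse w,
  so a point where the sum of all of them is maximal has a neighbourhood, in either parameter
  space, on which all of them are constant.\<close>
lemma ex_generic_point:
  obtains v0 w0 where "inv_pair n v0 w0"
    "zariski_near (n * n) v0 (\<lambda>v. mat_invertible n v \<and> (\<forall>d<D. \<forall>S\<in>mdown d. jdim v d S = jdim v0 d S))"
    "zariski_near (n * n) w0 (\<lambda>w. \<exists>v. inv_pair n v w \<and> (\<forall>d<D. \<forall>S\<in>mdown d. jdim v d S = jdim v0 d S))"
proof -
  define Idx where "Idx = (SIGMA d:{..<D}. mdown d)"
  have fin: "finite Idx" by (simp add: Idx_def finite_mdown)
  define tot where "tot = (\<lambda>v. \<Sum>i\<in>Idx. jdim v (fst i) (snd i))"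
  have bound: "jdim v d S \<le> card (E d) + card S" if "S \<in> mdown d" for v d S
  proof -
    have fS: "finite S" using mdown_subset[OF that] finite_monset by (rule finite_subset)
    have "jdim v d S \<le> card (act n v ` E d \<union> (\<lambda>m. single m (1::'k)) ` S)"
      unfolding jdim_def by (rule mp.dim_le_card) (use E(2) fS in \<open>auto intro: mp.span_base\<close>)
    also have "\<dots> \<le> card (E d) + card S"
      using card_Un_le[of "act n v ` E d" "(\<lambda>m. single m (1::'k)) ` S"] card_image_le[OF E(2), of "act n v" d] card_image_le[OF fS, of "\<lambda>m. single m (1::'k)"]
      by linarith
    finally show ?thesis .
  qed
  have totb: "tot v \<le> (\<Sum>i\<in>Idx. card (E (fst i)) + card (snd i))" for v
    unfolding tot_def by (intro sum_mono) (auto simp: Idx_def bound)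
  \<comment> \<open>The identity matrix shows that the set over which the maximum is taken is
    nonempty.\<close>
  have "inv_pair n (\<lambda>k. if k div n = k mod n then 1 else 0) (\<lambda>k. if k div n = k mod n then (1::'k) else 0)"
  proof -
    have g: "gsubst n (\<lambda>k. if k div n = k mod n then (1::'k) else 0) j = Var j" if "j < n" for j
      using that by (simp add: gsubst_def sum_const_delta)
    show ?thesis by (rule inv_pairI) (simp_all add: g)
  qed
  note one = inv_pair_mat_invertible[OF this]
  obtain v0 where v0: "mat_invertible n v0" "\<And>v. mat_invertible n v \<Longrightarrow> tot v \<le> tot v0"
    using ex_has_greatest_nat[of "mat_invertible n", OF one, of tot "Suc (\<Sum>i\<in>Idx. card (E (fst i)) + card (snd i))"]
      totb[THEN le_imp_less_Suc] by (auto dest: less_imp_le)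
  obtain w0 where vw0: "inv_pair n v0 w0" using ex_inv_pair[OF v0(1)] .
  \<comment> \<open>If no dimension drops and their sum is already maximal, then none can
    grow.\<close>
  have eq: "\<forall>d<D. \<forall>S\<in>mdown d. jdim v d S = jdim v0 d S"
    if inv: "mat_invertible n v" and le: "\<forall>i\<in>Idx. jdim v0 (fst i) (snd i) \<le> jdim v (fst i) (snd i)" for v
  proof (rule ccontr)
    assume "\<not> ?thesis"
    then obtain d S where "(d, S) \<in> Idx" "jdim v0 d S < jdim v d S"
      using le by (force simp: Idx_def)
    then have "tot v0 < tot v" unfolding tot_def using le fin
      by (intro sum_strict_mono_ex1) (auto intro!: bexI[of _ "(d, S)"])
    then show False using v0(2)[OF inv] by simp
  qed
  have fS: "finite S" if "(d, S) \<in> Idx" for d S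
    using that finite_subset[OF mdown_subset[of S d] finite_monset] by (simp add: Idx_def)
  have "zariski_near (n * n) v0 (\<lambda>v. \<forall>i\<in>Idx. jdim v0 (fst i) (snd i) \<le> jdim v (fst i) (snd i))"
    using fS by (intro zariski_near_ball fin jdim_near) auto
  from zariski_near_conj[OF mat_invertible_near[OF v0(1)] this]
  have 1: "zariski_near (n * n) v0 (\<lambda>v. mat_invertible n v \<and> (\<forall>d<D. \<forall>S\<in>mdown d. jdim v d S = jdim v0 d S))"
    by (rule zariski_near_mono) (use eq in blast)
  have w0: "mat_invertible n w0" using inv_pair_mat_invertible[OF inv_pair_sym[OF vw0]] .
  have "zariski_near (n * n) w0 (\<lambda>w. \<forall>i\<in>Idx. idim w0 (fst i) (snd i) \<le> idim w (fst i) (snd i))"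
    by (intro zariski_near_ball fin idim_near) (auto simp: Idx_def dest!: mdown_subset)
  from zariski_near_conj[OF mat_invertible_near[OF w0] this]
  have 2: "zariski_near (n * n) w0 (\<lambda>w. \<exists>v. inv_pair n v w \<and> (\<forall>d<D. \<forall>S\<in>mdown d. jdim v d S = jdim v0 d S))"
  proof (rule zariski_near_mono)
    fix w assume w: "mat_invertible n w \<and> (\<forall>i\<in>Idx. idim w0 (fst i) (snd i) \<le> idim w (fst i) (snd i))"
    then obtain v where "inv_pair n w v" using ex_inv_pair[of n w] by blast
    then have v: "inv_pair n v w" by (rule inv_pair_sym)
    \<comment> \<open>Semicontinuity in \<open>w\<close> controls \<open>idim\<close>; at inverse
      pairs this is the same number as \<open>jdim\<close>.\<close>
    have "jdim v0 (fst i) (snd i) \<le> jdim v (fst i) (snd i)" if i: "i \<in> Idx" for i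
    proof -
      have "snd i \<subseteq> monset n (fst i)" using i by (intro mdown_subset) (auto simp: Idx_def)
      then show ?thesis using jdim_eq_idim[OF vw0] jdim_eq_idim[OF v] w i by simp
    qed
    then have "\<forall>d<D. \<forall>S\<in>mdown d. jdim v d S = jdim v0 d S"
      using inv_pair_mat_invertible[OF v] by (intro eq) simp_all
    then show "\<exists>v. inv_pair n v w \<and> (\<forall>d<D. \<forall>S\<in>mdown d. jdim v d S = jdim v0 d S)" using v by blast
  qed
  show ?thesis using that[OF vw0 1 2] .
qed

text \<open>Two nonempty open sets meet, so the generic value of the initial ideal is unique and the
  definite description in \<open>gin\<close> is justified.\<close>

lemma gin_eqI:
  assumes "zariski_near (n * n) v0 (\<lambda>v. mat_invertible n v \<and> init_mons n (gact n v I) = G)"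
  shows "gin n I = G"
  unfolding gin_def
proof (rule the_equality)
  show "generic (n * n) (\<lambda>v. mat_invertible n v \<and> init_mons n (gact n v I) = G)"
    using assms by (auto simp: generic_iff_near)
  fix G' assume "generic (n * n) (\<lambda>v. mat_invertible n v \<and> init_mons n (gact n v I) = G')"
  then obtain a where "zariski_near (n * n) a (\<lambda>v. mat_invertible n v \<and> init_mons n (gact n v I) = G')"
    by (auto simp: generic_iff_near)
  from zariski_near_common[OF assms this] show "G' = G" by blast
qed

end

context homog_artinian
begin

text \<open>The neighbourhood of \<open>v0\<close> serves the deformation argument for strong
  stability. The one in the inverse parameter \<open>w\<close> serves the Lefschetz condition,
  because the columns of \<open>w\<close> are the linear forms that \<open>v\<close> carries to the
  variables.\<close>

lemma gin_generic:
  obtains v0 w0 where "inv_pair n v0 w0" "init_mons n (gact n v0 I) = gin n I"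
    "zariski_near (n * n) v0 (\<lambda>v. mat_invertible n v \<and> (\<forall>d<D. \<forall>S\<in>mdown d. jdim v d S = jdim v0 d S))"
    "zariski_near (n * n) w0 (\<lambda>w. \<exists>v. inv_pair n v w \<and> init_mons n (gact n v I) = gin n I)"
proof -
  obtain v0 w0 where vw: "inv_pair n v0 w0"
    and 1: "zariski_near (n * n) v0 (\<lambda>v. mat_invertible n v \<and> (\<forall>d<D. \<forall>S\<in>mdown d. jdim v d S = jdim v0 d S))"
    and 2: "zariski_near (n * n) w0 (\<lambda>w. \<exists>v. inv_pair n v w \<and> (\<forall>d<D. \<forall>S\<in>mdown d. jdim v d S = jdim v0 d S))"
    by (rule ex_generic_point)
  have eq: "init_mons n (gact n v I) = init_mons n (gact n v0 I)"
    if "inv_pair n v w" "\<forall>d<D. \<forall>S\<in>mdown d. jdim v d S = jdim v0 d S" for v w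
    using that by (intro init_gact_cong[OF that(1) vw]) auto
  have "zariski_near (n * n) v0 (\<lambda>v. mat_invertible n v \<and> init_mons n (gact n v I) = init_mons n (gact n v0 I))"
    using 1
  proof (rule zariski_near_mono)
    fix v assume v: "mat_invertible n v \<and> (\<forall>d<D. \<forall>S\<in>mdown d. jdim v d S = jdim v0 d S)"
    then obtain w where "inv_pair n v w" using ex_inv_pair[of n v] by blast
    then show "mat_invertible n v \<and> init_mons n (gact n v I) = init_mons n (gact n v0 I)" using eq v by blast
  qed
  then have g: "gin n I = init_mons n (gact n v0 I)" by (rule gin_eqI)
  show ?thesis
  proof (rule that[OF vw g[symmetric] 1])
    show "zariski_near (n * n) w0 (\<lambda>w. \<exists>v. inv_pair n v w \<and> init_mons n (gact n v I) = gin n I)"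
      using 2 by (rule zariski_near_mono) (use eq g in blast)
  qed
qed

end

subsection \<open>Strong stability\<close>

definition shear :: "nat \<Rightarrow> nat \<Rightarrow> 'k::comm_ring_1 \<Rightarrow> nat \<Rightarrow> 'k mpoly" where
  "shear a b t j = (if j = b then Var b + const t * Var a else Var j)"

text \<open>\<open>F\<close> is the divided difference in \<open>t\<close>. Keeping it as a
  polynomial family makes it meaningful at \<open>t\<close> = 0, where it becomes the derivative.
  The parameter is a point of the affine line, so only coordinate 0 of \<open>t\<close> is
  read.\<close>

lemma shear_power_expand:
  "\<exists>F. polyfam 1 F \<and> (\<forall>t. (Var b + const (t 0) * Var a) ^ e = Var b ^ e + const (t 0) * F t)
     \<and> F (\<lambda>_. 0) = (of_nat e * Var b ^ (e - 1) * Var a :: 'k::field mpoly)"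
proof (induction e)
  case 0
  show ?case by (intro exI[of _ "\<lambda>_. 0"]) (auto intro: polyfam_const)
next
  case (Suc e)
  then obtain F where F: "polyfam 1 F" "\<And>t. (Var b + const (t 0) * Var a) ^ e = Var b ^ e + const (t 0) * F t"
    "F (\<lambda>_. 0) = (of_nat e * Var b ^ (e - 1) * Var a :: 'k mpoly)" by blast
  let ?F = "\<lambda>t. (Var b + const (t 0) * Var a) ^ e * Var a + Var b * F t"
  have "polyfam 1 ?F"
    using F(1) by (intro polyfam_add polyfam_mult polyfam_power polyfam_const polyfam_coeff polyfun_coord) auto
  moreover have "(Var b + const (t 0) * Var a) ^ Suc e = Var b ^ Suc e + const (t 0) * ?F t" for t
  proof -
    have "(Var b + const (t 0) * Var a) ^ Suc e =
        const (t 0) * ((Var b + const (t 0) * Var a) ^ e * Var a) + Var b * (Var b + const (t 0) * Var a) ^ e"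
      by (simp add: algebra_simps)
    also have "Var b * (Var b + const (t 0) * Var a) ^ e = Var b * (Var b ^ e + const (t 0) * F t)"
      by (simp only: F(2))
    finally show ?thesis by (simp add: algebra_simps)
  qed
  moreover have "?F (\<lambda>_. 0) = of_nat (Suc e) * Var b ^ (Suc e - 1) * Var a"
    by (cases e) (simp_all add: F(3) algebra_simps)
  ultimately show ?case by blast
qed

text \<open>At \<open>t\<close> = 0 only \<open>\<nu>\<close> with one factor x_b replaced by x_a
  appears. The relation between \<open>\<kappa>\<close> and \<open>\<nu>\<close> is written with
  sums to avoid truncated subtraction; if x_b does not divide \<open>\<nu>\<close>, the coefficient
  is 0 anyway.\<close>

lemma shear_monomial_expand:
  assumes "a \<noteq> b"
  shows "\<exists>F. polyfam 1 F \<and> (\<forall>t. subst (shear a b (t 0)) (single \<nu> 1) = single \<nu> 1 + const (t 0) * F t)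
    \<and> (\<forall>\<kappa>. lookup (F (\<lambda>_. 0)) \<kappa> =
         (if \<kappa> + single b 1 = \<nu> + single a 1 then of_nat (lookup \<nu> b) else (0::'k::field)))"
proof -
  define e where "e = lookup \<nu> b"
  define \<rho> where "\<rho> = \<nu> - single b e"
  have \<nu>: "\<nu> = \<rho> + single b e"
    by (rule poly_mapping_eqI) (auto simp: \<rho>_def lookup_add lookup_minus lookup_single when_def e_def)
  have \<rho>b: "lookup \<rho> b = 0" by (simp add: \<rho>_def lookup_minus e_def)
  obtain F where F: "polyfam 1 F" "\<And>t. (Var b + const (t 0) * Var a) ^ e = Var b ^ e + const (t 0) * F t"
    "F (\<lambda>_. 0) = (of_nat e * Var b ^ (e - 1) * Var a :: 'k mpoly)" using shear_power_expand by blast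
  have \<rho>: "mprod (shear a b t) \<rho> = single \<rho> (1::'k)" for t
  proof -
    have "mprod (shear a b t) \<rho> = mprod Var \<rho>"
      unfolding mprod_def using \<rho>b by (intro prod.cong) (auto simp: shear_def in_keys_iff)
    then show ?thesis by (simp add: mprod_Var)
  qed
  show ?thesis
  proof (intro exI[of _ "\<lambda>t. single \<rho> 1 * F t"] conjI allI)
    show "polyfam 1 (\<lambda>t. single \<rho> 1 * F t)" using F(1) by (intro polyfam_mult polyfam_const)
    show "subst (shear a b (t 0)) (single \<nu> 1) = single \<nu> 1 + const (t 0) * (single \<rho> 1 * F t)" for t
    proof -
      have "subst (shear a b (t 0)) (single \<nu> 1) = single \<rho> 1 * (Var b + const (t 0) * Var a) ^ e"
        by (simp add: subst_single \<nu> mprod_add \<rho>) (simp add: shear_def)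
      also have "\<dots> = single \<rho> 1 * Var b ^ e + const (t 0) * (single \<rho> 1 * F t)"
        unfolding F(2) by (simp add: algebra_simps)
      also have "single \<rho> 1 * Var b ^ e = single \<nu> (1::'k)"
        by (simp add: Var_power Poly_Mapping.mult_single \<nu>)
      finally show ?thesis .
    qed
    fix \<kappa>
    have "single \<rho> 1 * F (\<lambda>_. 0) = single (\<rho> + single b (e - 1) + single a 1) (of_nat e)"
      unfolding F(3) Var_power by (simp add: Var_def var_mon_def of_nat_single Poly_Mapping.mult_single add.assoc del: single_of_nat)
    moreover have "\<kappa> + single b 1 = \<nu> + single a 1 \<longleftrightarrow> \<kappa> = \<rho> + single b (e - 1) + single a 1" if "e > 0"
    proof -
      have "\<nu> + single a 1 = (\<rho> + single b (e - 1) + single a 1) + single b 1"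
        using that by (simp add: \<nu> add_ac single_add[symmetric])
      then show ?thesis by (metis add_right_cancel)
    qed
    ultimately show "lookup (single \<rho> 1 * F (\<lambda>_. 0)) \<kappa> =
        (if \<kappa> + single b 1 = \<nu> + single a 1 then of_nat (lookup \<nu> b) else 0)"
      unfolding e_def[symmetric] by (cases "e = 0") (auto simp: lookup_single when_def)
  qed
qed

text \<open>First-order expansion: the coefficients of F at 0 are those of x_a times the derivative of p
  with respect to x_b.\<close>
lemma shear_expand:
  fixes p :: "'k::field mpoly"
  assumes "a \<noteq> b"
  obtains F where "polyfam 1 F" "\<And>t. subst (shear a b (t 0)) p = p + const (t 0) * F t"
    "\<And>\<kappa>. lookup (F (\<lambda>_. 0)) \<kappa> =
       (\<Sum>\<nu>\<in>keys p. lookup p \<nu> * (if \<kappa> + single b 1 = \<nu> + single a 1 then of_nat (lookup \<nu> b) else 0))"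
proof -
  define P where "P = (\<lambda>\<nu> F. polyfam 1 F
    \<and> (\<forall>t. subst (shear a b (t 0)) (single \<nu> (1::'k)) = single \<nu> 1 + const (t 0) * F t)
    \<and> (\<forall>\<kappa>. lookup (F (\<lambda>_. 0)) \<kappa> = (if \<kappa> + single b 1 = \<nu> + single a 1 then of_nat (lookup \<nu> b) else 0)))"
  define F where "F = (\<lambda>\<nu>. SOME F. P \<nu> F)"
  have "P \<nu> (F \<nu>)" for \<nu>
  proof -
    have "\<exists>F. P \<nu> F" unfolding P_def by (rule shear_monomial_expand[OF assms])
    then show ?thesis unfolding F_def by (rule someI_ex)
  qed
  then have F: "polyfam 1 (F \<nu>)"
    "subst (shear a b (t 0)) (single \<nu> (1::'k)) = single \<nu> 1 + const (t 0) * F \<nu> t"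
    "lookup (F \<nu> (\<lambda>_. 0)) \<kappa> = (if \<kappa> + single b 1 = \<nu> + single a 1 then of_nat (lookup \<nu> b) else 0)"
    for \<nu> t \<kappa> unfolding P_def by blast+
  let ?F = "\<lambda>t. \<Sum>\<nu>\<in>keys p. const (lookup p \<nu>) * F \<nu> t"
  have 1: "polyfam 1 ?F" by (intro polyfam_sum polyfam_mult polyfam_const F(1))
  have p: "p = (\<Sum>\<nu>\<in>keys p. const (lookup p \<nu>) * single \<nu> 1)"
    by (simp flip: poly_mapping_sum_single)
  have 2: "subst (shear a b (t 0)) p = p + const (t 0) * ?F t" for t
  proof -
    have "subst (shear a b (t 0)) p = (\<Sum>\<nu>\<in>keys p. const (lookup p \<nu>) * (single \<nu> 1 + const (t 0) * F \<nu> t))"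
      by (subst (1) p) (simp only: subst_sum subst_mult subst_const F(2))
    also have "\<dots> = (\<Sum>\<nu>\<in>keys p. const (lookup p \<nu>) * single \<nu> 1) + const (t 0) * ?F t"
      by (simp only: distrib_left sum.distrib sum_distrib_left mult.left_commute)
    finally show ?thesis using p by simp
  qed
  show ?thesis by (rule that[OF 1 2]) (simp add: lookup_sum F(3))
qed

context homog_artinian
begin

text \<open>Let f be led by m = \<open>\<mu>\<close> x_b and suppose that m' = \<open>\<mu>\<close>
  x_a is not initial. The shear turns f into f + t F(t), and F(0) is led by m' with coefficient the
  exponent of x_b in m, nonzero in characteristic 0. So F(0) lies outside the space spanned by the
  ideal and the monomials below m', and adjoining F(t) gives a dimension larger by at least one for
  t near 0. For t different from 0, however, F(t) already lies in the corresponding space at t,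
  since f and its shear do, and the dimension of that space is constant near t = 0.\<close>

lemma gin_strongly_stable:
  assumes m: "\<mu> + single b 1 \<in> gin n I" and ab: "a < b" "b < n"
  shows "\<mu> + single a 1 \<in> gin n I"
proof (rule ccontr)
  assume neg: "\<mu> + single a 1 \<notin> gin n I"
  define m m' where "m = \<mu> + single b 1" and "m' = \<mu> + single a 1"
  obtain v0 w0 where vw: "inv_pair n v0 w0" and g: "init_mons n (gact n v0 I) = gin n I"
    and near: "zariski_near (n * n) v0 (\<lambda>v. mat_invertible n v \<and> (\<forall>d<D. \<forall>S\<in>mdown d. jdim v d S = jdim v0 d S))"
    by (rule gin_generic)
  define J where "J = gact n v0 I"
  have J: "is_ideal n J" "homogeneous_ideal J" unfolding J_def
    using gact_ideal[OF vw ideal] gact_homogeneous[OF vw ideal homogeneous] by auto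
  define d where "d = mdeg m"
  have keysm: "keys m \<subseteq> {..<n}" using m g by (auto simp: init_mons_def m_def)
  have m'd: "m' \<in> monset n d"
    using keysm ab by (auto simp: monset_def m_def m'_def d_def keys_add_mon)
  \<comment> \<open>Only degrees below \<open>D\<close> are covered by the constancy of dimensions;
    a missing monomial must lie there.\<close>
  have dD: "d < D" using init_gact_high[OF vw m'd] neg g by (auto simp: m'_def not_le[symmetric])
  have gt: "mon_gt m' m"
    unfolding m_def m'_def using ab by (auto simp: mon_gt_iff lookup_add lookup_single when_def intro!: exI[of _ b])
  let ?L = "monlt n m'"
  have Ldown: "?L \<in> mdown d" using m'd by (auto simp: mdown_def)
  obtain f where f: "f \<in> J" "leads f m"
    using m g init_mons_iff[OF J] by (auto simp: J_def m_def)
  have fd: "f \<in> gpart J d" using f by (auto simp: gpart_def leads_def d_def)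
  then obtain q where q: "q \<in> gpart I d" "f = act n v0 q" unfolding J_def gpart_gact[OF vw ideal] by blast
  have fL: "keys f \<subseteq> ?L"
  proof
    fix \<nu> assume "\<nu> \<in> keys f"
    then have "\<nu> \<in> monset n d" "mon_gt m' \<nu>"
      using gpart_keys[OF J(1) fd] f(2) gt mon_gt_trans by (auto simp: leads_def)
    then show "\<nu> \<in> ?L" using m'd by (auto simp: monlt_def monset_def)
  qed
  obtain F where F: "polyfam 1 F" "\<And>t. subst (shear a b (t 0)) f = f + const (t 0) * F t"
    "\<And>\<kappa>. lookup (F (\<lambda>_. 0)) \<kappa> =
       (\<Sum>\<nu>\<in>keys f. lookup f \<nu> * (if \<kappa> + single b 1 = \<nu> + single a 1 then of_nat (lookup \<nu> b) else 0))"
    using shear_expand[of a b f] ab by blast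
  define t0 where "t0 = (\<lambda>_::nat. 0::'k)"
  define e where "e = (of_nat (lookup m b) :: 'k)"
  have e: "e \<noteq> 0" unfolding e_def of_nat_eq_0_iff by (simp add: m_def lookup_add)
  have mm': "m' + single b 1 = m + single a 1" by (simp add: m_def m'_def add_ac)
  \<comment> \<open>Among the monomials of \<open>f\<close>, only \<open>m\<close> itself is carried
    to \<open>m'\<close>.\<close>
  have Fm': "lookup (F t0) m' = e"
  proof -
    have "lookup (F t0) m' = (\<Sum>\<nu>\<in>keys f. if \<nu> = m then lookup f \<nu> * of_nat (lookup \<nu> b) else 0)"
      unfolding t0_def F(3) mm' by (intro sum.cong) auto
    then show ?thesis using f(2) by (auto simp: leads_def in_keys_iff e_def)
  qed
  \<comment> \<open>Exchanging one x_b for x_a preserves the order, so monomials below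
    \<open>m\<close> land below \<open>m'\<close>.\<close>
  have Fkeys: "\<kappa> \<in> ?L" if \<kappa>: "\<kappa> \<in> keys (F t0)" "\<kappa> \<noteq> m'" for \<kappa>
  proof -
    have "(\<Sum>\<nu>\<in>keys f. lookup f \<nu> * (if \<kappa> + single b 1 = \<nu> + single a 1 then of_nat (lookup \<nu> b) else 0)) \<noteq> 0"
      using \<kappa>(1) unfolding in_keys_iff t0_def F(3) .
    then obtain \<nu> where \<nu>: "\<nu> \<in> keys f" "\<kappa> + single b 1 = \<nu> + single a 1"
      by (rule sum.not_neutral_contains_not_neutral) (auto split: if_splits)
    have "\<nu> \<noteq> m" using \<nu>(2) mm' \<kappa>(2) by (metis add_right_cancel)
    then have "mon_gt m \<nu>" using f(2) \<nu>(1) by (auto simp: leads_def)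
    then have "mon_gt (m' + single b 1) (\<kappa> + single b 1)" unfolding mm' \<nu>(2) by simp
    then have gt: "mon_gt m' \<kappa>" by simp
    have "mdeg (\<kappa> + single b 1) = mdeg (\<nu> + single a 1)" "keys (\<kappa> + single b 1) = keys (\<nu> + single a 1)"
      using \<nu>(2) by simp_all
    then have "mdeg \<kappa> = mdeg \<nu>" "keys \<kappa> \<subseteq> keys \<nu> \<union> {a}" by (auto simp: keys_add_mon)
    then have "\<kappa> \<in> monset n d"
      using gpart_keys[OF J(1) fd] \<nu>(1) ab by (fastforce simp: monset_def)
    then show ?thesis using gt m'd by (auto simp: monlt_def monset_def)
  qed
  have spanL: "p \<in> mp.span (X \<union> (\<lambda>m. single m 1) ` ?L)" if "keys p \<subseteq> ?L" for p :: "'k mpoly" and X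
    using that span_single_iff[of p ?L] mp.span_mono[of "(\<lambda>m. single m 1) ` ?L" "X \<union> (\<lambda>m. single m 1) ` ?L"]
    by blast
  \<comment> \<open>Adding t times row \<open>b\<close> to row \<open>a\<close> gives the matrix of
    \<open>v0\<close> followed by the shear, so the deformation is a line through \<open>v0\<close>
    in the space of matrices.\<close>
  define s where "s = (\<lambda>t k. v0 k + (if k div n = a then t (0::nat) * v0 (b * n + k mod n) else 0))"
  have s0: "s t0 = v0" by (simp add: s_def t0_def fun_eq_iff)
  have gs: "gsubst n (s t) j = subst (shear a b (t 0)) (gsubst n v0 j)" if j: "j < n" for t j
  proof -
    have "gsubst n (s t) j = (\<Sum>l<n. const (v0 (l*n+j)) * Var l + (if l = a then const (t 0 * v0 (b*n+j)) * Var l else 0))"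
      using j by (auto simp: gsubst_def s_def const_add distrib_right intro!: sum.cong)
    also have "\<dots> = (\<Sum>l<n. const (v0 (l*n+j)) * Var l) + const (t 0 * v0 (b*n+j)) * Var a"
      using ab by (simp add: sum.distrib)
    also have "\<dots> = (\<Sum>l<n. const (v0 (l*n+j)) * Var l + (if l = b then const (v0 (l*n+j)) * (const (t 0) * Var a) else 0))"
      using ab by (simp add: sum.distrib const_mult mult_ac)
    also have "\<dots> = (\<Sum>l<n. const (v0 (l*n+j)) * shear a b (t 0) l)"
      by (intro sum.cong) (auto simp: shear_def distrib_left)
    finally show ?thesis using j by (simp add: gsubst_def subst_sum subst_mult)
  qed
  have act_s: "act n (s t) p = subst (shear a b (t 0)) (act n v0 p)" if "p \<in> polyR n" for t p
    unfolding subst_subst using that gs by (rule subst_cong)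
  let ?W = "\<lambda>i t. case i of Inl p \<Rightarrow> act n (s t) p | Inr m \<Rightarrow> single m 1"
  let ?A = "\<lambda>t. act n (s t) ` E d \<union> (\<lambda>m. single m 1) ` ?L"
  have WA: "(\<lambda>i. ?W i t) ` (E d <+> ?L) = ?A t" for t by (force simp: Plus_def)
  have fin: "finite (E d <+> ?L)" "finite (?A t)" for t using E(2) finite_monlt by auto
  obtain T where T: "T \<subseteq> E d <+> ?L" "mp.indep_fam T (\<lambda>i. ?W i t0)" "card T = mp.dim (?A t0)"
    by (rule mp.ex_indep_subfam[OF fin(1), of "\<lambda>i. ?W i t0"]) (simp only: WA)
  have finT: "finite T" using T(1) fin(1) by (rule finite_subset)
  have notin: "F t0 \<notin> mp.span (?A t0)"
  proof
    assume "F t0 \<in> mp.span (?A t0)"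
    moreover have "keys (F t0 - const e * single m' 1) \<subseteq> ?L"
    proof
      fix \<kappa> assume \<kappa>: "\<kappa> \<in> keys (F t0 - const e * single m' 1)"
      then have "\<kappa> \<noteq> m'" using Fm' by (auto simp: in_keys_iff lookup_minus)
      moreover from this \<kappa> have "\<kappa> \<in> keys (F t0)"
        by (auto simp: in_keys_iff lookup_minus lookup_single)
      ultimately show "\<kappa> \<in> ?L" using Fkeys by blast
    qed
    then have "F t0 - const e * single m' 1 \<in> mp.span (?A t0)" by (rule spanL)
    ultimately have "F t0 - (F t0 - const e * single m' 1) \<in> mp.span (?A t0)" by (rule mp.span_diff)
    then have "const e * single m' 1 \<in> mp.span (?A t0)" by simp
    then have "const (inverse e) * (const e * single m' 1) \<in> mp.span (?A t0)"
      by (rule mp.span_scale)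
    moreover have "const (inverse e) * (const e * single m' 1) = single m' (1::'k)" using e by simp
    ultimately have "single m' 1 \<in> mp.span (?A t0)" by (simp only:)
    then have "single m' 1 \<in> mp.span (gpart J d \<union> (\<lambda>m. single m 1) ` ?L)"
      unfolding J_def span_gact[OF vw] s0 .
    then show False using init_mons_span[OF J m'd] neg g by (simp add: J_def m'_def)
  qed
  \<comment> \<open>The extra index \<open>None\<close> stands for F(t), adjoined to a maximal
    independent subfamily at t = 0.\<close>
  let ?V = "\<lambda>i t. case i of None \<Rightarrow> F t | Some i \<Rightarrow> ?W i t"
  let ?T = "insert None (Some ` T)"
  have "mp.indep_fam (Some ` T) (\<lambda>i. ?V i t0)"
    using T(2) unfolding mp.indep_fam_def by (auto simp: sum.reindex)
  moreover have "(\<lambda>i. ?V i t0) ` Some ` T \<subseteq> ?A t0" using T(1) WA[of t0] by auto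
  then have "F t0 \<notin> mp.span ((\<lambda>i. ?V i t0) ` Some ` T)" using notin mp.span_mono by blast
  ultimately have ind: "mp.indep_fam ?T (\<lambda>i. ?V i t0)"
    using finT by (intro mp.indep_fam_insert) auto
  have ps: "polyfun 1 (\<lambda>t. s t k)" for k
  proof (cases "k div n = a")
    case True
    then show ?thesis unfolding s_def
      by simp (intro polyfun_add polyfun_mult polyfun_const polyfun_coord, simp)
  next
    case False
    then show ?thesis unfolding s_def by simp (rule polyfun_const)
  qed
  have "polyfam 1 (\<lambda>t. gsubst n (s t) j)" if "j < n" for j
    unfolding gsubst_def using that
    by (simp del: One_nat_def) (intro polyfam_sum polyfam_mult polyfam_const polyfam_coeff ps)
  then have pact: "polyfam 1 (\<lambda>t. act n (s t) p)" if "p \<in> polyR n" for p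
    using that by (intro polyfam_subst[of p n]) auto
  have "polyfam 1 (?W x)" if "x \<in> E d <+> ?L" for x
    using that by (rule PlusE) (auto simp del: One_nat_def intro!: polyfam_const pact intro: E_polyR)
  then have "polyfam 1 (?V i)" if "i \<in> ?T" for i
    using that T(1) F(1) by (cases i) auto
  then have "polyfun 1 (\<lambda>t. lookup (?V i t) \<kappa>)" if "i \<in> ?T" for i \<kappa>
    using that unfolding polyfam_def by blast
  then have near1: "zariski_near 1 t0 (\<lambda>t. mp.indep_fam ?T (\<lambda>i. ?V i t))"
    using finT ind by (intro indep_fam_open[where W="?V" and ?v0.0=t0]) auto
  have "zariski_near (n * n) (s t0) (\<lambda>v. \<forall>d<D. \<forall>S\<in>mdown d. jdim v d S = jdim v0 d S)"
    unfolding s0 using near by (rule zariski_near_mono) blast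
  from zariski_near_compose[where s=s, OF this ps]
  have near2: "zariski_near 1 t0 (\<lambda>t. \<forall>d<D. \<forall>S\<in>mdown d. jdim (s t) d S = jdim v0 d S)" .
  \<comment> \<open>The previous neighbourhoods are centred at 0; the complement of 0 is also open
    and nonempty, so they share a point where division by t is possible.\<close>
  have near3: "zariski_near 1 (\<lambda>_. 1) (\<lambda>t. t 0 \<noteq> (0::'k))"
    unfolding zariski_near_def by (intro exI[of _ "\<lambda>t. t 0"]) (auto intro: polyfun_coord)
  obtain t where "mp.indep_fam ?T (\<lambda>i. ?V i t) \<and> (\<forall>d<D. \<forall>S\<in>mdown d. jdim (s t) d S = jdim v0 d S)"
    and t0: "t 0 \<noteq> 0"
    by (rule zariski_near_common[OF zariski_near_conj[OF near1 near2] near3])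
  then have t: "mp.indep_fam ?T (\<lambda>i. ?V i t)" "\<forall>d<D. \<forall>S\<in>mdown d. jdim (s t) d S = jdim v0 d S" by simp_all
  have "F t \<in> mp.span (?A t)"
  proof -
    interpret l: Vector_Spaces.linear "\<lambda>(c::'k) p. const c * p" "\<lambda>c p. const c * p" "act n (s t)"
      by (rule linear_subst)
    have "q \<in> polyR n" using q(1) is_ideal_polyR[OF ideal] by (auto simp: gpart_def)
    then have "subst (shear a b (t 0)) f = act n (s t) q" unfolding q(2) by (simp add: act_s)
    moreover have "act n (s t) q \<in> mp.span (act n (s t) ` E d)"
      using E(3)[of d] q(1) by (auto simp: l.span_image)
    ultimately have "subst (shear a b (t 0)) f \<in> mp.span (?A t)"
      using mp.span_mono[of "act n (s t) ` E d" "?A t"] by auto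
    then have "subst (shear a b (t 0)) f - f \<in> mp.span (?A t)"
      using spanL[OF fL] by (rule mp.span_diff)
    then have "const (t 0) * F t \<in> mp.span (?A t)" unfolding F(2) by simp
    then have "const (inverse (t 0)) * (const (t 0) * F t) \<in> mp.span (?A t)"
      by (rule mp.span_scale)
    moreover have "const (inverse (t 0)) * (const (t 0) * F t) = F t"
      using t0 by (simp add: mult.assoc[symmetric] const_mult[symmetric])
    ultimately show ?thesis by (simp only:)
  qed
  moreover have "(\<lambda>i. ?V i t) ` Some ` T \<subseteq> ?A t" using T(1) WA[of t] by auto
  then have "(\<lambda>i. ?V i t) ` Some ` T \<subseteq> mp.span (?A t)" using mp.span_superset by (rule subset_trans)
  ultimately have "(\<lambda>i. ?V i t) ` ?T \<subseteq> mp.span (?A t)"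
    by (simp only: image_insert insert_subset option.case simp_thms)
  then have "card ?T \<le> mp.dim (?A t)" using finT fin(2) by (intro mp.indep_fam_card_le[OF _ t(1)]) auto
  moreover have "card ?T = Suc (card T)" using finT by (simp add: card_image)
  moreover have "mp.dim (?A t) = mp.dim (?A t0)" using t(2) dD Ldown s0 by (auto simp: jdim_def)
  ultimately show False using T(3) by simp
qed

end

section \<open>Strong Lefschetz elements\<close>

definition sl_elt :: "nat \<Rightarrow> 'k::comm_ring_1 mpoly set \<Rightarrow> 'k mpoly \<Rightarrow> bool" where
  "sl_elt n J L \<longleftrightarrow> (\<forall>d i.
      (\<forall>p\<in>polyR n. homog_of_deg d p \<longrightarrow> L ^ i * p \<in> J \<longrightarrow> p \<in> J) \<or>
      (\<forall>q\<in>polyR n. homog_of_deg (d + i) q \<longrightarrow>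
          (\<exists>p\<in>polyR n. homog_of_deg d p \<and> q - L ^ i * p \<in> J)))"

lemma slp_iff: "slp n J \<longleftrightarrow> (\<exists>L\<in>polyR n. homog_of_deg 1 L \<and> sl_elt n J L)"
  by (simp add: slp_def sl_elt_def)

lemma ideal_plus_cong:
  assumes "\<And>j. j < i \<Longrightarrow> Ls j = Ls' j" shows "ideal_plus n I Ls i = ideal_plus n I Ls' i"
proof -
  have "(\<Sum>j<i. r j * Ls j) = (\<Sum>j<i. r j * Ls' j)" for r :: "nat \<Rightarrow> 'a mpoly"
    using assms by (intro sum.cong) auto
  then show ?thesis by (simp add: ideal_plus_def)
qed

lemma ideal_plus_superset: "p \<in> I \<Longrightarrow> p \<in> ideal_plus n I Ls i"
  unfolding ideal_plus_def by (intro CollectI exI[of _ p] exI[of _ "\<lambda>_. 0"]) simp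

lemma ideal_plus_ideal:
  fixes I :: "'k::comm_ring_1 mpoly set"
  assumes I: "is_ideal n I" and L: "\<And>j. j < i \<Longrightarrow> Ls j \<in> polyR n"
  shows "is_ideal n (ideal_plus n I Ls i)"
  unfolding is_ideal_def
proof (intro conjI ballI subsetI)
  fix x assume "x \<in> ideal_plus n I Ls i"
  then show "x \<in> polyR n"
    using L is_ideal_polyR[OF I] by (auto simp: ideal_plus_def intro!: polyR_add polyR_sum polyR_mult)
next
  show "0 \<in> ideal_plus n I Ls i" using is_ideal_0[OF I] by (rule ideal_plus_superset)
next
  fix x y assume "x \<in> ideal_plus n I Ls i" "y \<in> ideal_plus n I Ls i"
  then obtain p r q s where x: "x = p + (\<Sum>j<i. r j * Ls j)" "p \<in> I" "\<forall>j<i. r j \<in> polyR n"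
    and y: "y = q + (\<Sum>j<i. s j * Ls j)" "q \<in> I" "\<forall>j<i. s j \<in> polyR n"
    unfolding ideal_plus_def by blast
  have "x + y = (p + q) + (\<Sum>j<i. (r j + s j) * Ls j)"
    by (simp add: x(1) y(1) distrib_right sum.distrib)
  then show "x + y \<in> ideal_plus n I Ls i"
    unfolding ideal_plus_def using x(2,3) y(2,3) is_ideal_add[OF I] polyR_add
    by (intro CollectI exI[of _ "p + q"] exI[of _ "\<lambda>j. r j + s j"]) blast
next
  fix a x :: "'k mpoly" assume a: "a \<in> polyR n" and "x \<in> ideal_plus n I Ls i"
  then obtain p r where x: "x = p + (\<Sum>j<i. r j * Ls j)" "p \<in> I" "\<forall>j<i. r j \<in> polyR n"
    unfolding ideal_plus_def by blast
  have "a * x = a * p + (\<Sum>j<i. (a * r j) * Ls j)"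
    by (simp add: x(1) distrib_left sum_distrib_left mult.assoc)
  then show "a * x \<in> ideal_plus n I Ls i"
    unfolding ideal_plus_def using x(2,3) is_ideal_mult[OF I a] polyR_mult[OF a]
    by (intro CollectI exI[of _ "a * p"] exI[of _ "\<lambda>j. a * r j"]) blast
qed

lemma ideal_plus_mult:
  assumes "is_ideal n I" "j < i" "q \<in> polyR n" shows "q * Ls j \<in> ideal_plus n I Ls i"
proof -
  have "q * Ls j = 0 + (\<Sum>k<i. (if k = j then q else 0) * Ls k)"
    using assms(2) by (simp add: if_distrib[of "\<lambda>x. x * _"] cong: if_cong)
  then show ?thesis
    unfolding ideal_plus_def using assms(3) is_ideal_0[OF assms(1)]
    by (intro CollectI exI[of _ 0] exI[of _ "\<lambda>k. if k = j then q else 0"]) simp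
qed

lemma ideal_plus_homogeneous:
  assumes I: "homogeneous_ideal I" and L: "\<And>j. j < i \<Longrightarrow> homog_of_deg 1 (Ls j)"
  shows "homogeneous_ideal (ideal_plus n I Ls i)"
  unfolding homogeneous_ideal_def
proof (intro ballI allI)
  fix x d assume "x \<in> ideal_plus n I Ls i"
  then obtain p r where x: "x = p + (\<Sum>j<i. r j * Ls j)" "p \<in> I" "\<forall>j<i. r j \<in> polyR n"
    unfolding ideal_plus_def by blast
  have "homog_comp d x = homog_comp d p + (\<Sum>j<i. (if 1 \<le> d then homog_comp (d - 1) (r j) else 0) * Ls j)"
    unfolding x(1) homog_comp_add homog_comp_sum using homog_comp_mult_homog[OF L]
    by (auto intro!: sum.cong)
  then show "homog_comp d x \<in> ideal_plus n I Ls i"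
    unfolding ideal_plus_def using x(2,3) I
    by (intro CollectI exI[of _ "homog_comp d p"] exI[of _ "\<lambda>j. if 1 \<le> d then homog_comp (d - 1) (r j) else 0"])
      (auto simp: homogeneous_ideal_def intro: polyR_homog_comp)
qed

subsection \<open>Combinatorial form of the Lefschetz condition\<close>

text \<open>Multiplication by the e-th power of the m-th variable on standard monomials in the first
  m variables: the alternatives are injectivity and surjectivity on this basis. The m-th variable
  has index \<open>m - 1\<close>.\<close>

definition slcomb :: "mon set \<Rightarrow> nat \<Rightarrow> bool" where
  "slcomb G m \<longleftrightarrow> (\<forall>d e. (\<forall>M\<in>monset m d. M \<notin> G \<longrightarrow> M + single (m - 1) e \<notin> G) \<or>
     (\<forall>M\<in>monset m (d + e). M \<notin> G \<longrightarrow> e \<le> lookup M (m - 1)))"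

section \<open>The last variable in the reverse lexicographic order\<close>

lemma monset_mono: "m \<le> n \<Longrightarrow> monset m d \<subseteq> monset n d"
  by (auto simp: monset_def)

lemma lookup_beyond: assumes "keys \<mu> \<subseteq> {..<m}" "m \<le> l" shows "lookup (\<mu>::mon) l = 0"
proof (rule ccontr)
  assume "lookup \<mu> l \<noteq> 0"
  then have "l \<in> keys \<mu>" by (simp add: in_keys_iff)
  then show False using assms by auto
qed

text \<open>The two monomials last differ at the largest variable of \<open>\<nu>\<close>, which is
  absent from \<open>\<mu>\<close>. Hence, in a fixed degree, terms lost by setting the final
  variables to zero are smaller than all terms that survive.\<close>

lemma mon_gt_of_larger_var:
  assumes "mdeg \<mu> = mdeg \<nu>" "keys \<mu> \<subseteq> {..<m}" "\<not> keys \<nu> \<subseteq> {..<m}" shows "mon_gt \<mu> \<nu>"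
proof -
  let ?j = "Max (keys \<nu>)"
  obtain k where k: "k \<in> keys \<nu>" "k \<ge> m" using assms(3) by (auto simp: not_less subset_iff)
  have j: "?j \<in> keys \<nu>" using k(1) by (intro Max_in) auto
  have jm: "?j \<ge> m" using order_trans[OF k(2) Max_ge[OF finite_keys k(1)]] .
  have big: "lookup \<nu> l = 0" if "l > ?j" for l
  proof (rule ccontr)
    assume "lookup \<nu> l \<noteq> 0"
    then have "l \<in> keys \<nu>" by (simp add: in_keys_iff)
    from Max_ge[OF finite_keys this] that show False by simp
  qed
  have small: "lookup \<mu> l = 0" if "l \<ge> m" for l
    using lookup_beyond[OF assms(2) that] .
  have "lookup \<nu> ?j \<noteq> 0" using j unfolding in_keys_iff .
  moreover have "lookup \<mu> ?j = 0" using small[OF jm] .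
  ultimately have "lookup \<mu> ?j < lookup \<nu> ?j" by simp
  moreover have "\<forall>l>?j. lookup \<mu> l = lookup \<nu> l" using big small jm by simp
  ultimately show ?thesis unfolding mon_gt_iff using assms(1) by blast
qed

text \<open>The order looks at the last variable first. Consequently a form in m variables whose
  leading monomial is divisible by a power of the last variable is itself divisible by that
  power.\<close>

lemma mon_gt_last_le:
  assumes "\<mu> \<in> monset m d" "\<nu> \<in> monset m d" "mon_gt \<mu> \<nu>"
  shows "lookup \<mu> (m - 1) \<le> lookup \<nu> (m - 1)"
proof -
  obtain j where j: "lookup \<mu> j < lookup \<nu> j" "\<forall>l>j. lookup \<mu> l = lookup \<nu> l"
    using assms by (auto simp: mon_gt_iff monset_def)
  have "j < m" using j(1) lookup_beyond[of \<nu> m j] assms(2) by (cases "j < m") (auto simp: monset_def)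
  then show ?thesis using j by (cases "j = m - 1") auto
qed

lemma mon_gt_last_less:
  assumes "\<mu> \<in> monset m d" "\<nu> \<in> monset m d" "lookup \<mu> (m - 1) < lookup \<nu> (m - 1)"
  shows "mon_gt \<mu> \<nu>"
proof -
  have "\<forall>l>m - 1. lookup \<mu> l = lookup \<nu> l"
    using assms(1,2) lookup_beyond[of _ m] by (auto simp: monset_def)
  then show ?thesis using assms by (auto simp: mon_gt_iff monset_def)
qed

lemma ex_Var_power_factor:
  fixes r :: "'k::comm_ring_1 mpoly"
  assumes "\<And>\<nu>. \<nu> \<in> keys r \<Longrightarrow> e \<le> lookup \<nu> j"
  obtains p where "r = single (single j e) 1 * p"
proof -
  have "single j e + (\<nu> - single j e) = \<nu>" if "\<nu> \<in> keys r" for \<nu>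
    using assms[OF that] by (intro poly_mapping_eqI) (auto simp: lookup_add lookup_minus lookup_single when_def)
  then have "single (single j e) 1 * (\<Sum>\<nu>\<in>keys r. single (\<nu> - single j e) (lookup r \<nu>)) = (\<Sum>\<nu>\<in>keys r. single \<nu> (lookup r \<nu>))"
    by (auto simp: sum_distrib_left Poly_Mapping.mult_single intro!: sum.cong)
  from that[OF sym[OF this[folded poly_mapping_sum_single]]] show ?thesis .
qed

text \<open>\<open>K\<close> adjoins to \<open>J\<close> the variables of index at least
  \<open>m\<close>, listed from the last one downwards to match the order of the generic linear
  forms. Modulo \<open>K\<close>, the monomials in the first \<open>m\<close> variables outside
  \<open>G\<close> form a basis.\<close>

locale truncated_ideal =
  fixes n m :: nat and J K :: "'k::field mpoly set" and G :: "mon set"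
  assumes J: "is_ideal n J" "homogeneous_ideal J" and m: "1 \<le> m" "m \<le> n"
    and K_def: "K = ideal_plus n J (\<lambda>j. Var (n - 1 - j)) (n - m)"
    and G_def: "G = init_mons n J"
begin

lemma K: "is_ideal n K"
  unfolding K_def by (rule ideal_plus_ideal[OF J(1)]) (use m in auto)

lemma K_superset: "p \<in> J \<Longrightarrow> p \<in> K"
  unfolding K_def by (rule ideal_plus_superset)

lemma single_in_K:
  assumes "keys \<nu> \<subseteq> {..<n}" "\<not> keys \<nu> \<subseteq> {..<m}" shows "single \<nu> c \<in> K"
proof -
  obtain j where j: "j \<in> keys \<nu>" "m \<le> j" "j < n" using assms by (force simp: subset_iff)
  have "\<nu> = (\<nu> - single j 1) + single j 1"
    using j(1) by (intro poly_mapping_eqI) (auto simp: lookup_add lookup_minus lookup_single when_def in_keys_iff)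
  moreover have "keys (\<nu> - single j 1) \<subseteq> keys \<nu>"
    by (auto simp: in_keys_iff lookup_minus)
  ultimately have "single \<nu> c = single (\<nu> - single j 1) c * Var j" "single (\<nu> - single j 1) c \<in> polyR n"
    using assms(1) by (auto simp: Var_def var_mon_def Poly_Mapping.mult_single intro!: polyR_single)
  moreover have "single (\<nu> - single j 1) c * Var (n - 1 - (n - 1 - j)) \<in> K"
    unfolding K_def using j m calculation(2) by (intro ideal_plus_mult[OF J(1)]) auto
  ultimately show ?thesis using j(3) by simp
qed

text \<open>On monomials in the first \<open>m\<close> variables, \<open>p\<close> agrees with an
  element of \<open>J\<close>. The other terms of that element in degree \<open>d\<close> involve a
  later variable and are smaller, so \<open>\<mu>\<close> leads in \<open>J\<close> as well.\<close>

lemma K_lead: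
  assumes p: "p \<in> K" "homog_of_deg d p" and \<mu>: "\<mu> \<in> keys p" "keys \<mu> \<subseteq> {..<m}"
    and gt: "\<And>\<nu>. \<nu> \<in> keys p \<Longrightarrow> \<nu> \<noteq> \<mu> \<Longrightarrow> keys \<nu> \<subseteq> {..<m} \<Longrightarrow> mon_gt \<mu> \<nu>"
  shows "\<mu> \<in> G"
proof -
  obtain q r where q: "p = q + (\<Sum>j<n-m. r j * Var (n - 1 - j))" "q \<in> J"
    using p(1) unfolding K_def ideal_plus_def by blast
  have z: "lookup (s * Var j) \<nu> = 0" if "keys \<nu> \<subseteq> {..<m}" "j \<ge> m" for s :: "'k mpoly" and j \<nu>
  proof (rule ccontr)
    assume "lookup (s * Var j) \<nu> \<noteq> 0"
    then have "\<nu> \<in> keys (s * Var j)" by (simp add: in_keys_iff)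
    then have "j \<in> keys \<nu>"
      using Poly_Mapping.keys_mult[of s "Var j"] by (auto simp: Var_def var_mon_def keys_add_mon)
    then show False using that by auto
  qed
  have eq: "lookup p \<nu> = lookup q \<nu>" if "keys \<nu> \<subseteq> {..<m}" for \<nu>
    unfolding q(1) lookup_add lookup_sum using z[OF that] m by (simp add: sum.neutral)
  define c where "c = lookup q \<mu>"
  have c: "c \<noteq> 0" using \<mu> eq by (simp add: c_def in_keys_iff)
  have d: "mdeg \<mu> = d" using p(2) \<mu>(1) by (simp add: homog_of_deg_def)
  define f where "f = const (inverse c) * homog_comp d q"
  have "f \<in> J" unfolding f_def using J q(2) by (intro is_ideal_scale[OF J(1)]) (auto simp: homogeneous_ideal_def)
  moreover have "leads f \<mu>"
    unfolding leads_def
  proof (intro conjI ballI impI)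
    show "homog_of_deg (mdeg \<mu>) f" by (simp add: f_def d homog_scale homog_homog_comp)
    show "lookup f \<mu> = 1" using c by (simp add: f_def lookup_homog_comp d c_def)
    fix \<nu> assume \<nu>: "\<nu> \<in> keys f" "\<nu> \<noteq> \<mu>"
    then have \<nu>d: "mdeg \<nu> = d" "lookup q \<nu> \<noteq> 0"
      by (auto simp: f_def in_keys_iff lookup_homog_comp split: if_splits)
    show "mon_gt \<mu> \<nu>"
    proof (cases "keys \<nu> \<subseteq> {..<m}")
      case True
      then show ?thesis using gt \<nu> \<nu>d eq by (auto simp: in_keys_iff)
    next
      case False
      then show ?thesis using mon_gt_of_larger_var[OF _ \<mu>(2)] d \<nu>d by simp
    qed
  qed
  ultimately show ?thesis
    unfolding G_def using init_mons_iff[OF J] \<mu>(2) m by auto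
qed

lemma subspace_K: "mp.subspace K"
  by (rule mp.subspaceI) (auto simp: is_ideal_0[OF K] is_ideal_add[OF K] is_ideal_scale[OF K])

text \<open>Replacing an initial monomial by the tail of an element of \<open>J\<close> that it
  leads produces only smaller monomials of the same degree, so the induction on the order
  terminates.\<close>

lemma K_reduce_monomial:
  assumes "\<mu> \<in> monset n d"
  shows "single \<mu> 1 \<in> mp.span (K \<union> (\<lambda>\<nu>. single \<nu> 1) ` {\<nu>\<in>monset m d. \<nu> \<notin> G})" (is "_ \<in> mp.span ?X")
  using assms
proof (induction \<mu> rule: mon_wf_induct)
  case (less \<mu>)
  have k: "keys \<mu> \<subseteq> {..<n}" and d: "mdeg \<mu> = d" using less.hyps by (auto simp: monset_def)
  consider "\<not> keys \<mu> \<subseteq> {..<m}" | "keys \<mu> \<subseteq> {..<m}" "\<mu> \<notin> G" | "\<mu> \<in> G" by blast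
  then show ?case
  proof cases
    case 1
    then show ?thesis using single_in_K[OF k] by (intro mp.span_base) blast
  next
    case 2
    then show ?thesis using d by (intro mp.span_base) (auto simp: monset_def)
  next
    case 3
    then obtain f where f: "f \<in> J" "leads f \<mu>" using init_mons_iff[OF J] by (auto simp: G_def)
    have fd: "keys f \<subseteq> monset n d"
      using f d by (intro gpart_keys[OF J(1)]) (auto simp: gpart_def leads_def)
    have "single \<nu> 1 \<in> mp.span ?X" if "\<nu> \<in> keys (f - single \<mu> 1)" for \<nu>
    proof -
      have "\<nu> \<in> keys f" "\<nu> \<noteq> \<mu>"
        using that f(2) by (auto simp: in_keys_iff lookup_minus lookup_single leads_def when_def split: if_splits)
      then show ?thesis using less.IH fd f(2) by (auto simp: leads_def)
    qed
    then have "(\<Sum>\<nu>\<in>keys (f - single \<mu> 1). const (lookup (f - single \<mu> 1) \<nu>) * single \<nu> 1) \<in> mp.span ?X"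
      by (intro mp.span_sum mp.span_scale)
    then have "f - single \<mu> 1 \<in> mp.span ?X"
      by (simp flip: poly_mapping_sum_single)
    moreover have "f \<in> mp.span ?X" using f(1) K_superset by (intro mp.span_base) blast
    ultimately have "f - (f - single \<mu> 1) \<in> mp.span ?X" by (rule mp.span_diff[rotated])
    then show ?thesis by simp
  qed
qed

lemma K_reduce:
  assumes "p \<in> polyR n" "homog_of_deg d p"
  obtains r where "keys r \<subseteq> {\<nu>\<in>monset m d. \<nu> \<notin> G}" "p - r \<in> K"
proof -
  let ?X = "(\<lambda>\<nu>. single \<nu> (1::'k)) ` {\<nu>\<in>monset m d. \<nu> \<notin> G}"
  have "keys p \<subseteq> monset n d" using assms polyR_homog_iff by blast
  then have "(\<Sum>\<nu>\<in>keys p. const (lookup p \<nu>) * single \<nu> 1) \<in> mp.span (K \<union> ?X)"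
    by (intro mp.span_sum mp.span_scale K_reduce_monomial) auto
  then have "p \<in> mp.span (K \<union> ?X)" by (simp flip: poly_mapping_sum_single)
  then obtain k r where "p = k + r" "k \<in> K" "r \<in> mp.span ?X"
    using mp.span_eq_iff[THEN iffD2, OF subspace_K] by (auto simp: mp.span_Un)
  then show ?thesis using that[of r] by (simp add: span_single_iff)
qed

lemma keys_std_polyR: "keys r \<subseteq> {\<nu>\<in>monset m d. \<nu> \<notin> G} \<Longrightarrow> r \<in> polyR n \<and> homog_of_deg d r"
  using polyR_homog_iff[of r n d] monset_mono[OF m(2), of d] by blast

text \<open>Standard monomials represent the quotient, and the order compares exponents of the last
  remaining variable first. For these two reasons injectivity and surjectivity are each equivalent
  to their monomial versions.\<close>

lemma sl_elt_iff_slcomb: "sl_elt n K (Var (m - 1)) \<longleftrightarrow> slcomb G m"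
proof
  assume sl: "sl_elt n K (Var (m - 1))"
  show "slcomb G m"
    unfolding slcomb_def
  proof (intro allI)
    fix d e
    consider (inj) "\<forall>p\<in>polyR n. homog_of_deg d p \<longrightarrow> Var (m - 1) ^ e * p \<in> K \<longrightarrow> p \<in> K"
      | (surj) "\<forall>q\<in>polyR n. homog_of_deg (d + e) q \<longrightarrow> (\<exists>p\<in>polyR n. homog_of_deg d p \<and> q - Var (m - 1) ^ e * p \<in> K)"
      using sl unfolding sl_elt_def by blast
    then show "(\<forall>M\<in>monset m d. M \<notin> G \<longrightarrow> M + single (m - 1) e \<notin> G) \<or>
      (\<forall>M\<in>monset m (d + e). M \<notin> G \<longrightarrow> e \<le> lookup M (m - 1))"
    proof cases
      case inj
      have "M \<in> G" if M: "M \<in> monset m d" "M + single (m - 1) e \<in> G" for M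
      proof -
        let ?M = "M + single (m - 1) e"
        have Mm: "?M \<in> monset m (d + e)" using M(1) m by (auto simp: monset_def keys_add_mon)
        obtain f where f: "f \<in> J" "leads f ?M" using M(2) init_mons_iff[OF J] by (auto simp: G_def)
        have fd: "keys f \<subseteq> monset n (d + e)"
          using f Mm by (intro gpart_keys[OF J(1)]) (auto simp: gpart_def leads_def monset_def)
        \<comment> \<open>\<open>f0\<close> is \<open>f\<close> with the variables of index at least
          \<open>m\<close> set to zero; it differs from \<open>f\<close> by an element of
          \<open>K\<close>.\<close>
        define A where "A = {\<nu>\<in>keys f. keys \<nu> \<subseteq> {..<m}}"
        define f0 where "f0 = (\<Sum>\<nu>\<in>A. single \<nu> (lookup f \<nu>))"
        have lf0: "lookup f0 \<nu> = (if keys \<nu> \<subseteq> {..<m} then lookup f \<nu> else 0)" for \<nu>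
          by (auto simp: f0_def A_def lookup_sum lookup_single when_def in_keys_iff)
        have "f - f0 = (\<Sum>\<nu>\<in>keys f - A. single \<nu> (lookup f \<nu>))"
        proof -
          have "f = (\<Sum>\<nu>\<in>keys f - A. single \<nu> (lookup f \<nu>)) + f0"
            unfolding f0_def by (subst sum.subset_diff[symmetric]) (auto simp: A_def poly_mapping_sum_single[symmetric])
          then show ?thesis by (metis add_diff_cancel_right')
        qed
        also have "\<dots> \<in> K"
          using fd by (intro is_ideal_sum[OF K] single_in_K) (auto simp: A_def monset_def)
        finally have "f - (f - f0) \<in> K" using is_ideal_diff[OF K K_superset[OF f(1)]] by blast
        then have f0K: "f0 \<in> K" by simp
        have kf0: "\<nu> \<in> monset m (d + e)" "\<nu> \<noteq> ?M \<Longrightarrow> mon_gt ?M \<nu>" if "\<nu> \<in> keys f0" for \<nu>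
          using that f(2) fd by (auto simp: in_keys_iff lf0 leads_def monset_def split: if_splits)
        have "e \<le> lookup \<nu> (m - 1)" if "\<nu> \<in> keys f0" for \<nu>
        proof (cases "\<nu> = ?M")
          case True then show ?thesis by (simp add: lookup_add)
        next
          case False
          have "e \<le> lookup ?M (m - 1)" by (simp add: lookup_add)
          also have "\<dots> \<le> lookup \<nu> (m - 1)" using kf0[OF that] False by (intro mon_gt_last_le[OF Mm]) auto
          finally show ?thesis .
        qed
        then obtain p where p: "f0 = single (single (m - 1) e) 1 * p" using ex_Var_power_factor by blast
        have keysp: "\<kappa> \<in> keys p \<longleftrightarrow> M + \<kappa> - M + single (m - 1) e \<in> keys f0" for \<kappa>
          unfolding p keys_single_mult by (auto simp: add.commute)
        then have kp: "\<kappa> + single (m - 1) e \<in> keys f0" if "\<kappa> \<in> keys p" for \<kappa> using that by simp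
        have "keys p \<subseteq> monset m d"
        proof
          fix \<kappa> assume "\<kappa> \<in> keys p"
          from kf0(1)[OF kp[OF this]] show "\<kappa> \<in> monset m d" by (auto simp: monset_def keys_add_mon)
        qed
        then have pR: "p \<in> polyR n" "homog_of_deg d p"
          using polyR_homog_iff[of p n d] monset_mono[OF m(2), of d] by blast+
        then have pK: "p \<in> K" using inj f0K unfolding p Var_power by blast
        show "M \<in> G"
        proof (rule K_lead[OF pK pR(2)])
          have "?M \<in> keys f0" using f(2) Mm by (auto simp: in_keys_iff lf0 leads_def monset_def)
          then show "M \<in> keys p" using keysp[of M] by simp
          show "keys M \<subseteq> {..<m}" using M(1) by (simp add: monset_def)
          fix \<kappa> assume "\<kappa> \<in> keys p" "\<kappa> \<noteq> M"
          then have "mon_gt ?M (\<kappa> + single (m - 1) e)" by (intro kf0(2) kp) auto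
          then show "mon_gt M \<kappa>" by simp
        qed
      qed
      then show ?thesis by blast
    next
      case surj
      have "e \<le> lookup M (m - 1)" if M: "M \<in> monset m (d + e)" "M \<notin> G" for M
      proof (rule ccontr)
        assume small: "\<not> e \<le> lookup M (m - 1)"
        have Mn: "M \<in> monset n (d + e)" using M(1) monset_mono[OF m(2)] by blast
        then have "single M 1 \<in> polyR n" "homog_of_deg (d + e) (single M (1::'k))"
          by (auto simp: monset_def intro: polyR_single homog_single)
        then obtain p where p: "p \<in> polyR n" "homog_of_deg d p" "single M 1 - Var (m - 1) ^ e * p \<in> K"
          using surj by blast
        let ?P = "single M 1 - Var (m - 1) ^ e * p"
        have big: "e \<le> lookup \<nu> (m - 1)" if "\<nu> \<in> keys (Var (m - 1) ^ e * p)" for \<nu>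
          using that unfolding Var_power keys_single_mult by (auto simp: lookup_add)
        have "homog_of_deg (e * 1 + d) (Var (m - 1) ^ e * p)"
          using p(2) by (intro homog_mult homog_power homog_Var)
        then have hom: "homog_of_deg (d + e) ?P"
          using \<open>homog_of_deg (d + e) (single M (1::'k))\<close> by (intro homog_diff) (auto simp: add.commute)
        \<comment> \<open>\<open>M\<close> is not divisible by the power of the variable, so the
          product cannot cancel it; the monomials of the product in the first \<open>m\<close>
          variables have a larger last exponent and hence are smaller than \<open>M\<close>.\<close>
        have "M \<in> G"
        proof (rule K_lead[OF p(3) hom])
          have "M \<notin> keys (Var (m - 1) ^ e * p)" using big small by blast
          then show "M \<in> keys ?P" by (simp add: in_keys_iff lookup_minus)
          show "keys M \<subseteq> {..<m}" using M(1) by (simp add: monset_def)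
          fix \<nu> assume \<nu>: "\<nu> \<in> keys ?P" "\<nu> \<noteq> M" "keys \<nu> \<subseteq> {..<m}"
          then have "\<nu> \<in> keys (Var (m - 1) ^ e * p)"
            by (auto simp: in_keys_iff lookup_minus lookup_single when_def split: if_splits)
          moreover have "\<nu> \<in> monset m (d + e)" using hom \<nu> by (auto simp: homog_of_deg_def monset_def)
          ultimately show "mon_gt M \<nu>" using big small M(1) by (intro mon_gt_last_less) (auto simp: not_le intro: less_le_trans)
        qed
        then show False using M(2) by simp
      qed
      then show ?thesis by blast
    qed
  qed
next
  assume comb: "slcomb G m"
  show "sl_elt n K (Var (m - 1))"
    unfolding sl_elt_def
  proof (intro allI)
    fix d e
    consider (inj) "\<forall>M\<in>monset m d. M \<notin> G \<longrightarrow> M + single (m - 1) e \<notin> G"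
      | (surj) "\<forall>M\<in>monset m (d + e). M \<notin> G \<longrightarrow> e \<le> lookup M (m - 1)"
      using comb unfolding slcomb_def by blast
    then show "(\<forall>p\<in>polyR n. homog_of_deg d p \<longrightarrow> Var (m - 1) ^ e * p \<in> K \<longrightarrow> p \<in> K) \<or>
      (\<forall>q\<in>polyR n. homog_of_deg (d + e) q \<longrightarrow> (\<exists>p\<in>polyR n. homog_of_deg d p \<and> q - Var (m - 1) ^ e * p \<in> K))"
    proof cases
      case inj
      have "p \<in> K" if p: "p \<in> polyR n" "homog_of_deg d p" "Var (m - 1) ^ e * p \<in> K" for p
      proof -
        obtain r where r: "keys r \<subseteq> {\<nu>\<in>monset m d. \<nu> \<notin> G}" "p - r \<in> K" using K_reduce[OF p(1,2)] .
        \<comment> \<open>A nonzero remainder has a standard leading monomial; its product with the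
          power would lead an element of \<open>K\<close> and so lie in \<open>G\<close>, against
          the monomial injectivity.\<close>
        have "r = 0"
        proof (rule ccontr)
          assume "r \<noteq> 0"
          note lm = lm_props[OF this]
          let ?V = "Var (m - 1) ^ e :: 'k mpoly"
          have V: "?V \<in> polyR n" using m by (intro polyR_power polyR_Var) auto
          have "?V * p - ?V * (p - r) \<in> K" using p(3) is_ideal_mult[OF K V r(2)] by (rule is_ideal_diff[OF K])
          then have "?V * r \<in> K" by (simp add: right_diff_distrib)
          moreover have "homog_of_deg (e * 1 + d) (?V * r)"
            using keys_std_polyR[OF r(1)] by (intro homog_mult homog_power homog_Var) auto
          ultimately have "single (m - 1) e + lm r \<in> G"
          proof (rule K_lead)
            show "single (m - 1) e + lm r \<in> keys (?V * r)" using lm(1) by (simp add: Var_power keys_single_mult)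
            show "keys (single (m - 1) e + lm r) \<subseteq> {..<m}"
              using lm(1) r(1) m by (auto simp: keys_add_mon monset_def subset_iff)
            fix \<nu> assume "\<nu> \<in> keys (?V * r)" "\<nu> \<noteq> single (m - 1) e + lm r"
            then show "mon_gt (single (m - 1) e + lm r) \<nu>" using lm(2) by (auto simp: Var_power keys_single_mult)
          qed
          then show False using inj lm(1) r(1) by (auto simp: add.commute)
        qed
        then show ?thesis using r(2) by simp
      qed
      then show ?thesis by blast
    next
      case surj
      have "\<exists>p\<in>polyR n. homog_of_deg d p \<and> q - Var (m - 1) ^ e * p \<in> K"
        if q: "q \<in> polyR n" "homog_of_deg (d + e) q" for q
      proof -
        obtain r where r: "keys r \<subseteq> {\<nu>\<in>monset m (d + e). \<nu> \<notin> G}" "q - r \<in> K" using K_reduce[OF q] .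
        then have "e \<le> lookup \<nu> (m - 1)" if "\<nu> \<in> keys r" for \<nu> using that surj by blast
        then obtain p where p: "r = single (single (m - 1) e) 1 * p" using ex_Var_power_factor by blast
        have "keys p \<subseteq> monset n d"
        proof
          fix \<kappa> assume "\<kappa> \<in> keys p"
          then have "single (m - 1) e + \<kappa> \<in> keys r" unfolding p keys_single_mult by blast
          then have "single (m - 1) e + \<kappa> \<in> monset m (d + e)" using r(1) by blast
          then have "\<kappa> \<in> monset m d" by (auto simp: monset_def keys_add_mon)
          then show "\<kappa> \<in> monset n d" using monset_mono[OF m(2)] by blast
        qed
        then have "p \<in> polyR n" "homog_of_deg d p" using polyR_homog_iff[of p n d] by blast+
        then show ?thesis using r(2) unfolding p Var_power by blast
      qed
      then show ?thesis by blast
    qed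
  qed
qed

end

subsection \<open>Transfer and genericity\<close>

lemma sl_elt_transfer:
  assumes vw: "inv_pair n v w" and Q: "\<And>p. p \<in> polyR n \<Longrightarrow> p \<in> Q \<longleftrightarrow> act n v p \<in> K"
    and L: "L \<in> polyR n" and sl: "sl_elt n K (act n v L)"
  shows "sl_elt n Q L"
  unfolding sl_elt_def
proof (intro allI)
  fix d i
  have LR: "L ^ i \<in> polyR n" using L by (rule polyR_power)
  consider (inj) "\<forall>p\<in>polyR n. homog_of_deg d p \<longrightarrow> act n v L ^ i * p \<in> K \<longrightarrow> p \<in> K"
    | (surj) "\<forall>q\<in>polyR n. homog_of_deg (d + i) q \<longrightarrow> (\<exists>p\<in>polyR n. homog_of_deg d p \<and> q - act n v L ^ i * p \<in> K)"
    using sl unfolding sl_elt_def by blast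
  then show "(\<forall>p\<in>polyR n. homog_of_deg d p \<longrightarrow> L ^ i * p \<in> Q \<longrightarrow> p \<in> Q) \<or>
      (\<forall>q\<in>polyR n. homog_of_deg (d + i) q \<longrightarrow> (\<exists>p\<in>polyR n. homog_of_deg d p \<and> q - L ^ i * p \<in> Q))"
  proof cases
    case inj
    have "p \<in> Q" if p: "p \<in> polyR n" "homog_of_deg d p" "L ^ i * p \<in> Q" for p
    proof -
      have "act n v (L ^ i * p) \<in> K" using p(3) Q[OF polyR_mult[OF LR p(1)]] by simp
      then have "act n v p \<in> K"
        using inj act_polyR[OF p(1)] act_homog[OF p(2,1)] by (simp add: subst_mult subst_power)
      then show ?thesis using Q[OF p(1)] by simp
    qed
    then show ?thesis by blast
  next
    case surj
    have "\<exists>p\<in>polyR n. homog_of_deg d p \<and> q - L ^ i * p \<in> Q" if q: "q \<in> polyR n" "homog_of_deg (d + i) q" for q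
    proof -
      obtain p where p: "p \<in> polyR n" "homog_of_deg d p" "act n v q - act n v L ^ i * p \<in> K"
        using surj act_polyR[OF q(1)] act_homog[OF q(2,1)] by blast
      have "act n v (act n w p) = p" using vw p(1) by (simp add: inv_pair_def)
      then have "act n v (q - L ^ i * act n w p) \<in> K" using p(3) by (simp add: subst_diff subst_mult subst_power)
      moreover have "q - L ^ i * act n w p \<in> polyR n" using q(1) LR act_polyR[OF p(1)] by (intro polyR_diff polyR_mult)
      ultimately have "q - L ^ i * act n w p \<in> Q" using Q by blast
      then show ?thesis using act_polyR[OF p(1)] act_homog[OF p(2,1)] by blast
    qed
    then show ?thesis by blast
  qed
qed

lemma ideal_plus_transfer:
  assumes vw: "inv_pair n v w" and I: "is_ideal n I" and p: "p \<in> polyR n"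
    and L: "\<And>j. j < i \<Longrightarrow> Ls j \<in> polyR n"
  shows "p \<in> ideal_plus n (gact n v I) Ls i \<longleftrightarrow> act n w p \<in> ideal_plus n I (\<lambda>j. act n w (Ls j)) i"
proof
  assume "p \<in> ideal_plus n (gact n v I) Ls i"
  then obtain q r where q: "p = q + (\<Sum>j<i. r j * Ls j)" "q \<in> gact n v I" "\<forall>j<i. r j \<in> polyR n"
    unfolding ideal_plus_def by blast
  have "act n w p = act n w q + (\<Sum>j<i. act n w (r j) * act n w (Ls j))"
    by (simp add: q(1) subst_add subst_sum subst_mult)
  moreover have "act n w q \<in> I" using q(2) gact_iff[OF vw I] by blast
  ultimately show "act n w p \<in> ideal_plus n I (\<lambda>j. act n w (Ls j)) i"
    unfolding ideal_plus_def using q(3)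
    by (intro CollectI exI[of _ "act n w q"] exI[of _ "\<lambda>j. act n w (r j)"]) (simp add: act_polyR)
next
  assume "act n w p \<in> ideal_plus n I (\<lambda>j. act n w (Ls j)) i"
  then obtain q r where q: "act n w p = q + (\<Sum>j<i. r j * act n w (Ls j))" "q \<in> I" "\<forall>j<i. r j \<in> polyR n"
    unfolding ideal_plus_def by blast
  have inv: "act n v (act n w s) = s" if "s \<in> polyR n" for s using vw that by (simp add: inv_pair_def)
  have "p = act n v q + (\<Sum>j<i. act n v (r j) * act n v (act n w (Ls j)))"
    using arg_cong[OF q(1), of "act n v"] inv[OF p] by (simp add: subst_add subst_sum subst_mult)
  also have "\<dots> = act n v q + (\<Sum>j<i. act n v (r j) * Ls j)" using inv[OF L] by simp
  finally show "p \<in> ideal_plus n (gact n v I) Ls i"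
    unfolding ideal_plus_def using q(2,3)
    by (intro CollectI exI[of _ "act n v q"] exI[of _ "\<lambda>j. act n v (r j)"]) (simp add: act_polyR gact_def)
qed

text \<open>A set of monomials maximal among those independent modulo \<open>Q\<close> represents a
  basis of the degree \<open>d\<close> part of the quotient. A maximal one exists because there are
  only finitely many monomials of degree \<open>d\<close>.\<close>

lemma ex_complement:
  fixes Q :: "'k::field mpoly set"
  assumes Q: "is_ideal n Q"
  obtains C where "finite C" "C \<subseteq> (\<lambda>\<nu>. single \<nu> 1) ` monset n d"
    "\<forall>a. (\<Sum>b\<in>C. const (a b) * b) \<in> Q \<longrightarrow> (\<forall>b\<in>C. a b = 0)"
    "\<forall>p\<in>polyR n. homog_of_deg d p \<longrightarrow> (\<exists>a. p - (\<Sum>b\<in>C. const (a b) * b) \<in> Q)"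
proof -
  let ?M = "(\<lambda>\<nu>. single \<nu> (1::'k)) ` monset n d"
  define good where "good = (\<lambda>C. \<forall>a. (\<Sum>b\<in>C. const (a b) * b) \<in> Q \<longrightarrow> (\<forall>b\<in>C. a b = 0))"
  have finM: "finite ?M" by (simp add: finite_monset)
  have "finite {C\<in>Pow ?M. good C}" using finM by simp
  moreover have "{} \<in> {C\<in>Pow ?M. good C}" by (simp add: good_def)
  ultimately obtain C where C: "C \<in> {C\<in>Pow ?M. good C}" "\<forall>C'\<in>{C\<in>Pow ?M. good C}. C \<subseteq> C' \<longrightarrow> C = C'"
    using finite_has_maximal2 by (metis (no_types, lifting))
  have CM: "C \<subseteq> ?M" and gC: "good C" using C(1) by auto
  have finC: "finite C" using CM finM by (rule finite_subset)
  have sQ: "mp.subspace Q"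
    by (rule mp.subspaceI) (auto simp: is_ideal_0[OF Q] is_ideal_add[OF Q] is_ideal_scale[OF Q])
  have M: "?M \<subseteq> mp.span (Q \<union> C)"
  proof
    fix x assume x: "x \<in> ?M"
    show "x \<in> mp.span (Q \<union> C)"
    proof (cases "x \<in> C")
      case True
      then show ?thesis by (intro mp.span_base) blast
    next
      case False
      have "\<not> good (insert x C)"
      proof
        assume "good (insert x C)"
        then have "C = insert x C" using C(2) x CM by blast
        then show False using False by blast
      qed
      then obtain a b where a: "(\<Sum>b\<in>insert x C. const (a b) * b) \<in> Q" "b \<in> insert x C" "a b \<noteq> 0"
        by (auto simp: good_def)
      have s: "(\<Sum>b\<in>insert x C. const (a b) * b) = const (a x) * x + (\<Sum>b\<in>C. const (a b) * b)"
        using False finC by simp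
      have ax: "a x \<noteq> 0"
      proof
        assume "a x = 0"
        then have "\<forall>b\<in>C. a b = 0" using a(1) gC unfolding s good_def by simp
        then show False using a(2,3) \<open>a x = 0\<close> by blast
      qed
      have "(\<Sum>b\<in>C. const (a b) * b) \<in> mp.span (Q \<union> C)"
        by (intro mp.span_sum mp.span_scale mp.span_base) blast
      moreover have "(\<Sum>b\<in>insert x C. const (a b) * b) \<in> mp.span (Q \<union> C)"
        using a(1) by (intro mp.span_base) blast
      ultimately have "(\<Sum>b\<in>insert x C. const (a b) * b) - (\<Sum>b\<in>C. const (a b) * b) \<in> mp.span (Q \<union> C)"
        by (rule mp.span_diff[rotated])
      then have "const (a x) * x \<in> mp.span (Q \<union> C)" unfolding s by simp
      then have "const (inverse (a x)) * (const (a x) * x) \<in> mp.span (Q \<union> C)" by (rule mp.span_scale)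
      moreover have "const (inverse (a x)) * (const (a x) * x) = x"
        using ax by (simp add: mult.assoc[symmetric] const_mult[symmetric])
      ultimately show ?thesis by (simp only:)
    qed
  qed
  show ?thesis
  proof (rule that[OF finC CM gC[unfolded good_def]], intro ballI impI)
    fix p :: "'k mpoly" assume "p \<in> polyR n" "homog_of_deg d p"
    then have "p \<in> mp.span ?M" using polyR_homog_iff[of p n d] by (simp add: span_single_iff)
    then have "p \<in> mp.span (Q \<union> C)" by (rule subsetD[OF mp.span_minimal[OF M mp.subspace_span]])
    then obtain q r where qr: "p = q + r" "q \<in> Q" "r \<in> mp.span C"
      using mp.span_eq_iff[THEN iffD2, OF sQ] by (auto simp: mp.span_Un)
    have "\<exists>a. r = (\<Sum>b\<in>C. const (a b) * b)"
      using qr(3) span_image_explicit[OF finC, of r "\<lambda>x. x"] by simp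
    then obtain a where "r = (\<Sum>b\<in>C. const (a b) * b)" by blast
    then have "p - (\<Sum>b\<in>C. const (a b) * b) \<in> Q" using qr by simp
    then show "\<exists>a. p - (\<Sum>b\<in>C. const (a b) * b) \<in> Q" by (rule exI[of _ a])
  qed
qed

section \<open>Openness of the set of strong Lefschetz forms\<close>

abbreviation linform :: "nat \<Rightarrow> (nat \<Rightarrow> 'k::comm_ring_1) \<Rightarrow> 'k mpoly" where
  "linform n c \<equiv> (\<Sum>l<n. const (c l) * Var l)"

lemma polyR_linform: "linform n c \<in> polyR n"
  by (intro polyR_sum polyR_mult) auto
lemma homog_linform: "homog_of_deg 1 (linform n c)"
  by (intro homog_sum homog_scale homog_Var)
lemma homog_linform_mult: "homog_of_deg d p \<Longrightarrow> homog_of_deg (d + e) (linform n c ^ e * p)"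
  using homog_mult[OF homog_power[OF homog_linform[where n=n and c=c], of e], of d p] by (simp add: add.commute)
lemma polyfam_linform: "polyfam n (\<lambda>c. linform n c)"
  by (intro polyfam_sum polyfam_mult polyfam_const polyfam_coeff polyfun_coord) auto

lemma ex_gpart_basis:
  fixes Q :: "'k::field mpoly set"
  assumes "is_ideal n Q"
  obtains B where "finite B" "B \<subseteq> gpart Q d" "mp.independent B" "gpart Q d = mp.span B"
proof -
  have "gpart Q d \<subseteq> mp.span ((\<lambda>m. single m 1) ` monset n d)"
    using gpart_keys[OF assms] by (auto simp: span_single_iff)
  then obtain B where B: "B \<subseteq> gpart Q d" "finite B" "mp.independent B" "gpart Q d \<subseteq> mp.span B"
    using mp.ex_finite_basis finite_monset finite_imageI by metis
  have "mp.span B \<subseteq> gpart Q d" using B(1) subspace_gpart[OF assms] by (rule mp.span_minimal)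
  then show ?thesis using that B by blast
qed

text \<open>Injectivity says that a basis of \<open>Q\<close> in degree \<open>d + e\<close>,
  together with the e-th power of the form times a monomial basis of the quotient in degree
  \<open>d\<close>, is an independent family. Independence persists nearby.\<close>

lemma injective_near:
  fixes Q :: "'k::field mpoly set"
  assumes Q: "is_ideal n Q"
    and inj: "\<And>p. p \<in> polyR n \<Longrightarrow> homog_of_deg d p \<Longrightarrow> linform n c ^ e * p \<in> Q \<Longrightarrow> p \<in> Q"
  shows "zariski_near n c (\<lambda>c'. \<forall>p\<in>polyR n. homog_of_deg d p \<longrightarrow> linform n c' ^ e * p \<in> Q \<longrightarrow> p \<in> Q)"
proof -
  obtain C where C: "finite C" "C \<subseteq> (\<lambda>\<nu>. single \<nu> 1) ` monset n d"
    "\<forall>a. (\<Sum>b\<in>C. const (a b) * b) \<in> Q \<longrightarrow> (\<forall>b\<in>C. a b = 0)"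
    "\<forall>p\<in>polyR n. homog_of_deg d p \<longrightarrow> (\<exists>a. p - (\<Sum>b\<in>C. const (a b) * b) \<in> Q)"
    by (rule ex_complement[OF Q, of d])
  obtain B where B: "finite B" "B \<subseteq> gpart Q (d + e)" "mp.independent B" "gpart Q (d + e) = mp.span B"
    by (rule ex_gpart_basis[OF Q])
  let ?W = "\<lambda>i c. case i of Inl p \<Rightarrow> p | Inr b \<Rightarrow> linform n c ^ e * b"
  have sumW: "(\<Sum>i\<in>B <+> C. const (a i) * ?W i c) =
      (\<Sum>p\<in>B. const (a (Inl p)) * p) + linform n c ^ e * (\<Sum>b\<in>C. const (a (Inr b)) * b)" for a c
    using B(1) C(1) by (simp add: sum.Plus) (simp only: sum_distrib_left mult.left_commute)
  have CR: "(\<Sum>b\<in>C. const (a b) * b) \<in> polyR n" "homog_of_deg d (\<Sum>b\<in>C. const (a b) * b)" for a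
    using C(2) by (auto simp: monset_def intro!: polyR_sum polyR_mult homog_sum homog_scale intro: polyR_single homog_single)
  have "mp.indep_fam (B <+> C) (\<lambda>i. ?W i c)"
    unfolding mp.indep_fam_def
  proof (intro allI impI)
    fix a assume "(\<Sum>i\<in>B <+> C. const (a i) * ?W i c) = 0"
    then have z: "(\<Sum>p\<in>B. const (a (Inl p)) * p) + linform n c ^ e * (\<Sum>b\<in>C. const (a (Inr b)) * b) = 0"
      unfolding sumW .
    have "(\<Sum>p\<in>B. const (a (Inl p)) * p) \<in> Q"
      using B(2) by (intro is_ideal_sum[OF Q] is_ideal_scale[OF Q]) (auto simp: gpart_def)
    moreover have "linform n c ^ e * (\<Sum>b\<in>C. const (a (Inr b)) * b) = - (\<Sum>p\<in>B. const (a (Inl p)) * p)"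
      using z by (simp add: eq_neg_iff_add_eq_0 add.commute)
    ultimately have "linform n c ^ e * (\<Sum>b\<in>C. const (a (Inr b)) * b) \<in> Q"
      using is_ideal_uminus[OF Q] by simp
    then have "(\<Sum>b\<in>C. const (a (Inr b)) * b) \<in> Q" by (rule inj[OF CR])
    with C(3)[rule_format, of "\<lambda>b. a (Inr b)"] have c0: "\<forall>b\<in>C. a (Inr b) = 0" by blast
    then have "(\<Sum>p\<in>B. const (a (Inl p)) * p) = 0" using z by (simp add: sum.neutral)
    then have "a (Inl p) = 0" if "p \<in> B" for p
      using mp.independentD[OF B(3,1) subset_refl, of "\<lambda>p. a (Inl p)" p] that by blast
    then show "\<forall>i\<in>B <+> C. a i = 0" using c0 by auto
  qed
  moreover have "polyfam n (?W i)" for i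
    by (cases i) (auto intro!: polyfam_mult polyfam_power polyfam_linform polyfam_const)
  ultimately have "zariski_near n c (\<lambda>c'. mp.indep_fam (B <+> C) (\<lambda>i. ?W i c'))"
    using B(1) C(1) by (intro indep_fam_open[where W="?W"]) (auto simp: polyfam_def)
  then show ?thesis
  proof (rule zariski_near_mono, intro ballI impI)
    fix c' p assume ind: "mp.indep_fam (B <+> C) (\<lambda>i. ?W i c')"
      and p: "p \<in> polyR n" "homog_of_deg d p" "linform n c' ^ e * p \<in> Q"
    let ?L = "linform n c' ^ e"
    obtain a where a: "p - (\<Sum>b\<in>C. const (a b) * b) \<in> Q" using C(4) p(1,2) by blast
    have "?L * (p - (\<Sum>b\<in>C. const (a b) * b)) \<in> Q"
      by (rule is_ideal_mult[OF Q polyR_power[OF polyR_linform] a])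
    from is_ideal_diff[OF Q p(3) this] have "?L * (\<Sum>b\<in>C. const (a b) * b) \<in> Q"
      by (simp add: right_diff_distrib)
    then have "?L * (\<Sum>b\<in>C. const (a b) * b) \<in> mp.span B"
      unfolding B(4)[symmetric] using homog_linform_mult[OF CR(2)] by (auto simp: gpart_def)
    then have "\<exists>g. ?L * (\<Sum>b\<in>C. const (a b) * b) = (\<Sum>x\<in>B. const (g x) * x)"
      using span_image_explicit[OF B(1), of _ "\<lambda>x. x"] by simp
    then obtain g where g: "?L * (\<Sum>b\<in>C. const (a b) * b) = (\<Sum>x\<in>B. const (g x) * x)" by blast
    let ?a = "\<lambda>i. case i of Inl x \<Rightarrow> - g x | Inr b \<Rightarrow> a b"
    have "(\<Sum>i\<in>B <+> C. const (?a i) * ?W i c') = 0"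
      unfolding sumW by (simp add: g const_uminus sum_negf)
    from mp.indep_famD[OF ind this] have "a b = 0" if "b \<in> C" for b using that by (metis InrI sum.case(2))
    then have "(\<Sum>b\<in>C. const (a b) * b) = 0" by (simp add: sum.neutral)
    then show "p \<in> Q" using a by simp
  qed
qed

text \<open>Surjectivity says that \<open>Q\<close> in degree \<open>d + e\<close> and the multiples
  of the e-th power together fill all forms of that degree. The rank is then as large as possible,
  and it cannot drop nearby.\<close>

lemma surjective_near:
  fixes Q :: "'k::field mpoly set"
  assumes Q: "is_ideal n Q" "homogeneous_ideal Q"
    and surj: "\<And>q. q \<in> polyR n \<Longrightarrow> homog_of_deg (d + e) q \<Longrightarrow>
      \<exists>p\<in>polyR n. homog_of_deg d p \<and> q - linform n c ^ e * p \<in> Q"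
  shows "zariski_near n c (\<lambda>c'. \<forall>q\<in>polyR n. homog_of_deg (d + e) q \<longrightarrow>
      (\<exists>p\<in>polyR n. homog_of_deg d p \<and> q - linform n c' ^ e * p \<in> Q))"
proof -
  obtain B where B: "finite B" "B \<subseteq> gpart Q (d + e)" "mp.independent B" "gpart Q (d + e) = mp.span B"
    by (rule ex_gpart_basis[OF Q(1)])
  let ?W = "\<lambda>i c. case i of Inl p \<Rightarrow> p | Inr \<nu> \<Rightarrow> linform n c ^ e * single \<nu> 1"
  let ?A = "\<lambda>c. B \<union> (\<lambda>\<nu>. linform n c ^ e * single \<nu> 1) ` monset n d"
  let ?M = "(\<lambda>\<nu>. single \<nu> (1::'k)) ` monset n (d + e)"
  have WA: "(\<lambda>i. ?W i c) ` (B <+> monset n d) = ?A c" for c by (force simp: Plus_def)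
  have finA: "finite (?A c)" for c using B(1) finite_monset by simp
  have finM: "finite ?M" by (simp add: finite_monset)
  have AM: "?A c \<subseteq> mp.span ?M" for c
  proof -
    have "linform n c ^ e * single \<nu> 1 \<in> mp.span ?M" if "\<nu> \<in> monset n d" for \<nu>
    proof -
      have "single \<nu> 1 \<in> polyR n" "homog_of_deg d (single \<nu> (1::'k))"
        using that by (auto simp: monset_def intro: polyR_single homog_single)
      then have "linform n c ^ e * single \<nu> 1 \<in> polyR n \<and> homog_of_deg (d + e) (linform n c ^ e * single \<nu> 1)"
        using homog_linform_mult polyR_mult[OF polyR_power[OF polyR_linform]] by blast
      then show ?thesis unfolding span_single_iff polyR_homog_iff .
    qed
    moreover have "B \<subseteq> mp.span ?M"
      using B(2) gpart_keys[OF Q(1)] by (fastforce simp: span_single_iff)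
    ultimately show ?thesis by blast
  qed
  have "?M \<subseteq> mp.span (?A c)"
  proof
    fix x assume "x \<in> ?M"
    then have "x \<in> polyR n" "homog_of_deg (d + e) x"
      by (auto simp: monset_def intro: polyR_single homog_single)
    then obtain p where p: "p \<in> polyR n" "homog_of_deg d p" "x - linform n c ^ e * p \<in> Q"
      using surj by blast
    have "x - linform n c ^ e * p \<in> gpart Q (d + e)"
      using p \<open>homog_of_deg (d + e) x\<close> by (auto simp: gpart_def intro: homog_diff homog_linform_mult)
    then have "x - linform n c ^ e * p \<in> mp.span (?A c)"
      unfolding B(4) using mp.span_mono[of B "?A c"] by blast
    moreover have "linform n c ^ e * p = (\<Sum>\<nu>\<in>keys p. const (lookup p \<nu>) * (linform n c ^ e * single \<nu> 1))"
    proof -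
      have "p = (\<Sum>\<nu>\<in>keys p. const (lookup p \<nu>) * single \<nu> 1)" by (simp flip: poly_mapping_sum_single)
      then have "linform n c ^ e * p = linform n c ^ e * (\<Sum>\<nu>\<in>keys p. const (lookup p \<nu>) * single \<nu> 1)" by simp
      then show ?thesis by (simp only: sum_distrib_left mult.left_commute)
    qed
    moreover have "(\<Sum>\<nu>\<in>keys p. const (lookup p \<nu>) * (linform n c ^ e * single \<nu> 1)) \<in> mp.span (?A c)"
      using p(1,2) polyR_homog_iff[of p n d] by (intro mp.span_sum mp.span_scale mp.span_base) blast
    ultimately have "(x - linform n c ^ e * p) + linform n c ^ e * p \<in> mp.span (?A c)"
      by (intro mp.span_add) (simp_all only:)
    then show "x \<in> mp.span (?A c)" by simp
  qed
  then have dimM: "mp.dim ?M \<le> mp.dim (?A c)" by (rule mp.dim_mono_finite[OF finA])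
  have "polyfam n (?W i)" for i
    by (cases i) (auto intro!: polyfam_mult polyfam_power polyfam_linform polyfam_const)
  then have "zariski_near n c (\<lambda>c'. mp.dim ((\<lambda>i. ?W i c) ` (B <+> monset n d)) \<le> mp.dim ((\<lambda>i. ?W i c') ` (B <+> monset n d)))"
    using B(1) finite_monset by (intro dim_open[where W="?W"]) auto
  then show ?thesis unfolding WA
  proof (rule zariski_near_mono, intro ballI impI)
    fix c' :: "nat \<Rightarrow> 'k" and q :: "'k mpoly"
    assume le: "mp.dim (?A c) \<le> mp.dim (?A c')" and q: "q \<in> polyR n" "homog_of_deg (d + e) q"
    have M: "?M \<subseteq> mp.span (?A c')"
      using le dimM by (intro mp.subset_span_of_dim[OF finM finA AM]) simp
    have "q \<in> mp.span ?M" using q polyR_homog_iff[of q n "d + e"] by (simp add: span_single_iff)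
    then have "q \<in> mp.span (?A c')" by (rule subsetD[OF mp.span_minimal[OF M mp.subspace_span]])
    then obtain a b where ab: "q = a + b" "a \<in> mp.span B" "b \<in> mp.span ((\<lambda>\<nu>. linform n c' ^ e * single \<nu> 1) ` monset n d)"
      by (auto simp: mp.span_Un)
    from span_image_explicit[OF finite_monset ab(3)] obtain g
      where g: "b = (\<Sum>\<nu>\<in>monset n d. const (g \<nu>) * (linform n c' ^ e * single \<nu> 1))" by blast
    define p where "p = (\<Sum>\<nu>\<in>monset n d. const (g \<nu>) * single \<nu> 1)"
    have "b = linform n c' ^ e * p"
      unfolding g p_def sum_distrib_left by (intro sum.cong refl mult.left_commute)
    moreover have "p \<in> polyR n" "homog_of_deg d p"
      unfolding p_def by (auto simp: monset_def intro!: polyR_sum homog_sum intro: polyR_single homog_single)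
    moreover have "a \<in> Q" using ab(2) B(4) by (auto simp: gpart_def)
    ultimately show "\<exists>p\<in>polyR n. homog_of_deg d p \<and> q - linform n c' ^ e * p \<in> Q"
      using ab(1) by (intro bexI[of _ p]) auto
  qed
qed

text \<open>If \<open>d + e\<close> is at least \<open>D\<close>, the target of the multiplication
  is zero and surjectivity is automatic. Only finitely many pairs of degree and exponent remain, so
  their neighbourhoods can be intersected.\<close>

lemma sl_elt_near:
  fixes Q :: "'k::field mpoly set"
  assumes Q: "is_ideal n Q" "homogeneous_ideal Q"
    and high: "\<And>d p. d \<ge> D \<Longrightarrow> p \<in> polyR n \<Longrightarrow> homog_of_deg d p \<Longrightarrow> p \<in> Q"
    and sl: "sl_elt n Q (linform n c)"
  shows "zariski_near n c (\<lambda>c'. sl_elt n Q (linform n c'))"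
proof -
  define P where "P = (\<lambda>d e c. (\<forall>p\<in>polyR n. homog_of_deg d p \<longrightarrow> linform n c ^ e * p \<in> Q \<longrightarrow> p \<in> Q) \<or>
      (\<forall>q\<in>polyR n. homog_of_deg (d + e) q \<longrightarrow> (\<exists>p\<in>polyR n. homog_of_deg d p \<and> q - linform n c ^ e * p \<in> Q)))"
  have near: "zariski_near n c (P d e)" for d e
  proof -
    consider "\<forall>p\<in>polyR n. homog_of_deg d p \<longrightarrow> linform n c ^ e * p \<in> Q \<longrightarrow> p \<in> Q"
      | "\<forall>q\<in>polyR n. homog_of_deg (d + e) q \<longrightarrow> (\<exists>p\<in>polyR n. homog_of_deg d p \<and> q - linform n c ^ e * p \<in> Q)"
      using sl unfolding sl_elt_def by blast
    then show ?thesis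
    proof cases
      case 1
      then have "zariski_near n c (\<lambda>c'. \<forall>p\<in>polyR n. homog_of_deg d p \<longrightarrow> linform n c' ^ e * p \<in> Q \<longrightarrow> p \<in> Q)"
        by (intro injective_near[OF Q(1)]) blast
      then show ?thesis by (rule zariski_near_mono) (simp add: P_def)
    next
      case 2
      then have "zariski_near n c (\<lambda>c'. \<forall>q\<in>polyR n. homog_of_deg (d + e) q \<longrightarrow>
          (\<exists>p\<in>polyR n. homog_of_deg d p \<and> q - linform n c' ^ e * p \<in> Q))"
        by (intro surjective_near[OF Q]) blast
      then show ?thesis by (rule zariski_near_mono) (simp add: P_def)
    qed
  qed
  have triv: "P d e c'" if "D \<le> d + e" for d e c'
  proof -
    have "q - linform n c' ^ e * 0 \<in> Q" if "q \<in> polyR n" "homog_of_deg (d + e) q" for q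
      using high[OF \<open>D \<le> d + e\<close> that] by simp
    then show ?thesis unfolding P_def using polyR_0 homog_0 by blast
  qed
  have "zariski_near n c (\<lambda>c'. \<forall>i\<in>{..<D} \<times> {..<D}. P (fst i) (snd i) c')"
    by (intro zariski_near_ball near) auto
  then show ?thesis
  proof (rule zariski_near_mono)
    fix c' assume a: "\<forall>i\<in>{..<D} \<times> {..<D}. P (fst i) (snd i) c'"
    have "P d e c'" for d e
    proof (cases "D \<le> d + e")
      case False
      then have "(d, e) \<in> {..<D} \<times> {..<D}" by auto
      with a have "P (fst (d, e)) (snd (d, e)) c'" by blast
      then show ?thesis by simp
    qed (rule triv)
    then show "sl_elt n Q (linform n c')" unfolding sl_elt_def P_def by blast
  qed
qed

lemma linear_form_eq:
  assumes "L \<in> polyR n" "homog_of_deg 1 L" shows "L = linform n (\<lambda>l. lookup L (var_mon l))"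
proof (rule poly_mapping_eqI)
  fix m
  show "lookup L m = lookup (linform n (\<lambda>l. lookup L (var_mon l))) m"
  proof (cases "m \<in> monset n 1")
    case True
    have "\<exists>k<n. m = var_mon k"
    proof -
      have "keys m \<noteq> {}" using True by (auto simp: monset_def)
      then obtain k where k: "k \<in> keys m" by blast
      have "m = single k 1 + (m - single k 1)"
        using k by (intro poly_mapping_eqI) (auto simp: lookup_add lookup_minus lookup_single when_def in_keys_iff)
      moreover from arg_cong[OF this, of mdeg] have "mdeg (m - single k 1) = 0" using True by (simp add: monset_def)
      ultimately have "m = var_mon k" by (simp add: mdeg_eq_0_iff var_mon_def)
      then show ?thesis using k True by (auto simp: monset_def)
    qed
    then show ?thesis using lookup_linear_form[of "\<lambda>l. lookup L (var_mon l)" n] by auto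
  next
    case False
    have "keys L \<subseteq> monset n 1" "keys (linform n (\<lambda>l. lookup L (var_mon l))) \<subseteq> monset n 1"
      unfolding polyR_homog_iff[symmetric] using assms polyR_linform homog_linform by auto
    then have "m \<notin> keys L" "m \<notin> keys (linform n (\<lambda>l. lookup L (var_mon l)))"
      using False by blast+
    then show ?thesis by (simp add: in_keys_iff)
  qed
qed

lemma index_less: "l < n \<Longrightarrow> j < (i::nat) \<Longrightarrow> j * n + l < n * i"
proof -
  assume "l < n" "j < i"
  then have "j * n + l < Suc j * n" by simp
  also have "\<dots> \<le> i * n" using \<open>j < i\<close> by (intro mult_le_mono1) simp
  finally show ?thesis by (simp add: mult.commute)
qed

lemma lin_cong: "(\<And>l. l < n \<Longrightarrow> u (j * n + l) = u' (j * n + l)) \<Longrightarrow> lin n u j = lin n u' j"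
  unfolding lin_def by (intro sum.cong) auto

section \<open>Generic linear forms against the generic coordinate change\<close>

context homog_artinian
begin

text \<open>The rows of u are listed in reverse order: the first rows are the forms that are killed first,
  and they correspond to the last variables.\<close>
definition good_rows :: "(nat \<Rightarrow> 'k) \<Rightarrow> bool" where
  "good_rows u \<longleftrightarrow> (\<exists>v w. inv_pair n v w \<and> init_mons n (gact n v I) = gin n I \<and>
     (\<forall>k<n. gsubst n w k = lin n u (n - 1 - k)))"

lemma good_rows_near: obtains u0 where "zariski_near (n * n) u0 good_rows"
proof -
  obtain v0 w0 where near: "zariski_near (n * n) w0 (\<lambda>w. \<exists>v. inv_pair n v w \<and> init_mons n (gact n v I) = gin n I)"
    by (rule gin_generic)
  \<comment> \<open>\<open>gsubst\<close> reads the columns of a matrix while \<open>lin\<close>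
    reads rows. The rearrangement \<open>tr\<close> makes column k equal to row n - 1 - k of
    \<open>u\<close>, and \<open>u0\<close> is a preimage of \<open>w0\<close> under it on the n * n
    entries that matter.\<close>
  define tr where "tr = (\<lambda>(u :: nat \<Rightarrow> 'k) x. u ((n - 1 - x mod n) * n + x div n))"
  define u0 where "u0 = (\<lambda>x. w0 ((x mod n) * n + (n - 1 - x div n)))"
  have dm: "x div n < n" "x mod n < n" if "x < n * n" for x
    using that by (auto simp: less_mult_imp_div_less) (metis mod_less_divisor mult_0 neq0_conv not_less0)
  have "w0 x = tr u0 x" if x: "x < n * n" for x
  proof -
    have "((n - 1 - x mod n) * n + x div n) div n = n - 1 - x mod n"
      "((n - 1 - x mod n) * n + x div n) mod n = x div n" using dm[OF x] by auto
    moreover have "n - 1 - (n - 1 - x mod n) = x mod n" using dm(2)[OF x] by linarith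
    ultimately have "tr u0 x = w0 (x div n * n + x mod n)" unfolding tr_def u0_def by simp
    then show ?thesis by simp
  qed
  then have "zariski_near (n * n) (tr u0) (\<lambda>w. \<exists>v. inv_pair n v w \<and> init_mons n (gact n v I) = gin n I)"
    by (rule zariski_near_cong[OF near])
  then have "zariski_near (n * n) u0 (\<lambda>u. \<exists>v. inv_pair n v (tr u) \<and> init_mons n (gact n v I) = gin n I)"
  proof (rule zariski_near_compose)
    fix x assume x: "x < n * n"
    then have "n - 1 - x mod n < n" using dm[OF x] by simp
    then show "polyfun (n * n) (\<lambda>u. tr u x)"
      unfolding tr_def by (intro polyfun_coord index_less dm[OF x])
  qed
  then have "zariski_near (n * n) u0 good_rows"
  proof (rule zariski_near_mono)
    fix u assume "\<exists>v. inv_pair n v (tr u) \<and> init_mons n (gact n v I) = gin n I"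
    moreover have "gsubst n (tr u) k = lin n u (n - 1 - k)" if "k < n" for k
      using that by (simp add: gsubst_def lin_def tr_def)
    ultimately show "good_rows u" unfolding good_rows_def by blast
  qed
  then show ?thesis using that by blast
qed

text \<open>The change \<open>v\<close> carries the first \<open>i\<close> rows of \<open>u\<close>
  to the last variables, and row \<open>i\<close> to the last variable that remains, so the
  criterion of \<open>truncated_ideal\<close> applies with n - i variables.\<close>

lemma good_rows_sl:
  assumes u: "good_rows u" and i: "i < n"
  shows "sl_elt n (ideal_plus n I (lin n u) i) (lin n u i) \<longleftrightarrow> slcomb (gin n I) (n - i)"
proof -
  obtain v w where vw: "inv_pair n v w" and G: "init_mons n (gact n v I) = gin n I"
    and row: "\<And>k. k < n \<Longrightarrow> gsubst n w k = lin n u (n - 1 - k)"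
    using u unfolding good_rows_def by blast
  let ?J = "gact n v I"
  let ?K = "ideal_plus n ?J (\<lambda>j. Var (n - 1 - j)) i" and ?Q = "ideal_plus n I (lin n u) i"
  interpret truncated_ideal n "n - i" ?J ?K "gin n I"
    by unfold_locales
      (use i G gact_ideal[OF vw ideal] gact_homogeneous[OF vw ideal homogeneous] in auto)
  have "ideal_plus n I (\<lambda>j. act n w (Var (n - 1 - j))) i = ?Q"
    using i row by (intro ideal_plus_cong) simp
  then have KQ: "p \<in> ?K \<longleftrightarrow> act n w p \<in> ?Q" if "p \<in> polyR n" for p
    using ideal_plus_transfer[OF vw ideal that, of i "\<lambda>j. Var (n - 1 - j)"] i by simp
  have QK: "p \<in> ?Q \<longleftrightarrow> act n v p \<in> ?K" if "p \<in> polyR n" for p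
    using KQ[OF act_polyR[OF that]] vw that by (simp add: inv_pair_def)
  have V: "(Var (n - i - 1) :: 'k mpoly) \<in> polyR n" using i by simp
  have L: "act n w (Var (n - i - 1)) = lin n u i" using row[of "n - i - 1"] i by simp
  have vL: "act n v (lin n u i) = Var (n - i - 1)" using vw V unfolding L[symmetric] inv_pair_def by blast
  have "lin n u i \<in> polyR n" unfolding L[symmetric] by (rule act_polyR[OF V])
  then have "sl_elt n ?Q (lin n u i) \<longleftrightarrow> sl_elt n ?K (Var (n - i - 1))"
    using sl_elt_transfer[OF vw QK, of "lin n u i"] sl_elt_transfer[OF inv_pair_sym[OF vw] KQ V] L vL by auto
  then show ?thesis using sl_elt_iff_slcomb by simp
qed

text \<open>From right to left, the forms are completed to a full generic matrix, and its next row
  is a Lefschetz element. From left to right, a Lefschetz element exists for some forms that extend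
  to a good matrix; by openness it can be moved to become the next row of a good matrix with the
  same first rows.\<close>

lemma generic_slp_iff:
  assumes i: "i < n"
  shows "generic (n * i) (\<lambda>v. slp n (ideal_plus n I (lin n v) i)) \<longleftrightarrow> slcomb (gin n I) (n - i)"
proof
  obtain u0 where u0: "zariski_near (n * n) u0 good_rows" by (rule good_rows_near)
  have lin_R: "lin n u j \<in> polyR n" and lin_h: "homog_of_deg 1 (lin n u j)" for u :: "nat \<Rightarrow> 'k" and j
    unfolding lin_def by (rule polyR_linform, rule homog_linform)
  have le: "n * i \<le> n * n" using i by simp
  {
    assume comb: "slcomb (gin n I) (n - i)"
    \<comment> \<open>Positions below \<open>n * i\<close> hold the first \<open>i\<close> rows; the
      others are frozen at a generic matrix.\<close>
    define s where "s = (\<lambda>v k. if k < n * i then v k else u0 k)"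
    have "zariski_near (n * n) (s u0) good_rows" using u0 by (simp add: s_def)
    then have "zariski_near (n * i) u0 (\<lambda>v. good_rows (s v))"
    proof (rule zariski_near_compose)
      show "polyfun (n * i) (\<lambda>v. s v k)" for k
        by (cases "k < n * i") (auto simp: s_def intro: polyfun_coord polyfun_const)
    qed
    then have "zariski_near (n * i) u0 (\<lambda>v. slp n (ideal_plus n I (lin n v) i))"
    proof (rule zariski_near_mono)
      fix v assume "good_rows (s v)"
      then have "sl_elt n (ideal_plus n I (lin n (s v)) i) (lin n (s v) i)" using good_rows_sl[OF _ i] comb by blast
      moreover have "ideal_plus n I (lin n (s v)) i = ideal_plus n I (lin n v) i"
        by (intro ideal_plus_cong lin_cong) (simp add: s_def index_less)
      ultimately show "slp n (ideal_plus n I (lin n v) i)" unfolding slp_iff using lin_R lin_h by metis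
    qed
    then show "generic (n * i) (\<lambda>v. slp n (ideal_plus n I (lin n v) i))" unfolding generic_iff_near by blast
  }
  assume "generic (n * i) (\<lambda>v. slp n (ideal_plus n I (lin n v) i))"
  then obtain a where "zariski_near (n * i) a (\<lambda>v. slp n (ideal_plus n I (lin n v) i))"
    unfolding generic_iff_near by blast
  \<comment> \<open>Viewing the condition on \<open>n * i\<close> coordinates as one on all
    \<open>n * n\<close> makes it comparable with \<open>good_rows\<close>; the common point
    \<open>u1\<close> becomes the new centre.\<close>
  from zariski_near_dim_mono[OF this le] zariski_near_self[OF u0]
  obtain u1 where u1: "slp n (ideal_plus n I (lin n u1) i)" and near1: "zariski_near (n * n) u1 good_rows"
    by (rule zariski_near_common)
  let ?Q = "ideal_plus n I (lin n u1) i"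
  obtain L where L: "L \<in> polyR n" "homog_of_deg 1 L" "sl_elt n ?Q L" using u1 unfolding slp_iff by blast
  define c where "c = (\<lambda>l. lookup L (var_mon l))"
  have Lc: "L = linform n c" using linear_form_eq[OF L(1,2)] unfolding c_def .
  have Q: "is_ideal n ?Q" "homogeneous_ideal ?Q"
    by (rule ideal_plus_ideal[OF ideal lin_R], rule ideal_plus_homogeneous[OF homogeneous lin_h])
  have near2: "zariski_near n c (\<lambda>c'. sl_elt n ?Q (linform n c'))"
    using L(3) by (intro sl_elt_near[OF Q, of D]) (auto simp: Lc intro: ideal_plus_superset D)
  \<comment> \<open>Now the first \<open>i\<close> rows are frozen, which fixes the ideal
    \<open>?Q\<close>, and the remaining rows vary until row \<open>i\<close> is a Lefschetz element
    of a good matrix.\<close>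
  define s where "s = (\<lambda>u k. if k < n * i then u1 k else u k)"
  have "zariski_near (n * n) (s u1) good_rows" using near1 by (simp add: s_def)
  then have n1: "zariski_near (n * n) u1 (\<lambda>u. good_rows (s u))"
  proof (rule zariski_near_compose)
    show "polyfun (n * n) (\<lambda>v. s v k)" if "k < n * n" for k
      using that by (cases "k < n * i") (auto simp: s_def intro: polyfun_coord polyfun_const)
  qed
  define r where "r = (\<lambda>(u :: nat \<Rightarrow> 'k) l. u (i * n + l))"
  define u2 where "u2 = (\<lambda>k. c (k - i * n))"
  have "zariski_near n (r u2) (\<lambda>c'. sl_elt n ?Q (linform n c'))" using near2 by (simp add: r_def u2_def)
  then have n2: "zariski_near (n * n) u2 (\<lambda>u. sl_elt n ?Q (linform n (r u)))"
    by (rule zariski_near_compose) (auto simp: r_def intro!: polyfun_coord index_less i)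
  obtain u where u: "good_rows (s u)" "sl_elt n ?Q (linform n (r u))" using zariski_near_common[OF n1 n2] .
  have "linform n (r u) = lin n u i" by (simp add: lin_def r_def)
  also have "\<dots> = lin n (s u) i" by (intro lin_cong) (simp add: s_def mult.commute)
  finally have "sl_elt n ?Q (lin n (s u) i)" using u(2) by simp
  moreover have "?Q = ideal_plus n I (lin n (s u)) i"
    by (intro ideal_plus_cong lin_cong) (simp add: s_def index_less)
  ultimately show "slcomb (gin n I) (n - i)" using good_rows_sl[OF u(1) i] by simp
qed

end

section \<open>Almost reverse lexicographic ideals\<close>

lemma mon_le_imp_add:
  assumes "\<And>k. lookup a k \<le> lookup (b::mon) k" shows "b = a + (b - a)"
  using assms by (intro poly_mapping_eqI) (simp add: lookup_add lookup_minus)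

lemma mdeg_mono: assumes "\<And>k. lookup a k \<le> lookup b k" shows "mdeg a \<le> mdeg b"
  using arg_cong[OF mon_le_imp_add[OF assms], of mdeg] by simp

lemma mon_eq_of_le: assumes "\<And>k. lookup a k \<le> lookup b k" "mdeg a = mdeg b" shows "a = b"
proof -
  have b: "b = a + (b - a)" by (rule mon_le_imp_add[OF assms(1)])
  have "mdeg b = mdeg a + mdeg (b - a)" by (subst (1) b) (rule mdeg_add)
  then have "mdeg (b - a) = 0" using assms(2) by simp
  then show ?thesis using b by (simp add: mdeg_eq_0_iff)
qed

lemma ex_mon_divisor: "c \<le> mdeg B \<Longrightarrow> \<exists>B' C. B = B' + C \<and> mdeg B' = c"
proof (induction "mdeg B - c" arbitrary: c)
  case 0
  then show ?case by (intro exI[of _ B] exI[of _ 0]) auto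
next
  case (Suc x)
  have "\<exists>B' C. B = B' + C \<and> mdeg B' = Suc c"
    using Suc.hyps(2) Suc.prems by (intro Suc.hyps(1)) auto
  then obtain B' C where B': "B = B' + C" "mdeg B' = Suc c" by blast
  then have "keys B' \<noteq> {}" by auto
  then obtain k where k: "k \<in> keys B'" by blast
  define E where "E = B' - single k 1"
  have E: "B' = single k 1 + E" unfolding E_def
    using k by (intro mon_le_imp_add) (auto simp: lookup_single when_def in_keys_iff)
  have "B = E + (C + single k 1)" unfolding B'(1) E by (simp only: add_ac)
  moreover have "mdeg E = c" using B'(2) E by simp
  ultimately show ?case by blast
qed

lemma split_last_var:
  fixes M :: mon
  assumes "keys M \<subseteq> {..<Suc j}"
  obtains A where "M = A + single j (lookup M j)" "keys A \<subseteq> {..<j}"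
proof -
  let ?A = "M - single j (lookup M j)"
  have "M = single j (lookup M j) + ?A"
    by (intro mon_le_imp_add) (simp add: lookup_single when_def)
  moreover have "k < j" if "k \<in> keys ?A" for k
  proof -
    have "k \<in> keys M" "k \<noteq> j" using that by (auto simp: in_keys_iff lookup_minus lookup_single when_def)
    then show ?thesis using assms by (auto simp: less_Suc_eq)
  qed
  ultimately show ?thesis using that[of ?A] by (auto simp: add.commute)
qed

section \<open>Exponent lists and the functions f_i\<close>

lemma lookup_nth_list: "lookup (Poly_Mapping.nth xs) k = (if k < length xs then xs ! k else 0)"
  by (simp add: nth_default_def)

lemma keys_nth_list: "keys (Poly_Mapping.nth xs) \<subseteq> {..<length xs}"
  by (auto simp: in_keys_iff lookup_nth_list simp del: lookup_nth keys_nth split: if_splits)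

lemma mdeg_nth_list: "mdeg (Poly_Mapping.nth xs) = sum_list xs"
  by (subst mdeg_superset[OF _ keys_nth_list])
    (simp_all add: lookup_nth_list sum_list_sum_nth atLeast0LessThan del: lookup_nth)

lemma fval_le: "Poly_Mapping.nth \<alpha> + single (length \<alpha>) t \<in> G \<Longrightarrow> fval G \<alpha> \<le> enat t"
  by (auto simp: fval_def intro: Least_le)

lemma fval_enat:
  assumes "fval G \<alpha> = enat t"
  shows "Poly_Mapping.nth \<alpha> + single (length \<alpha>) t \<in> G"
  using assms LeastI_ex[of "\<lambda>t. Poly_Mapping.nth \<alpha> + single (length \<alpha>) t \<in> G"]
  by (auto simp: fval_def split: if_splits)

text \<open>Inside this locale the generic initial ideal is represented by these three properties
  alone, and the argument is purely about monomials.\<close>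

locale stable_monomials =
  fixes n :: nat and G :: "mon set"
  assumes vars: "\<mu> \<in> G \<Longrightarrow> keys \<mu> \<subseteq> {..<n}"
    and up: "\<mu> \<in> G \<Longrightarrow> keys \<nu> \<subseteq> {..<n} \<Longrightarrow> \<mu> + \<nu> \<in> G"
    and stable: "\<mu> + single b 1 \<in> G \<Longrightarrow> a < b \<Longrightarrow> b < n \<Longrightarrow> \<mu> + single a 1 \<in> G"
begin

lemma up_le:
  assumes "\<mu> \<in> G" "\<And>k. lookup \<mu> k \<le> lookup \<nu> k" "keys \<nu> \<subseteq> {..<n}" shows "\<nu> \<in> G"
proof -
  have e: "\<nu> = \<mu> + (\<nu> - \<mu>)" by (rule mon_le_imp_add[OF assms(2)])
  have "keys (\<nu> - \<mu>) \<subseteq> keys \<nu>" by (auto simp: in_keys_iff lookup_minus)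
  then have "\<mu> + (\<nu> - \<mu>) \<in> G" using assms(1,3) by (intro up) auto
  then show ?thesis using e by simp
qed

lemma stable_power: "\<mu> + single 1 c \<in> G \<Longrightarrow> 1 < n \<Longrightarrow> \<mu> + single 0 c \<in> G"
proof (induction c arbitrary: \<mu>)
  case (Suc c)
  have "(\<mu> + single 1 c) + single 1 1 \<in> G" using Suc.prems(1) by (simp add: add.assoc single_add[symmetric])
  then have "(\<mu> + single 1 c) + single 0 1 \<in> G" by (rule stable) (use Suc.prems in auto)
  then have "(\<mu> + single 0 1) + single 1 c \<in> G" by (simp add: add_ac)
  then have "(\<mu> + single 0 1) + single 0 c \<in> G" using Suc by blast
  then show ?case by (simp add: add.assoc single_add[symmetric])
qed simp

lemma ex_min_gen: "\<mu> \<in> G \<Longrightarrow> \<exists>g q. min_gen G g \<and> \<mu> = g + q"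
proof (induction "mdeg \<mu>" arbitrary: \<mu> rule: less_induct)
  case less
  show ?case
  proof (cases "min_gen G \<mu>")
    case True
    then show ?thesis by (intro exI[of _ \<mu>] exI[of _ 0]) auto
  next
    case False
    then obtain \<nu> q where \<nu>: "\<nu> \<in> G" "\<mu> = \<nu> + q" "\<nu> \<noteq> \<mu>"
      using less.prems by (auto simp: min_gen_def mon_dvd_def)
    then have "q \<noteq> 0" by auto
    then have "mdeg q \<noteq> 0" by (simp add: mdeg_eq_0_iff)
    then have "mdeg \<nu> < mdeg \<mu>" using \<nu>(2) by simp
    then obtain g r where "min_gen G g" "\<nu> = g + r" using less.hyps \<nu>(1) by blast
    then show ?thesis using \<nu>(2) by (intro exI[of _ g] exI[of _ "r + q"]) (simp add: add.assoc)
  qed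
qed

text \<open>In the variables up to x_j and in the degree of the generator, every monomial with a
  smaller exponent of x_j is larger than the generator and so lies in \<open>G\<close>. Such a
  monomial is found dividing B x_j^b.\<close>

lemma almost_revlex_forces:
  assumes ar: "almost_revlex n G" and g: "min_gen G (A + single j s)"
    and A: "keys A \<subseteq> {..<j}" and B: "keys B \<subseteq> {..<j}" and s: "1 \<le> s" "j < n"
    and deg: "mdeg A < mdeg B" "mdeg A + s \<le> mdeg B + b"
  shows "B + single j b \<in> G"
proof -
  let ?g = "A + single j s"
  have gm: "?g \<in> monset (Suc j) (mdeg A + s)" using A by (auto simp: monset_def keys_add_mon)
  have lg: "lookup ?g j = s" using lookup_beyond[OF A order_refl] by (simp add: lookup_add)
  have Bj: "lookup B j = 0" by (rule lookup_beyond[OF B order_refl])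
  have key: "M \<in> G" if "M \<in> monset (Suc j) (mdeg A + s)" "lookup M j < s" for M
  proof -
    have "mon_gt M ?g" using that lg by (intro mon_gt_last_less[OF that(1) gm]) simp
    then show ?thesis using ar g that(1) gm s(2) unfolding almost_revlex_def monset_def by fastforce
  qed
  have Bk: "keys (B + single j b) \<subseteq> {..<n}" using B s(2) by (auto simp: keys_add_mon)
  show ?thesis
  proof (cases "mdeg A + s \<le> mdeg B")
    case True
    then obtain B' C where B': "B = B' + C" "mdeg B' = mdeg A + s" using ex_mon_divisor by metis
    have "B' \<in> G" using B' B Bj s(1) by (intro key) (auto simp: monset_def keys_add_mon lookup_add)
    then show ?thesis by (rule up_le) (use B' Bk in \<open>auto simp: lookup_add\<close>)
  next
    case False
    \<comment> \<open>The power that raises \<open>B\<close> to the degree of the generator. The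
      first degree hypothesis makes it less than \<open>s\<close>, the second makes it at most
      \<open>b\<close>.\<close>
    define b' where "b' = mdeg A + s - mdeg B"
    have "B + single j b' \<in> G"
      using B Bj False deg(1) by (intro key) (auto simp: monset_def keys_add_mon lookup_add b'_def)
    then show ?thesis
      by (rule up_le) (use Bk False deg(2) in \<open>auto simp: lookup_add lookup_single when_def b'_def\<close>)
  qed
qed

text \<open>If both alternatives fail, some standard \<open>M\<close> enters \<open>G\<close> after
  multiplication by the e-th power, and some standard \<open>M'\<close> of degree d + e has last
  exponent below e. The part of \<open>M'\<close> in the earlier variables then has larger degree
  than that of the generator responsible for \<open>M\<close>, which forces \<open>M'\<close> into
  \<open>G\<close>.\<close>

lemma almost_revlex_imp_slcomb:
  assumes ar: "almost_revlex n G" and m: "1 \<le> m" "m \<le> n"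
  shows "slcomb G m"
proof (rule ccontr)
  assume "\<not> slcomb G m"
  then obtain d e where de: "\<not> (\<forall>M\<in>monset m d. M \<notin> G \<longrightarrow> M + single (m - 1) e \<notin> G)"
    "\<not> (\<forall>M\<in>monset m (d + e). M \<notin> G \<longrightarrow> e \<le> lookup M (m - 1))"
    unfolding slcomb_def by blast
  obtain M where M: "M \<in> monset m d" "M \<notin> G" "M + single (m - 1) e \<in> G" using de(1) by blast
  obtain M' where "M' \<in> monset m (d + e)" "M' \<notin> G" "\<not> e \<le> lookup M' (m - 1)" using de(2) by blast
  then have M': "M' \<in> monset m (d + e)" "M' \<notin> G" "lookup M' (m - 1) < e" by simp_all
  define j where "j = m - 1"
  have j: "m = Suc j" "j < n" using m by (auto simp: j_def)
  obtain g q where g: "min_gen G g" "M + single j e = g + q" using ex_min_gen[OF M(3)] unfolding j_def by blast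
  have le: "lookup g k \<le> lookup (M + single j e) k" for k unfolding g(2) by (simp add: lookup_add)
  have "keys g \<subseteq> keys (M + single j e)" unfolding g(2) by (simp add: keys_add_mon)
  also have "\<dots> \<subseteq> {..<Suc j}" using M(1) j by (auto simp: monset_def keys_add_mon)
  finally obtain A where A: "g = A + single j (lookup g j)" "keys A \<subseteq> {..<j}" by (rule split_last_var)
  let ?s = "lookup g j"
  have "keys M' \<subseteq> {..<Suc j}" using M'(1) j by (simp add: monset_def)
  then obtain B where B: "M' = B + single j (lookup M' j)" "keys B \<subseteq> {..<j}" by (rule split_last_var)
  \<comment> \<open>Otherwise the generator would already divide \<open>M\<close>.\<close>
  have s: "lookup M j < ?s"
  proof (rule ccontr)
    assume "\<not> ?thesis"
    then have lk: "lookup g k \<le> lookup M k" for k using le[of k] by (cases "k = j") (auto simp: lookup_add lookup_single)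
    have "M \<in> G"
    proof (rule up_le[OF _ lk])
      show "g \<in> G" using g(1) by (simp add: min_gen_def)
      show "keys M \<subseteq> {..<n}" using M(1) m(2) by (auto simp: monset_def)
    qed
    then show False using M(2) by simp
  qed
  have "lookup A k \<le> lookup M k" for k
  proof (cases "k < j")
    case True
    have "lookup A k \<le> lookup g k" by (subst A(1)) (simp add: lookup_add)
    then show ?thesis using le[of k] True by (simp add: lookup_add lookup_single)
  next
    case False
    then show ?thesis using lookup_beyond[OF A(2), of k] by simp
  qed
  then have "mdeg A \<le> mdeg M" by (rule mdeg_mono)
  then have Ad: "mdeg A \<le> d" using M(1) by (simp add: monset_def)
  have "mdeg g \<le> mdeg (M + single j e)" by (rule mdeg_mono[OF le])
  then have gd: "mdeg A + ?s \<le> d + e" using arg_cong[OF A(1), of mdeg] M(1) by (simp add: monset_def)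
  have Bd: "mdeg B + lookup M' j = d + e" using arg_cong[OF B(1), of mdeg] M'(1) by (simp add: monset_def)
  have "B + single j (lookup M' j) \<in> G"
  proof (rule almost_revlex_forces[OF ar _ A(2) B(2)])
    show "min_gen G (A + single j ?s)" using g(1) A(1) by simp
    show "1 \<le> ?s" using s by simp
    show "j < n" by (rule j(2))
    have "lookup M' j < e" using M'(3) by (simp add: j_def)
    then show "mdeg A < mdeg B" using Ad Bd by linarith
    show "mdeg A + ?s \<le> mdeg B + lookup M' j" using gd Bd by simp
  qed
  then show False using M'(2) B(1) by simp
qed

text \<open>The last coordinate stays below the first exponent at which the shorter tuple enters
  \<open>G\<close>. The empty tuple carries no such constraint, whence
  \<open>1 \<le> i\<close>.\<close>

lemma Jset_notin:
  assumes "\<alpha> \<in> Jset G i" "1 \<le> i" shows "Poly_Mapping.nth \<alpha> \<notin> G"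
proof
  assume G: "Poly_Mapping.nth \<alpha> \<in> G"
  let ?\<beta> = "take (i - 1) \<alpha>"
  have len: "length \<alpha> = i" and less: "enat (\<alpha> ! (i - 1)) < fval G ?\<beta>"
    using assms by (auto simp: Jset_def)
  have "Poly_Mapping.nth \<alpha> = Poly_Mapping.nth ?\<beta> + single (i - 1) (\<alpha> ! (i - 1))"
    using len assms(2)
    by (intro poly_mapping_eqI) (auto simp: lookup_nth_list lookup_add lookup_single when_def simp del: lookup_nth)
  then have "fval G ?\<beta> \<le> enat (\<alpha> ! (i - 1))" using fval_le[of ?\<beta> "\<alpha> ! (i - 1)" G] G len by simp
  then show False using less by simp
qed

text \<open>A truncation of the exponent vector that already lay in \<open>G\<close> would divide
  \<open>A\<close>. Together with \<open>Jset_notin\<close> this identifies the tuples of positive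
  length with the standard monomials in the corresponding variables.\<close>

lemma Jset_intro:
  assumes "A \<notin> G" "keys A \<subseteq> {..<j}" "j \<le> n"
  shows "map (lookup A) [0..<j] \<in> Jset G j" "Poly_Mapping.nth (map (lookup A) [0..<j]) = A"
proof -
  let ?\<alpha> = "map (lookup A) [0..<j]"
  show eq: "Poly_Mapping.nth ?\<alpha> = A"
    by (rule poly_mapping_eqI) (use lookup_beyond[OF assms(2)] in \<open>simp add: lookup_nth_list del: lookup_nth\<close>)
  have "enat (lookup A l) < fval G (take l ?\<alpha>)" if l: "l < j" for l
  proof (rule ccontr)
    assume "\<not> ?thesis"
    then have "fval G (take l ?\<alpha>) \<le> enat (lookup A l)" by simp
    then obtain t where t: "fval G (take l ?\<alpha>) = enat t" "t \<le> lookup A l"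
      by (cases "fval G (take l ?\<alpha>)") auto
    have "Poly_Mapping.nth (take l ?\<alpha>) + single l t \<in> G" using fval_enat[OF t(1)] l by simp
    then have "A \<in> G"
      by (rule up_le) (use t(2) l assms in \<open>auto simp: lookup_nth_list lookup_add lookup_single when_def simp del: lookup_nth\<close>)
    then show False using assms(1) by simp
  qed
  then show "?\<alpha> \<in> Jset G j" by (simp add: Jset_def)
qed

text \<open>Let t be the value at \<open>\<alpha>\<close>. By minimality of t, a generator dividing
  the corresponding monomial has last exponent exactly t. Either it is the whole monomial, and the
  almost reverse lexicographic property applies directly, or its part in the earlier variables has
  smaller degree and \<open>almost_revlex_forces\<close> applies.\<close>

lemma almost_revlex_imp_fval_le:
  assumes ar: "almost_revlex n G" and i: "1 \<le> i" "i < n"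
    and \<alpha>: "\<alpha> \<in> Jset G i" and \<beta>: "\<beta> \<in> Jset G i"
    and eq: "sum_list \<alpha> = sum_list \<beta>" and gt: "mon_gt (Poly_Mapping.nth \<beta>) (Poly_Mapping.nth \<alpha>)"
  shows "fval G \<beta> \<le> fval G \<alpha>"
proof (cases "fval G \<alpha>")
  case (enat t)
  have len: "length \<alpha> = i" "length \<beta> = i" using \<alpha> \<beta> by (auto simp: Jset_def)
  define a b where "a = Poly_Mapping.nth \<alpha>" and "b = Poly_Mapping.nth \<beta>"
  have ak: "keys a \<subseteq> {..<i}" and bk: "keys b \<subseteq> {..<i}"
    using keys_nth_list[of \<alpha>] keys_nth_list[of \<beta>] len by (auto simp: a_def b_def)
  have deg: "mdeg a = mdeg b" using eq by (simp add: a_def b_def mdeg_nth_list)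
  have aG: "a \<notin> G" unfolding a_def by (rule Jset_notin[OF \<alpha> i(1)])
  have at: "a + single i t \<in> G" using fval_enat[OF enat] len by (simp add: a_def)
  obtain g q where g: "min_gen G g" "a + single i t = g + q" using ex_min_gen[OF at] by blast
  have le: "lookup g k \<le> lookup (a + single i t) k" for k unfolding g(2) by (simp add: lookup_add)
  have "keys g \<subseteq> keys (a + single i t)" unfolding g(2) by (simp add: keys_add_mon)
  also have "\<dots> \<subseteq> {..<Suc i}" using ak by (auto simp: keys_add_mon)
  finally obtain A where A: "g = A + single i (lookup g i)" "keys A \<subseteq> {..<i}" by (rule split_last_var)
  let ?s = "lookup g i"
  have Aa: "lookup A k \<le> lookup a k" for k
  proof (cases "k < i")
    case True
    have "lookup A k \<le> lookup g k" by (subst A(1)) (simp add: lookup_add)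
    then show ?thesis using le[of k] True by (simp add: lookup_add lookup_single)
  next
    case False
    then show ?thesis using lookup_beyond[OF A(2), of k] by simp
  qed
  have "lookup a i = 0" by (rule lookup_beyond[OF ak order_refl])
  then have st: "?s \<le> t" using le[of i] by (simp add: lookup_add)
  have "A + single i ?s \<in> G" using g(1) A(1) by (simp add: min_gen_def)
  then have as: "a + single i ?s \<in> G"
    by (rule up_le) (use Aa ak i in \<open>auto simp: lookup_add keys_add_mon\<close>)
  then have "fval G \<alpha> \<le> enat ?s" using fval_le[of \<alpha> ?s G] len by (simp add: a_def)
  then have s: "?s = t" using st enat by simp
  have t: "1 \<le> t"
  proof (rule ccontr)
    assume "\<not> 1 \<le> t"
    then have "t = 0" by simp
    then show False using at aG by simp
  qed
  have "b + single i t \<in> G"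
  proof (cases "mdeg A = mdeg a")
    case True
    then have "A = a" using Aa by (intro mon_eq_of_le)
    then have "min_gen G (a + single i t)" using g(1) A(1) s by simp
    moreover have "keys (b + single i t) \<subseteq> {..<n}" using bk i by (auto simp: keys_add_mon)
    moreover have "mon_gt (b + single i t) (a + single i t)" using gt by (simp add: a_def b_def)
    ultimately show ?thesis using ar deg unfolding almost_revlex_def by (metis mdeg_add)
  next
    case False
    then have "mdeg A < mdeg b" using mdeg_mono[OF Aa] deg by simp
    then show ?thesis
      using g(1) A(1) s t i by (intro almost_revlex_forces[OF ar _ A(2) bk, of t]) auto
  qed
  then show ?thesis using fval_le[of \<beta> t G] len enat by (simp add: b_def)
qed simp

lemma two_vars_eq:
  assumes "keys a \<subseteq> {..<2}"
  shows "a = single 0 (lookup a 0) + single 1 (lookup a 1)" "mdeg a = lookup a 0 + lookup a 1"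
proof -
  show "a = single 0 (lookup a 0) + single 1 (lookup a 1)"
  proof (rule poly_mapping_eqI)
    fix k
    show "lookup a k = lookup (single 0 (lookup a 0) + single 1 (lookup a 1)) k"
      using lookup_beyond[OF assms, of k] by (cases "k = 0 \<or> k = 1") (auto simp: lookup_add lookup_single when_def)
  qed
  then show "mdeg a = lookup a 0 + lookup a 1" using mdeg_add mdeg_single by metis
qed

text \<open>In a fixed degree, a monomial in two variables is determined by one exponent, and the
  exchanges of the second variable for the first that stability allows lead from \<open>A\<close> to
  \<open>B\<close>; the factor \<open>\<rho>\<close> is carried along.\<close>

lemma stable_two_vars:
  assumes "1 < n" "keys \<rho> \<subseteq> {..<n}" "keys A \<subseteq> {..<2}" "keys B \<subseteq> {..<2}" "mdeg A = mdeg B"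
    and "lookup B 1 \<le> lookup A 1" and "A + \<rho> \<in> G"
  shows "B + \<rho> \<in> G"
proof -
  define c where "c = lookup A 1 - lookup B 1"
  define \<mu> where "\<mu> = single 0 (lookup A 0) + single 1 (lookup B 1) + \<rho>"
  have "A = single 0 (lookup A 0) + single 1 (lookup B 1) + single 1 c"
    using two_vars_eq(1)[OF assms(3)] assms(6) by (simp add: c_def add.assoc single_add[symmetric])
  then have "A + \<rho> = \<mu> + single 1 c" by (simp add: \<mu>_def add_ac)
  then have "\<mu> + single 0 c \<in> G" using assms(1,7) by (intro stable_power) auto
  moreover have "lookup B 0 = lookup A 0 + c"
    using two_vars_eq(2)[OF assms(3)] two_vars_eq(2)[OF assms(4)] assms(5,6) by (simp add: c_def)
  then have "B = single 0 (lookup A 0) + single 0 c + single 1 (lookup B 1)"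
    using two_vars_eq(1)[OF assms(4)] by (simp add: single_add[symmetric])
  then have "B + \<rho> = \<mu> + single 0 c" by (simp add: \<mu>_def add_ac)
  ultimately show ?thesis by simp
qed

text \<open>A failure consists of a minimal generator and a larger monomial outside
  \<open>G\<close>; comparing their exponents of the generator's last variable decides which
  hypothesis is contradicted.\<close>

lemma slcomb_fval_imp_almost_revlex:
  assumes sl: "\<And>m. 3 \<le> m \<Longrightarrow> m \<le> n \<Longrightarrow> slcomb G m"
    and f: "\<And>i \<alpha> \<beta>. 3 \<le> i \<Longrightarrow> i < n \<Longrightarrow> \<alpha> \<in> Jset G i \<Longrightarrow> \<beta> \<in> Jset G i \<Longrightarrow> sum_list \<alpha> = sum_list \<beta> \<Longrightarrow>
      mon_gt (Poly_Mapping.nth \<beta>) (Poly_Mapping.nth \<alpha>) \<Longrightarrow> fval G \<beta> \<le> fval G \<alpha>"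
  shows "almost_revlex n G"
  unfolding almost_revlex_def
proof (intro allI impI, elim conjE, rule ccontr)
  fix g M assume g: "min_gen G g" and M: "keys M \<subseteq> {..<n}" "mdeg M = mdeg g" "mon_gt M g" "M \<notin> G"
  have gG: "g \<in> G" using g by (simp add: min_gen_def)
  have "g \<noteq> 0" using M(2,3) by (metis mdeg_eq_0_iff mon_gt_irrefl)
  then have ne: "keys g \<noteq> {}" by simp
  define j where "j = Max (keys g)"
  have jk: "j \<in> keys g" unfolding j_def by (intro Max_in ne finite_keys)
  then have j: "j < n" using vars[OF gG] by auto
  have gk: "keys g \<subseteq> {..<Suc j}" using Max_ge[OF finite_keys[of g]] by (auto simp: j_def less_Suc_eq_le)
  \<comment> \<open>A variable beyond those of \<open>g\<close> would make \<open>M\<close> the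
    smaller monomial.\<close>
  have Mk: "keys M \<subseteq> {..<Suc j}"
  proof (rule ccontr)
    assume "\<not> ?thesis"
    then have "mon_gt g M" using M(2) gk by (intro mon_gt_of_larger_var) auto
    then show False using M(3) mon_gt_asym by blast
  qed
  obtain A where A: "g = A + single j (lookup g j)" "keys A \<subseteq> {..<j}" using gk by (rule split_last_var)
  obtain B where B: "M = B + single j (lookup M j)" "keys B \<subseteq> {..<j}" using Mk by (rule split_last_var)
  let ?s = "lookup g j" and ?b = "lookup M j"
  have s: "1 \<le> ?s" using jk by (simp add: in_keys_iff)
  have gm: "g \<in> monset (Suc j) (mdeg g)" "M \<in> monset (Suc j) (mdeg g)" using gk Mk M(2) by (auto simp: monset_def)
  have bs: "?b \<le> ?s" using mon_gt_last_le[OF gm(2,1) M(3)] by simp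
  have dg: "mdeg g = mdeg A + ?s" using arg_cong[OF A(1), of mdeg] by simp
  have dM: "mdeg g = mdeg B + ?b" using arg_cong[OF B(1), of mdeg] M(2) by simp
  have AG: "A \<notin> G"
  proof
    assume "A \<in> G"
    moreover have "mon_dvd A g" unfolding mon_dvd_def using A(1) by blast
    moreover have "A \<noteq> g" using s dg by auto
    ultimately show False using g by (auto simp: min_gen_def)
  qed
  have BG: "B \<notin> G"
  proof
    assume "B \<in> G"
    moreover have "keys (single j ?b) \<subseteq> {..<n}" using j by simp
    ultimately have "B + single j ?b \<in> G" by (rule up)
    then show False using M(4) B(1) by simp
  qed
  show False
  proof (cases "?b < ?s")
    case True
    show ?thesis
    proof (cases "j \<ge> 2")
      case True
      \<comment> \<open>The first alternative fails at the standard monomial \<open>A\<close> with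
        exponent \<open>?s\<close>, so every standard monomial of this degree in these variables has
        last exponent at least \<open>?s\<close>; this excludes \<open>M\<close>.\<close>
      have "slcomb G (Suc j)" using True j by (intro sl) auto
      moreover have "A \<in> monset (Suc j) (mdeg A)" using A(2) by (auto simp: monset_def)
      moreover have "A + single (Suc j - 1) ?s \<in> G" using A(1) gG by simp
      moreover have "M \<in> monset (Suc j) (mdeg A + ?s)" using gm(2) dg by simp
      ultimately have "?s \<le> lookup M (Suc j - 1)" using AG M(4) unfolding slcomb_def by blast
      then show ?thesis using \<open>?b < ?s\<close> by simp
    next
      case False
      show ?thesis
      proof (cases "j = 0")
        case True
        then have "A = 0" "B = 0" using A(2) B(2) by auto
        then show ?thesis using dg dM \<open>?b < ?s\<close> by simp
      next
        case j0: False
        then have j1: "j = 1" using False by simp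
        \<comment> \<open>For \<open>j\<close> = 1 the whole comparison takes place in two
          variables, so the common factor is trivial.\<close>
        have "M + 0 \<in> G"
          using gG gk Mk M(2) bs j by (intro stable_two_vars[of 0 g M]) (auto simp: j1 numeral_2_eq_2)
        then show ?thesis using M(4) by simp
      qed
    qed
  next
    case False
    then have b: "?b = ?s" using bs by simp
    have dAB: "mdeg A = mdeg B" using dg dM b by simp
    have gt: "mon_gt B A"
    proof -
      have "mon_gt (B + single j ?s) (A + single j ?s)" using M(3) A(1) B(1) b by simp
      then show ?thesis by simp
    qed
    have "B + single j ?s \<in> G"
    proof (cases "j \<ge> 3")
      case True
      \<comment> \<open>\<open>A\<close> and \<open>B\<close> are standard of equal degree, so the
        condition on \<open>fval\<close> compares the powers of x_j with which they enter
        \<open>G\<close>.\<close>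
      note JA = Jset_intro[OF AG A(2) less_imp_le[OF j]] and JB = Jset_intro[OF BG B(2) less_imp_le[OF j]]
      let ?\<alpha> = "map (lookup A) [0..<j]" and ?\<beta> = "map (lookup B) [0..<j]"
      have "fval G ?\<beta> \<le> fval G ?\<alpha>"
      proof (rule f[OF True j JA(1) JB(1)])
        show "sum_list ?\<alpha> = sum_list ?\<beta>" unfolding mdeg_nth_list[symmetric] JA(2) JB(2) by (rule dAB)
        show "mon_gt (Poly_Mapping.nth ?\<beta>) (Poly_Mapping.nth ?\<alpha>)" unfolding JA(2) JB(2) by (rule gt)
      qed
      also have "fval G ?\<alpha> \<le> enat ?s"
        using fval_le[of ?\<alpha> ?s G] gG A(1) unfolding JA(2) by simp
      finally obtain t where t: "fval G ?\<beta> = enat t" "t \<le> ?s" by (cases "fval G ?\<beta>") auto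
      have "B + single j t \<in> G" using fval_enat[OF t(1)] unfolding JB(2) by simp
      then show ?thesis
        by (rule up_le) (use t(2) B(2) j in \<open>auto simp: lookup_add lookup_single when_def keys_add_mon\<close>)
    next
      case False
      then have k2: "keys A \<subseteq> {..<2}" "keys B \<subseteq> {..<2}" using A(2) B(2) by auto
      show ?thesis
      proof (cases "j = 2")
        case True
        have "lookup B 1 \<le> lookup A 1"
          using mon_gt_last_le[of B 2 "mdeg A" A] k2 gt dAB by (simp add: monset_def)
        then show ?thesis
          using k2 dAB gG A(1) True j by (intro stable_two_vars[of "single j ?s" A B]) auto
      next
        case j2: False
        \<comment> \<open>With at most one variable left, a monomial is determined by its degree, so
          no strict comparison is possible.\<close>
        then have "keys A \<subseteq> {..<1}" "keys B \<subseteq> {..<1}" using A(2) B(2) False by auto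
        then have "lookup A 1 = 0" "lookup B 1 = 0" using lookup_beyond[of _ 1 1] by auto
        moreover from this have "lookup A 0 = lookup B 0"
          using two_vars_eq(2)[OF k2(1)] two_vars_eq(2)[OF k2(2)] dAB by simp
        ultimately have "A = B"
          by (intro trans[OF two_vars_eq(1)[OF k2(1)] trans[OF _ two_vars_eq(1)[OF k2(2), symmetric]]]) simp
        then show ?thesis using gt by simp
      qed
    qed
    then show False using M(4) B(1) b by simp
  qed
qed

end

theorem theorem2p7:
  fixes I :: "'k::field_char_0 mpoly set" and n :: nat
  assumes "is_ideal n I" and "homogeneous_ideal I" and "artinian n I"
  shows "almost_revlex n (gin n I) \<longleftrightarrow>
    ((\<forall>i. i + 3 \<le> n \<longrightarrow> generic (n * i) (\<lambda>v. slp n (ideal_plus n I (lin n v) i))) \<and>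
     (\<forall>i. 3 \<le> i \<and> i \<le> n - 1 \<longrightarrow>
        (\<forall>\<alpha>\<in>Jset (gin n I) i. \<forall>\<beta>\<in>Jset (gin n I) i.
           sum_list \<alpha> = sum_list \<beta> \<and> mon_gt (Poly_Mapping.nth \<beta>) (Poly_Mapping.nth \<alpha>)
           \<longrightarrow> fval (gin n I) \<beta> \<le> fval (gin n I) \<alpha>)))"
proof -
  interpret homog_artinian n I by unfold_locales (fact assms)+
  obtain v0 w0 where g: "init_mons n (gact n v0 I) = gin n I" by (rule gin_generic)
  interpret stable_monomials n "gin n I"
  proof
    show "keys \<mu> \<subseteq> {..<n}" if "\<mu> \<in> gin n I" for \<mu>
      using that unfolding g[symmetric] by (simp add: init_mons_def)
    show "\<mu> + \<nu> \<in> gin n I" if \<mu>: "\<mu> \<in> gin n I" and \<nu>: "keys \<nu> \<subseteq> {..<n}" for \<mu> \<nu>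
    proof -
      obtain p q where "keys \<mu> \<subseteq> {..<n}" "p \<in> gact n v0 I" "p \<noteq> 0" "\<mu> = lm p + q"
        using \<mu> unfolding g[symmetric] init_mons_def mon_dvd_def by blast
      then show ?thesis unfolding g[symmetric] init_mons_def mon_dvd_def
        using \<nu> by (auto simp: keys_add_mon intro!: bexI[of _ p] exI[of _ "q + \<nu>"] simp: add.assoc)
    qed
    show "\<mu> + single a 1 \<in> gin n I" if "\<mu> + single b 1 \<in> gin n I" "a < b" "b < n" for \<mu> a b
      using that by (rule gin_strongly_stable)
  qed
  \<comment> \<open>Killing i forms leaves m = n - i variables, which turns the range of i into 3
    \<le> m \<le> n.\<close>
  have sl: "(\<forall>i. i + 3 \<le> n \<longrightarrow> generic (n * i) (\<lambda>v. slp n (ideal_plus n I (lin n v) i))) \<longleftrightarrow>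
      (\<forall>m. 3 \<le> m \<longrightarrow> m \<le> n \<longrightarrow> slcomb (gin n I) m)" (is "?S \<longleftrightarrow> ?T")
  proof
    assume ?S
    show ?T
    proof (intro allI impI)
      fix m assume m: "3 \<le> m" "m \<le> n"
      then have "generic (n * (n - m)) (\<lambda>v. slp n (ideal_plus n I (lin n v) (n - m)))" using \<open>?S\<close> by simp
      then show "slcomb (gin n I) m" using generic_slp_iff[of "n - m"] m by simp
    qed
  next
    assume ?T
    then show ?S using generic_slp_iff by simp
  qed
  show ?thesis unfolding sl
  proof (intro iffI conjI allI impI ballI; (elim conjE)?)
    fix m assume "almost_revlex n (gin n I)" "3 \<le> m" "m \<le> n"
    then show "slcomb (gin n I) m" by (intro almost_revlex_imp_slcomb) auto
  next
    fix i \<alpha> \<beta>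
    assume "almost_revlex n (gin n I)" "3 \<le> i" "i \<le> n - 1" "\<alpha> \<in> Jset (gin n I) i" "\<beta> \<in> Jset (gin n I) i"
      "sum_list \<alpha> = sum_list \<beta>" "mon_gt (Poly_Mapping.nth \<beta>) (Poly_Mapping.nth \<alpha>)"
    then show "fval (gin n I) \<beta> \<le> fval (gin n I) \<alpha>" by (intro almost_revlex_imp_fval_le[of i]) auto
  next
    assume "\<forall>m. 3 \<le> m \<longrightarrow> m \<le> n \<longrightarrow> slcomb (gin n I) m"
      and "\<forall>i. 3 \<le> i \<and> i \<le> n - 1 \<longrightarrow>
        (\<forall>\<alpha>\<in>Jset (gin n I) i. \<forall>\<beta>\<in>Jset (gin n I) i.
           sum_list \<alpha> = sum_list \<beta> \<and> mon_gt (Poly_Mapping.nth \<beta>) (Poly_Mapping.nth \<alpha>)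
           \<longrightarrow> fval (gin n I) \<beta> \<le> fval (gin n I) \<alpha>)"
    then show "almost_revlex n (gin n I)"
      by (intro slcomb_fval_imp_almost_revlex) auto
  qed
qed

end
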